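(* Let $X\subset\mathbb{P}^4$ be a cubic threefold with $2\mathsf D_4$-singularities, given by $x_1x_2x_3+f_3(x_3,x_4,x_5)=0$ for a cubic form $f_3$, and admitting the action of $H:=\langle\sigma_{(12)},\sigma_{(45)}\rangle$, where $$\sigma_{(12)}:(x_1,x_2,x_3,x_4,x_5)\mapsto(x_2,x_1,x_3,x_4,x_5),\qquad \sigma_{(45)}:(x_1,x_2,x_3,x_4,x_5)\mapsto(x_1,x_2,x_3,x_5,x_4).$$ Then, for any finite subgroup $G\subseteq\mathrm{Aut}(X)$ containing $H$, the $G$-action on $X$ is not linearizable.
   Context: The ground field $k$ is an uncountable algebraically closed field of characteristic zero. "$X$ has $2\mathsf D_4$-singularities" means that the singular locus of $X$ consists of exactly two points, both of type $\mathsf D_4$; up to isomorphism every such $X$ is given by an equation of the displayed form, with singular points $[1:0:0:0:0]$ and $[0:1:0:0:0]$. The $G$-action on $X$ is linearizable if $X$ is $G$-equivariantly birational to $\mathbb{P}(V)$ for some linear representation $V$ of $G$. *)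

theory Defs
  imports
    "HOL-Analysis.Analysis"
    "HOL-Algebra.Bij"
    "HOL-Algebra.Generated_Groups"
    "HOL-Library.Poly_Mapping"
begin

section \<open>Polynomials in finitely many variables\<close>

type_synonym ('n, 'k) mpoly = "('n \<Rightarrow>\<^sub>0 nat) \<Rightarrow>\<^sub>0 'k"

definition Var :: "'n \<Rightarrow> ('n, 'k::comm_ring_1) mpoly"
  where "Var i = Poly_Mapping.single (Poly_Mapping.single i 1) 1"

text \<open>Value of a polynomial at a point of a commutative \<open>'k\<close>-algebra \<open>'r\<close> whose structure map
  is \<open>c\<close>.\<close>

definition eval_in ::
  "('k::zero \<Rightarrow> 'r::comm_ring_1) \<Rightarrow> ('n::finite \<Rightarrow> 'r) \<Rightarrow> ('n, 'k) mpoly \<Rightarrow> 'r"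
  where "eval_in c a f =
    (\<Sum>m\<in>Poly_Mapping.keys f. c (Poly_Mapping.lookup f m) * (\<Prod>i\<in>UNIV. a i ^ Poly_Mapping.lookup m i))"

definition peval :: "('n::finite, 'k::comm_ring_1) mpoly \<Rightarrow> 'k^'n \<Rightarrow> 'k"
  where "peval f v = eval_in id (\<lambda>i. v $ i) f"

definition homogeneous :: "nat \<Rightarrow> ('n::finite, 'k::zero) mpoly \<Rightarrow> bool"
  where "homogeneous d f \<longleftrightarrow>
    (\<forall>m\<in>Poly_Mapping.keys f. (\<Sum>i\<in>UNIV. Poly_Mapping.lookup m i) = d)"

definition in_variables :: "'n set \<Rightarrow> ('n, 'k::zero) mpoly \<Rightarrow> bool"
  where "in_variables I f \<longleftrightarrow>
    (\<forall>m\<in>Poly_Mapping.keys f. Poly_Mapping.keys m \<subseteq> I)"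

definition partial_deriv :: "'n \<Rightarrow> ('n, 'k::comm_ring_1) mpoly \<Rightarrow> ('n, 'k) mpoly"
  where "partial_deriv i f =
    (\<Sum>m\<in>Poly_Mapping.keys f.
      Poly_Mapping.single (m - Poly_Mapping.single i 1)
        (of_nat (Poly_Mapping.lookup m i) * Poly_Mapping.lookup f m))"


section \<open>Projective varieties\<close>

text \<open>A point of \<open>\<P>(k\<^sup>n)\<close> is a line through the origin, as a set of vectors. The field will be
  algebraically closed, so a variety is identified with its set of \<open>k\<close>-points.\<close>

definition line :: "'k::field^'n \<Rightarrow> ('k^'n) set"
  where "line v = vec.span {v}"

definition proj_space :: "('k::field^'n) set set"
  where "proj_space = {line v |v. v \<noteq> 0}"

definition hypersurface :: "('n::finite, 'k::field) mpoly \<Rightarrow> ('k^'n) set set"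
  where "hypersurface F = {line v |v. v \<noteq> 0 \<and> peval F v = 0}"

definition zariski_closed :: "('k::field^'n::finite) set set \<Rightarrow> bool"
  where "zariski_closed Z \<longleftrightarrow>
    (\<exists>S. (\<forall>f\<in>S. \<exists>d. homogeneous d f) \<and>
         Z = {line v |v. v \<noteq> 0 \<and> (\<forall>f\<in>S. peval f v = 0)})"

definition zariski_open_in ::
  "('k::field^'n::finite) set set \<Rightarrow> ('k^'n) set set \<Rightarrow> bool"
  where "zariski_open_in X U \<longleftrightarrow> (\<exists>Z. zariski_closed Z \<and> U = X - Z)"

definition peval_map :: "('m::finite \<Rightarrow> ('n::finite, 'k::field) mpoly) \<Rightarrow> 'k^'n \<Rightarrow> 'k^'m"
  where "peval_map g v = (\<chi> i. peval (g i) v)"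

text \<open>A map on a locally closed set \<open>U\<close> is regular if near every point it is given by homogeneous
  polynomials of one common degree. The formula may be required on all of
  \<open>{g \<noteq> 0} \<inter> U\<close>: if it only holds on a smaller neighbourhood, multiply \<open>g\<close> by a form
  vanishing outside that neighbourhood.\<close>

definition regular_on ::
  "('k::field^'n::finite) set set \<Rightarrow> (('k^'n) set \<Rightarrow> ('k^'m::finite) set) \<Rightarrow> bool"
  where "regular_on U \<phi> \<longleftrightarrow>
    (\<forall>v. v \<noteq> 0 \<and> line v \<in> U \<longrightarrow>
      (\<exists>d g. (\<forall>i. homogeneous d (g i)) \<and> peval_map g v \<noteq> 0 \<and>
        (\<forall>w. w \<noteq> 0 \<and> line w \<in> U \<and> peval_map g w \<noteq> 0 \<longrightarrow> \<phi> (line w) = line (peval_map g w))))"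

definition biregular ::
  "('k::field^'n::finite) set set \<Rightarrow> ('k^'m::finite) set set \<Rightarrow> (('k^'n) set \<Rightarrow> ('k^'m) set) \<Rightarrow> bool"
  where "biregular U W \<phi> \<longleftrightarrow>
    bij_betw \<phi> U W \<and> regular_on U \<phi> \<and> regular_on W (inv_into U \<phi>)"

text \<open>The group of all automorphisms of the variety \<open>X\<close> (not only those induced by linear
  maps). As in \<^const>\<open>BijGroup\<close>, its elements are functions restricted to \<open>X\<close>.\<close>

definition Aut :: "('k::field^'n::finite) set set \<Rightarrow> (('k^'n) set \<Rightarrow> ('k^'n) set) monoid"
  where "Aut X = (BijGroup X)\<lparr>carrier := {\<phi> \<in> Bij X. biregular X X \<phi>}\<rparr>"


section \<open>Linearizable actions\<close>

text \<open>Equivariant birationality of irreducible \<open>X\<close> and \<open>Y\<close>, on which the elements of \<open>G\<close> act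
  through \<open>a\<close> and \<open>b\<close>: an isomorphism between nonempty (hence dense) open subsets that commutes
  with the actions wherever both sides are defined.\<close>

definition equivariantly_birational ::
  "'g set \<Rightarrow> ('g \<Rightarrow> ('k::field^'n::finite) set \<Rightarrow> ('k^'n) set) \<Rightarrow> ('k^'n) set set \<Rightarrow>
   ('g \<Rightarrow> ('k^'m::finite) set \<Rightarrow> ('k^'m) set) \<Rightarrow> ('k^'m) set set \<Rightarrow> bool"
  where "equivariantly_birational G a X b Y \<longleftrightarrow>
    (\<exists>U W \<phi>. zariski_open_in X U \<and> U \<noteq> {} \<and> zariski_open_in Y W \<and> W \<noteq> {} \<and> biregular U W \<phi> \<and>
      (\<forall>g\<in>G. \<forall>p\<in>U. a g p \<in> U \<longrightarrow> \<phi> (a g p) = b g (\<phi> p)))"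

definition GL :: "('k::field^'m^'m) monoid"
  where "GL = \<lparr>carrier = {A. invertible A}, mult = (**), one = mat 1\<rparr>"

text \<open>Linearizability by a representation on \<open>V = k\<^sup>m\<close>. The dimension is a type parameter, so
  that an action is not linearizable iff this fails for every finite type \<open>'m\<close>.\<close>

definition linearizable ::
  "'m::finite itself \<Rightarrow> ('k::field^'n::finite) set set \<Rightarrow> (('k^'n) set \<Rightarrow> ('k^'n) set) set \<Rightarrow> bool"
  where "linearizable (_ :: 'm itself) X G \<longleftrightarrow>
    (\<exists>\<rho> :: _ \<Rightarrow> 'k^'m^'m. \<rho> \<in> hom ((Aut X)\<lparr>carrier := G\<rparr>) GL \<and>
      equivariantly_birational G (\<lambda>g. g) X (\<lambda>g p. (\<lambda>v. \<rho> g *v v) ` p) proj_space)"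


section \<open>Three-dimensional \<open>D\<^sub>4\<close>-singularities\<close>

text \<open>The formal power series ring \<open>k[[t\<^sub>1,t\<^sub>2,t\<^sub>3,t\<^sub>4]]\<close>, as an iterated ring of
  series in one variable.\<close>

type_synonym 'k fps4 = "'k fps fps fps fps"

definition const4 :: "'k::field \<Rightarrow> 'k fps4"
  where "const4 c = fps_const (fps_const (fps_const (fps_const c)))"

definition t1 :: "'k::field fps4" where "t1 = fps_X"
definition t2 :: "'k::field fps4" where "t2 = fps_const fps_X"
definition t3 :: "'k::field fps4" where "t3 = fps_const (fps_const fps_X)"
definition t4 :: "'k::field fps4" where "t4 = fps_const (fps_const (fps_const fps_X))"

definition fps4_automorphism :: "('k::field fps4 \<Rightarrow> 'k fps4) \<Rightarrow> bool"
  where "fps4_automorphism \<theta> \<longleftrightarrow>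
    bij \<theta> \<and> (\<forall>f g. \<theta> (f + g) = \<theta> f + \<theta> g) \<and> (\<forall>f g. \<theta> (f * g) = \<theta> f * \<theta> g) \<and>
    (\<forall>c. \<theta> (const4 c) = const4 c)"

text \<open>Equivalently, the complete local rings \<open>k[[t]]/(f)\<close> and \<open>k[[t]]/(g)\<close> are isomorphic.\<close>

definition contact_equivalent :: "'k::field fps4 \<Rightarrow> 'k fps4 \<Rightarrow> bool"
  where "contact_equivalent f g \<longleftrightarrow> (\<exists>\<theta> u. fps4_automorphism \<theta> \<and> u dvd 1 \<and> \<theta> f = u * g)"

definition D4_normal_form :: "'k::field fps4"
  where "D4_normal_form = t1^2 + t2^2 + t3^2 * t4 + t4^3"

text \<open>The equation of a hypersurface at the point \<open>line v\<close> in the affine coordinates in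
  which \<open>(t\<^sub>1,...,t\<^sub>4)\<close> stands for \<open>line (v + t\<^sub>1 w\<^sub>1 + ... + t\<^sub>4 w\<^sub>4)\<close>, where
  \<open>v, w\<^sub>1, ..., w\<^sub>4\<close> is a basis of \<open>k\<^sup>5\<close>.\<close>

definition local_equation ::
  "(5, 'k::field) mpoly \<Rightarrow> 'k^5 \<Rightarrow> 'k^5 \<Rightarrow> 'k^5 \<Rightarrow> 'k^5 \<Rightarrow> 'k^5 \<Rightarrow> 'k fps4"
  where "local_equation F v w1 w2 w3 w4 =
    eval_in const4
      (\<lambda>i. const4 (v $ i) + const4 (w1 $ i) * t1 + const4 (w2 $ i) * t2
             + const4 (w3 $ i) * t3 + const4 (w4 $ i) * t4) F"

definition D4_singularity_at :: "(5, 'k::field) mpoly \<Rightarrow> ('k^5) set \<Rightarrow> bool"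
  where "D4_singularity_at F p \<longleftrightarrow>
    (\<exists>v w1 w2 w3 w4. p = line v \<and> vec.span {v, w1, w2, w3, w4} = UNIV \<and>
      contact_equivalent (local_equation F v w1 w2 w3 w4) D4_normal_form)"

definition singular_locus :: "('n::finite, 'k::field) mpoly \<Rightarrow> ('k^'n) set set"
  where "singular_locus F =
    {line v |v. v \<noteq> 0 \<and> peval F v = 0 \<and> (\<forall>i. peval (partial_deriv i F) v = 0)}"

definition has_2D4_singularities :: "(5, 'k::field) mpoly \<Rightarrow> bool"
  where "has_2D4_singularities F \<longleftrightarrow>
    card (singular_locus F) = 2 \<and> (\<forall>p\<in>singular_locus F. D4_singularity_at F p)"


section \<open>The cubic threefolds and the involutions\<close>

text \<open>Coordinates are indexed by \<open>1, 2, 3, 4, 5\<close> of the type \<open>5\<close>, in which \<open>5 = 0\<close>.\<close>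

lemma UNIV_5: "(UNIV :: 5 set) = {1, 2, 3, 4, 5}"
proof -
  have "card {1, 2, 3, 4, 5 :: 5} = CARD(5)" by simp
  then show ?thesis using card_subset_eq[of "UNIV :: 5 set" "{1, 2, 3, 4, 5}"] by simp
qed

lemma vector_5:
  "(vector [a, b, c, d, e] :: 'a::zero^5) $ 1 = a"
  "(vector [a, b, c, d, e] :: 'a::zero^5) $ 2 = b"
  "(vector [a, b, c, d, e] :: 'a::zero^5) $ 3 = c"
  "(vector [a, b, c, d, e] :: 'a::zero^5) $ 4 = d"
  "(vector [a, b, c, d, e] :: 'a::zero^5) $ 5 = e"
  by (simp_all add: vector_def)

definition cubic_form_2D4 :: "(5, 'k::field) mpoly \<Rightarrow> (5, 'k) mpoly"
  where "cubic_form_2D4 f3 = Var 1 * Var 2 * Var 3 + f3"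

definition swap12 :: "'k::field^5 \<Rightarrow> 'k^5"
  where "swap12 x = vector [x $ 2, x $ 1, x $ 3, x $ 4, x $ 5]"

definition swap45 :: "'k::field^5 \<Rightarrow> 'k^5"
  where "swap45 x = vector [x $ 1, x $ 2, x $ 3, x $ 5, x $ 4]"

text \<open>The map on the points of \<open>X\<close> induced by a linear map.\<close>

definition induced_on ::
  "('k::field^'n) set set \<Rightarrow> ('k^'n \<Rightarrow> 'k^'n) \<Rightarrow> ('k^'n) set \<Rightarrow> ('k^'n) set"
  where "induced_on X T = (\<lambda>p\<in>X. T ` p)"

end

theory Submission
  imports Defs "HOL-Computational_Algebra.Formal_Laurent_Series" "HOL-Algebra.Algebraic_Closure_Type"
begin

text \<open>
  Let \<open>E\<close> be the plane cubic cut out on \<open>X\<close> by \<open>x\<^sub>1 = x\<^sub>2\<close> and \<open>x\<^sub>4 = x\<^sub>5\<close>. It is fixed pointwise by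
  the two involutions, and it is a smooth elliptic curve: if \<open>T = x\<^sub>4 + x\<^sub>5\<close> and \<open>V = x\<^sub>4 - x\<^sub>5\<close>, then the
  equation of \<open>X\<close> at \<open>x\<^sub>3 = 1\<close> is, up to scaling, \<open>x\<^sub>1 x\<^sub>2 = q(T) + V\<^sup>2 l(T)\<close> with a cubic \<open>q\<close> and a
  linear polynomial \<open>l\<close>, and a double root of \<open>q\<close> or a vanishing leading coefficient would give
  further singular points of \<open>X\<close>. The surface \<open>x\<^sub>1 = x\<^sub>2\<close> and the curve \<open>E\<close> in it define a valuation
  of rank 2 of the function field \<open>K\<close> of \<open>X\<close>, with value group \<open>\<int>\<^sup>2\<close> and residue field \<open>k(E)\<close>. In suitable
  local parameters \<open>u\<close>, \<open>w\<close> of this flag one involution is \<open>u \<mapsto> -u\<close> and the other is \<open>w \<mapsto> -w\<close>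
  (\<open>swap_gen\<close>).

  Suppose that \<open>X\<close> is equivariantly birational to \<open>\<P>(V)\<close>. A tangent space argument
  (\<open>dimension_bound\<close>) shows that \<open>V\<close> has dimension at most 4. The images of the two commuting
  involutions in \<open>GL(V)\<close> are simultaneously diagonalizable, so \<open>K\<close> is generated by at most three
  functions on which both involutions act by signs. These signs are the parities of the values, and
  the involutions act faithfully on \<open>K\<close>; hence two of the generators, \<open>x\<close> and \<open>y\<close>, have linearly independent
  values. On \<open>k(x, y)\<close> the valuation is then monomial, its residue field is \<open>k\<close>, and \<open>K\<close> is generated
  over \<open>k(x, y)\<close> by one element. By the ruled residue theorem, of which \<open>ruled_residue\<close> is the case
  needed here, the residue field of \<open>K\<close> lies in \<open>k(\<tau>)\<close> for some \<open>\<tau>\<close>. So \<open>E\<close> would have a nonconstant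
  rational parametrization, which \<open>cubic_curve_not_rational\<close> excludes by infinite descent.

  Rational functions on \<open>X\<close> are represented by their values at a generic point. A form vanishes on
  \<open>X\<close> iff it vanishes at the generic point over \<open>k[T, V, A]\<close> with \<open>A = x\<^sub>1/x\<^sub>3\<close> (\<open>density\<close>), and this
  point is mapped into iterated Laurent series in \<open>w\<close> and \<open>u\<close> over an algebraically closed field
  that contains \<open>k(E)\<close>, where values and leading coefficients can be read off.
\<close>

hide_const (open) Coset.order Polynomials.degree Polynomials.lead_coeff
  UnivPoly.up_ring.coeff UnivPoly.up_ring.monom Module.module.smult
no_notation Polynomials.var (\<open>X\<index>\<close>)
no_notation fps_nth (infixl \<open>$\<close> 75)

section \<open>Cubic curves without rational parametrization\<close>

text \<open>Over an algebraically closed field a polynomial is determined up to a constant by its roots with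
  multiplicities, and constants are squares; the proof splits off a squared linear factor.\<close>

lemma square_if_even_orders:
  fixes p :: "'a::alg_closed_field poly"
  assumes "p \<noteq> 0" and "\<And>x. even (order x p)"
  shows "\<exists>r. p = r ^ 2"
  using assms
proof (induction "degree p" arbitrary: p rule: less_induct)
  case less
  show ?case
  proof (cases "degree p = 0")
    case True
    then obtain c where c: "p = [:c:]" by (elim degree_eq_zeroE)
    obtain d where "d ^ 2 = c" using nth_root_exists[of 2 c] by auto
    then have "p = [:d:] ^ 2" using c by (simp add: power2_eq_square)
    then show ?thesis by blast
  next
    case False
    then obtain x where x: "poly p x = 0" using alg_closed_imp_poly_has_root by blast
    then have "order x p \<noteq> 0" using less.prems(1) by (simp add: order_root)
    with less.prems(2)[of x] have "order x p \<ge> 2" by presburger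
    then have "[:-x, 1:] ^ 2 dvd p" by (rule dvd_trans[OF le_imp_power_dvd order_1])
    then obtain q where q: "p = [:-x, 1:] ^ 2 * q" by (elim dvdE)
    have q0: "q \<noteq> 0" using q less.prems(1) by auto
    have deg: "degree p = 2 + degree q"
      unfolding q using q0 by (subst degree_mult_eq) (auto simp: degree_power_eq)
    have ord: "even (order y q)" for y
    proof -
      have "order y p = order y ([:-x, 1:] ^ 2) + order y q"
        using less.prems(1) unfolding q by (rule order_mult)
      moreover have "order y ([:-x, 1:] ^ 2) = 2 * order y [:-x, 1:]"
        unfolding power2_eq_square by (subst order_mult) auto
      ultimately show ?thesis using less.prems(2)[of y] by simp
    qed
    obtain r where "q = r ^ 2" using less.hyps[of q] deg q0 ord by auto
    then have "p = ([:-x, 1:] * r) ^ 2" using q by (simp only: power_mult_distrib)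
    then show ?thesis by blast
  qed
qed

lemma order_power2:
  assumes "(r :: 'a::idom poly) \<noteq> 0" shows "order x (r ^ 2) = 2 * order x r"
  using assms unfolding power2_eq_square by (subst order_mult) auto

lemma squares_of_coprime_product:
  fixes a b :: "'a::alg_closed_field poly"
  assumes "a * b = r ^ 2" and "a * b \<noteq> 0" and "\<And>x. poly a x = 0 \<Longrightarrow> poly b x \<noteq> 0"
  shows "\<exists>s. a = s ^ 2" and "\<exists>s. b = s ^ 2"
proof -
  have r0: "r \<noteq> 0" using assms(1,2) by auto
  have sum: "order x a + order x b = 2 * order x r" for x
    using order_mult[OF assms(2), of x] order_power2[OF r0, of x] assms(1) by simp
  have one: "order x a = 0 \<or> order x b = 0" for x
    using assms(3)[of x] order_0I by metis
  have "even (order x a)" "even (order x b)" for x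
    using sum[of x] one[of x] by auto
  then show "\<exists>s. a = s ^ 2" "\<exists>s. b = s ^ 2"
    using assms(2) by (auto intro!: square_if_even_orders)
qed

lemma smult_square:
  fixes s :: "'a::alg_closed_field poly"
  shows "\<exists>s'. smult c (s ^ 2) = s' ^ 2"
proof -
  obtain d where "d ^ 2 = c" using nth_root_exists[of 2 c] by auto
  then have "smult c (s ^ 2) = (smult d s) ^ 2" by (simp add: smult_power)
  then show ?thesis by blast
qed

lemma degree_0_if_no_root:
  fixes a :: "'a::alg_closed_field poly"
  assumes "\<And>x. poly a x \<noteq> 0" shows "degree a = 0"
  using assms alg_closed_imp_poly_has_root[of a] by auto

text \<open>Infinite descent on the degree: if \<open>a = p\<^sup>2\<close> and \<open>b = q\<^sup>2\<close>, then the squares \<open>a - b\<close> and \<open>a - \<mu>\<^sup>2 b\<close>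
  split into coprime factors \<open>p - q\<close>, \<open>p + q\<close>, \<open>p - \<mu> q\<close>, \<open>p + \<mu> q\<close>. These are squares as well, and they are
  four distinct members of the pencil spanned by \<open>p\<close> and \<open>q\<close>, whose degree is half as large.\<close>

lemma four_squares_in_pencil:
  fixes a b :: "'a::{alg_closed_field, field_char_0} poly"
  assumes "\<And>x. poly a x = 0 \<Longrightarrow> poly b x \<noteq> 0"
    and "\<exists>s. a = s ^ 2" and "\<exists>s. b = s ^ 2" and "\<exists>s. a - b = s ^ 2"
    and "\<exists>s. a - smult l b = s ^ 2" and "l \<noteq> 0" and "l \<noteq> 1"
  shows "degree a = 0 \<and> degree b = 0"
  using assms
proof (induction "max (degree a) (degree b)" arbitrary: a b l rule: less_induct)
  case less
  note nc = less.prems(1)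
  show ?case
  proof (rule ccontr)
    assume neg: "\<not> ?thesis"
    have nz: "a - smult c b \<noteq> 0" if "c \<noteq> 0" for c
    proof
      assume "a - smult c b = 0"
      then have eq: "a = smult c b" by simp
      then have "poly a x \<noteq> 0" "poly b x \<noteq> 0" for x using nc[of x] that by auto
      then show False using neg degree_0_if_no_root by blast
    qed
    obtain p q where p: "a = p ^ 2" and q: "b = q ^ 2" using less.prems(2,3) by blast
    obtain \<mu> where \<mu>: "\<mu> ^ 2 = l" using nth_root_exists[of 2 l] by auto
    have \<mu>0: "\<mu> \<noteq> 0" and \<mu>1: "1 + \<mu> \<noteq> 0" "1 - \<mu> \<noteq> 0"
      using \<mu> less.prems(6,7) by (auto simp: power2_eq_square add_eq_0_iff)
    have nc': "poly p x = 0 \<Longrightarrow> poly q x \<noteq> 0" for x using nc[of x] by (simp add: p q)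
    have sq: "(\<exists>s. p - smult c q = s ^ 2) \<and> (\<exists>s. p + smult c q = s ^ 2)"
      if c: "c \<noteq> 0" and ex: "\<exists>s. a - smult (c ^ 2) b = s ^ 2" for c
    proof -
      have eq: "(p - smult c q) * (p + smult c q) = a - smult (c ^ 2) b"
        unfolding p q by (simp add: power2_eq_square algebra_simps)
      obtain s where s: "a - smult (c ^ 2) b = s ^ 2" using ex by blast
      have nc2: "poly (p + smult c q) x \<noteq> 0" if r: "poly (p - smult c q) x = 0" for x
      proof
        assume "poly (p + smult c q) x = 0"
        with r have "poly p x = c * poly q x" "poly p x = - (c * poly q x)"
          by (auto simp: add_eq_0_iff2)
        then have "2 * (c * poly q x) = 0" by (metis mult_2 add.right_inverse)
        then have "poly q x = 0" using c by simp
        with \<open>poly p x = c * poly q x\<close> nc'[of x] show False by simp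
      qed
      have nz2: "(p - smult c q) * (p + smult c q) \<noteq> 0" using eq nz[of "c ^ 2"] c by simp
      show ?thesis using squares_of_coprime_product[OF _ nz2 nc2, of s] eq s by simp
    qed
    have e12: "\<exists>s. p - q = s ^ 2" "\<exists>s. p + q = s ^ 2"
      using sq[of 1] less.prems(4) by auto
    have e34: "\<exists>s. p - smult \<mu> q = s ^ 2" "\<exists>s. p + smult \<mu> q = s ^ 2"
      using sq[of \<mu>] less.prems(5) \<mu> \<mu>0 by auto
    \<comment> \<open>Rescale \<open>p - q\<close> and \<open>p + q\<close> such that their difference is \<open>p - \<mu> q\<close>.\<close>
    define a' where "a' = smult ((1 + \<mu>) / 2) (p - q)"
    define b' where "b' = smult ((\<mu> - 1) / 2) (p + q)"
    define l' where "l' = ((1 + \<mu>) / (1 - \<mu>)) ^ 2"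
    have d: "a' - b' = p - smult \<mu> q"
      by (rule poly_eqI) (simp add: a'_def b'_def field_simps)
    have d': "a' - smult l' b' = smult ((1 + \<mu>) / (1 - \<mu>)) (p + smult \<mu> q)"
    proof (rule poly_eqI)
      fix n
      show "coeff (a' - smult l' b') n = coeff (smult ((1 + \<mu>) / (1 - \<mu>)) (p + smult \<mu> q)) n"
        using \<mu>1 by (simp add: a'_def b'_def l'_def power2_eq_square divide_simps)
          (simp add: algebra_simps)
    qed
    have max': "max (degree a') (degree b') \<le> max (degree p) (degree q)"
      unfolding a'_def b'_def using degree_diff_le_max[of p q] degree_add_le_max[of p q]
      by (simp add: le_trans[OF degree_smult_le])
    have "degree a = 2 * degree p" "degree b = 2 * degree q"
      unfolding p q by (cases "p = 0"; simp add: degree_power_eq) (cases "q = 0"; simp add: degree_power_eq)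
    with neg max' have less': "max (degree a') (degree b') < max (degree a) (degree b)" by auto
    have "degree a' = 0 \<and> degree b' = 0"
    proof (rule less.hyps[OF less'])
      show "poly b' x \<noteq> 0" if "poly a' x = 0" for x
      proof
        assume "poly b' x = 0"
        then have "poly p x + poly q x = 0" using \<mu>1 by (simp add: b'_def)
        moreover have "poly p x - poly q x = 0" using \<mu>1 that by (simp add: a'_def)
        ultimately have "2 * poly q x = 0" "poly p x = poly q x" by (auto simp: algebra_simps)
        then show False using nc'[of x] by simp
      qed
      show "\<exists>s. a' = s ^ 2" "\<exists>s. b' = s ^ 2"
        using e12 smult_square unfolding a'_def b'_def by metis+
      show "\<exists>s. a' - b' = s ^ 2" using e34 d by simp
      show "\<exists>s. a' - smult l' b' = s ^ 2" using e34(2) smult_square unfolding d' by metis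
      show "l' \<noteq> 0" using \<mu>1 by (simp add: l'_def)
      show "l' \<noteq> 1"
      proof
        assume "l' = 1"
        then have "(1 + \<mu>) ^ 2 = (1 - \<mu>) ^ 2" using \<mu>1 by (simp add: l'_def power_divide divide_eq_eq)
        then have "4 * \<mu> = 0" by (simp add: power2_eq_square algebra_simps)
        then show False using \<mu>0 by simp
      qed
    qed
    then have "degree (p - q) = 0" "degree (p + q) = 0"
      using \<mu>1 by (auto simp: a'_def b'_def)
    then have "degree ((p - q) + (p + q)) = 0" "degree ((p + q) - (p - q)) = 0"
      using degree_add_le_max[of "p - q" "p + q"] degree_diff_le_max[of "p + q" "p - q"] by auto
    moreover have "p = smult (1/2) ((p - q) + (p + q))" "q = smult (1/2) ((p + q) - (p - q))"
      by (rule poly_eqI, simp only: coeff_smult coeff_add coeff_diff, simp add: field_simps)+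
    ultimately have "degree p = 0" "degree q = 0"
      by (metis degree_smult_le le_zero_eq)+
    then show False using neg \<open>degree a = 2 * degree p\<close> \<open>degree b = 2 * degree q\<close> by simp
  qed
qed

lemma reduced_fraction:
  fixes A B :: "'a::alg_closed_field poly"
  assumes "B \<noteq> 0"
  shows "\<exists>A' B'. B' \<noteq> 0 \<and> A' * B = A * B' \<and> (\<forall>x. poly A' x = 0 \<longrightarrow> poly B' x \<noteq> 0)"
  using assms
proof (induction "degree B" arbitrary: A B rule: less_induct)
  case less
  show ?case
  proof (cases "\<exists>x. poly A x = 0 \<and> poly B x = 0")
    case True
    then obtain x A1 B1 where AB: "A = [:-x, 1:] * A1" "B = [:-x, 1:] * B1"
      by (metis poly_eq_0_iff_dvd dvdE)
    then have B1: "B1 \<noteq> 0" using less.prems by auto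
    then have "degree B = Suc (degree B1)" unfolding AB by (subst degree_mult_eq) auto
    then obtain A' B' where "B' \<noteq> 0" "A' * B1 = A1 * B'" "\<forall>x. poly A' x = 0 \<longrightarrow> poly B' x \<noteq> 0"
      using less.hyps[of B1 A1] B1 by auto
    then show ?thesis unfolding AB by (intro exI[of _ A'] exI[of _ B']) (simp add: algebra_simps)
  next
    case False
    then show ?thesis using less.prems by (intro exI[of _ A] exI[of _ B]) auto
  qed
qed

text \<open>The equation says that \<open>(A/B, C/D)\<close> lies on \<open>y\<^sup>2 = c (x - r1) (x - r2) (x - r3)\<close>. With \<open>A/B\<close> in lowest
  terms, comparing the orders of both sides at each root shows that the pairwise coprime polynomials
  \<open>B\<close> and \<open>A - r B\<close>, for the three roots \<open>r\<close>, are squares. So they are constant by the descent.\<close>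

lemma cubic_curve_not_rational:
  fixes A B C D :: "'a::{alg_closed_field, field_char_0} poly"
  assumes B: "B \<noteq> 0" and D: "D \<noteq> 0" and c: "c \<noteq> 0"
    and r: "r1 \<noteq> r2" "r1 \<noteq> r3" "r2 \<noteq> r3"
    and eq: "C ^ 2 * B ^ 3 = smult c (D ^ 2 * ((A - smult r1 B) * (A - smult r2 B) * (A - smult r3 B)))"
  shows "\<exists>e. A = smult e B"
proof (rule ccontr)
  assume neg: "\<not> ?thesis"
  obtain A' B' where B': "B' \<noteq> 0" and AB: "A' * B = A * B'"
    and nc: "\<And>x. poly A' x = 0 \<Longrightarrow> poly B' x \<noteq> 0"
    using reduced_fraction[OF B, of A] by blast
  have nprop: "\<not> (\<exists>e. A' = smult e B')"
  proof
    assume "\<exists>e. A' = smult e B'"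
    then obtain e where "A' = smult e B'" by blast
    then have "B' * (smult e B - A) = 0" using AB by (simp add: algebra_simps)
    then show False using neg B' by auto
  qed
  have lin: "(A' - smult e B') * B = (A - smult e B) * B'" for e
    using AB by (simp add: algebra_simps)
  define P where "P e = A' - smult e B'" for e
  have P0: "P e \<noteq> 0" for e using nprop by (auto simp: P_def)
  have eq': "C ^ 2 * B' ^ 3 = smult c (D ^ 2 * (P r1 * P r2 * P r3))"
  proof -
    have "(C ^ 2 * B' ^ 3) * B ^ 3 = (C ^ 2 * B ^ 3) * B' ^ 3" by (simp add: mult_ac)
    also have "\<dots> = smult c (D ^ 2 * (((A - smult r1 B) * B') * ((A - smult r2 B) * B') * ((A - smult r3 B) * B')))"
      unfolding eq by (simp add: power3_eq_cube mult_ac)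
    also have "\<dots> = smult c (D ^ 2 * (P r1 * P r2 * P r3)) * B ^ 3"
      unfolding lin[symmetric] P_def by (simp add: power3_eq_cube mult_ac)
    finally have "(C ^ 2 * B' ^ 3) * B ^ 3 = smult c (D ^ 2 * (P r1 * P r2 * P r3)) * B ^ 3" .
    moreover have "B ^ 3 \<noteq> 0" using B by simp
    ultimately show ?thesis using mult_right_cancel by blast
  qed
  have C0: "C \<noteq> 0" using eq' c D P0 by auto
  have ord: "2 * order x C + 3 * order x B' = 2 * order x D + (order x (P r1) + order x (P r2) + order x (P r3))" for x
  proof -
    have "order x (C ^ 2 * B' ^ 3) = 2 * order x C + 3 * order x B'"
      using C0 B' by (simp add: order_mult power2_eq_square power3_eq_cube)
    moreover have "order x (smult c (D ^ 2 * (P r1 * P r2 * P r3))) = 2 * order x D + (order x (P r1) + order x (P r2) + order x (P r3))"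
      using c D P0 by (simp add: order_smult order_mult power2_eq_square)
    ultimately show ?thesis using eq' by simp
  qed
  have ncP: "poly (P e) x \<noteq> 0" if "poly B' x = 0" for e x
    using nc[of x] that by (auto simp: P_def)
  have ncPP: "poly (P e) x \<noteq> 0" if "poly (P e') x = 0" "e \<noteq> e'" for e e' x
  proof
    assume "poly (P e) x = 0"
    then have "poly A' x = e * poly B' x" "poly A' x = e' * poly B' x" using that by (auto simp: P_def)
    then have "e * poly B' x = e' * poly B' x" by metis
    then have "poly B' x = 0" using that(2) by simp
    then show False using ncP that(1) by blast
  qed
  have sqB: "\<exists>s. B' = s ^ 2"
  proof (rule square_if_even_orders[OF B'])
    fix x show "even (order x B')"
    proof (cases "poly B' x = 0")
      case True
      then have "order x (P e) = 0" for e using ncP[of x e] by (simp add: order_0I)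
      then show ?thesis using ord[of x] by (metis add_0 dvd_triv_left even_add even_mult_iff odd_numeral)
    qed (simp add: order_0I)
  qed
  have sqP: "\<exists>s. P e = s ^ 2" if e: "e \<in> {r1, r2, r3}" for e
  proof (rule square_if_even_orders[OF P0])
    fix x show "even (order x (P e))"
    proof (cases "poly (P e) x = 0")
      case True
      then have "order x B' = 0" using ncP[of x e] by (auto intro: order_0I)
      moreover have "order x (P e') = 0" if "e' \<noteq> e" for e'
        using ncPP[of e x e'] True that by (auto intro: order_0I)
      ultimately have "2 * order x C = 2 * order x D + order x (P e)"
        using ord[of x] e r by auto
      then show ?thesis by presburger
    qed (simp add: order_0I)
  qed
  \<comment> \<open>The four members \<open>P r1\<close>, \<open>P r2\<close>, \<open>P r3\<close>, \<open>B'\<close> of one pencil are squares.\<close>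
  have "degree (P r1) = 0 \<and> degree (smult (r2 - r1) B') = 0"
  proof (rule four_squares_in_pencil)
    show "poly (smult (r2 - r1) B') x \<noteq> 0" if "poly (P r1) x = 0" for x
      using that ncP[of x r1] r by auto
    show "\<exists>s. P r1 = s ^ 2" using sqP by blast
    show "\<exists>s. smult (r2 - r1) B' = s ^ 2" using sqB smult_square by metis
    have "P r1 - smult (r2 - r1) B' = P r2"
      by (simp add: P_def algebra_simps smult_diff_left)
    then show "\<exists>s. P r1 - smult (r2 - r1) B' = s ^ 2" using sqP by simp
    have "P r1 - smult ((r3 - r1) / (r2 - r1)) (smult (r2 - r1) B') = P r3"
    proof -
      have "smult ((r3 - r1) / (r2 - r1)) (smult (r2 - r1) B') = smult (r3 - r1) B'" using r by simp
      then show ?thesis by (simp add: P_def smult_diff_left)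
    qed
    then show "\<exists>s. P r1 - smult ((r3 - r1) / (r2 - r1)) (smult (r2 - r1) B') = s ^ 2" using sqP by simp
    show "(r3 - r1) / (r2 - r1) \<noteq> 0" "(r3 - r1) / (r2 - r1) \<noteq> 1" using r by auto
  qed
  then have "degree B' = 0" "degree (P r1) = 0" using r by auto
  then obtain b d where "B' = [:b:]" "P r1 = [:d:]" by (metis degree_eq_zeroE)
  moreover have "A' = P r1 + smult r1 B'" by (simp add: P_def)
  ultimately have "A' = smult (d / b + r1) B'" using B' by (simp add: field_simps)
  then show False using nprop by blast
qed

section \<open>Ring homomorphisms and evaluation\<close>

definition ring_morphism :: "('a::comm_ring_1 \<Rightarrow> 'b::comm_ring_1) \<Rightarrow> bool"
  where "ring_morphism h \<longleftrightarrow> h 1 = 1 \<and> (\<forall>x y. h (x + y) = h x + h y) \<and> (\<forall>x y. h (x * y) = h x * h y)"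

lemma ring_morphismD:
  assumes "ring_morphism h"
  shows "h 1 = 1" "h (x + y) = h x + h y" "h (x * y) = h x * h y" "h 0 = 0"
    "h (- x) = - h x" "h (x - y) = h x - h y" "h (x ^ n) = h x ^ n"
    "h (numeral k) = numeral k"
proof -
  show 1: "h 1 = 1" "h (x + y) = h x + h y" "h (x * y) = h x * h y" for x y
    using assms unfolding ring_morphism_def by blast+
  show 0: "h 0 = 0" using 1(2)[of 0 0] by simp
  show m: "h (- x) = - h x" for x using 1(2)[of x "- x"] 0 by (simp add: add_eq_0_iff)
  show "h (x - y) = h x - h y" using 1(2)[of x "- y"] m[of y] by simp
  show "h (x ^ n) = h x ^ n" by (induction n) (simp_all add: 1)
  have "h (of_nat n) = of_nat n" for n by (induction n) (simp_all add: 0 1)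
  from this[of "numeral k"] show "h (numeral k) = numeral k" by simp
qed

lemma ring_morphism_sum:
  assumes "ring_morphism h" shows "h (\<Sum>i\<in>A. f i) = (\<Sum>i\<in>A. h (f i))"
  by (induction A rule: infinite_finite_induct) (simp_all add: ring_morphismD[OF assms])

lemma ring_morphism_prod:
  assumes "ring_morphism h" shows "h (\<Prod>i\<in>A. f i) = (\<Prod>i\<in>A. h (f i))"
  by (induction A rule: infinite_finite_induct) (simp_all add: ring_morphismD[OF assms])

lemma ring_morphism_comp:
  assumes "ring_morphism g" "ring_morphism h" shows "ring_morphism (\<lambda>x. g (h x))"
  using assms unfolding ring_morphism_def by auto

lemma ring_morphism_id: "ring_morphism (\<lambda>x. x)" "ring_morphism id"
  by (auto simp: ring_morphism_def)

lemma ring_morphism_inj: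
  assumes "ring_morphism (h :: 'a::field \<Rightarrow> 'b::comm_ring_1)" "h x = 0" shows "x = 0"
proof (rule ccontr)
  assume "x \<noteq> 0"
  then have "h x * h (inverse x) = 1" by (metis assms(1) ring_morphismD(1,3) right_inverse)
  then show False using assms(2) by simp
qed

lemma ring_morphism_divide:
  assumes "ring_morphism (h :: 'a::field \<Rightarrow> 'b::field)"
  shows "h (x / y) = h x / h y"
proof (cases "y = 0")
  case True
  then show ?thesis by (simp add: ring_morphismD[OF assms])
next
  case False
  then have "h y \<noteq> 0" using ring_morphism_inj[OF assms] by blast
  moreover have "h (x / y) * h y = h x" using False by (simp flip: ring_morphismD(3)[OF assms])
  ultimately show ?thesis by (simp add: field_simps)
qed

text \<open>The homomorphism on \<open>R[X]\<close> that extends \<open>c\<close> and maps \<open>X\<close> to \<open>x\<close>.\<close>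

definition poly_via :: "('a::comm_ring_1 \<Rightarrow> 'b::comm_ring_1) \<Rightarrow> 'b \<Rightarrow> 'a poly \<Rightarrow> 'b"
  where "poly_via c x p = poly (map_poly c p) x"

lemma poly_via_0 [simp]: "poly_via c x 0 = 0"
  by (simp add: poly_via_def)

lemma poly_via_pCons:
  assumes "ring_morphism c" shows "poly_via c x (pCons a p) = c a + x * poly_via c x p"
  using ring_morphismD(4)[OF assms] by (simp add: poly_via_def map_poly_pCons)

lemma poly_via_const:
  assumes "ring_morphism c" shows "poly_via c x [:a:] = c a"
  by (simp add: poly_via_pCons[OF assms])

lemma ring_morphism_poly_via:
  assumes "ring_morphism c" shows "ring_morphism (poly_via c x)"
proof -
  note [simp] = poly_via_pCons[OF assms] ring_morphismD[OF assms]
  have add: "poly_via c x (p + q) = poly_via c x p + poly_via c x q" for p q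
  proof (induction p arbitrary: q)
    case (pCons a p)
    obtain b r where "q = pCons b r" by (cases q)
    then show ?case by (simp add: pCons.IH algebra_simps)
  qed simp
  have smult: "poly_via c x (smult a q) = c a * poly_via c x q" for a q
    by (induction q) (simp_all add: algebra_simps)
  have "poly_via c x (p * q) = poly_via c x p * poly_via c x q" for p q
    by (induction p) (simp_all add: add smult algebra_simps)
  then show ?thesis using add by (simp add: ring_morphism_def one_pCons)
qed

lemma poly_via_smult:
  assumes "ring_morphism c" shows "poly_via c x (smult a p) = c a * poly_via c x p"
proof -
  have "smult a p = [:a:] * p" by simp
  then show ?thesis
    using ring_morphismD(3)[OF ring_morphism_poly_via[OF assms]] poly_via_const[OF assms] by metis
qed

lemma poly_via_morphism:
  assumes "ring_morphism h" "ring_morphism c"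
  shows "h (poly_via c x p) = poly_via (\<lambda>a. h (c a)) (h x) p"
  by (induction p)
    (simp_all add: poly_via_pCons[OF assms(2)] poly_via_pCons[OF ring_morphism_comp[OF assms]] ring_morphismD[OF assms(1)])

lemma poly_via_id: "poly_via (\<lambda>a. a) x p = poly p x"
  by (simp add: poly_via_def map_poly_idI)

lemma ring_morphism_fls_const: "ring_morphism fls_const"
  by (simp add: ring_morphism_def fls_plus_const)

text \<open>Algebraically closed fields have no proper algebraic extensions.\<close>

lemma transcendental_if_not_constant:
  fixes c :: "'k::alg_closed_field \<Rightarrow> 'r::field"
  assumes c: "ring_morphism c" and x: "x \<notin> range c" and p: "p \<noteq> 0"
  shows "poly_via c x p \<noteq> 0"
  using p
proof (induction "degree p" arbitrary: p rule: less_induct)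
  case less
  show ?case
  proof (cases "degree p = 0")
    case True
    then obtain a where "p = [:a:]" by (elim degree_eq_zeroE)
    then show ?thesis using less.prems ring_morphism_inj[OF c] by (auto simp: poly_via_const[OF c])
  next
    case False
    then obtain r where "poly p r = 0" using alg_closed_imp_poly_has_root by blast
    then obtain q where q: "p = [:-r, 1:] * q" by (metis poly_eq_0_iff_dvd dvdE)
    then have "q \<noteq> 0" using less.prems by auto
    then have "degree p = Suc (degree q)" unfolding q by (subst degree_mult_eq) auto
    then have "poly_via c x q \<noteq> 0" using less.hyps[of q] \<open>q \<noteq> 0\<close> by simp
    moreover have "x - c r \<noteq> 0" using x by auto
    ultimately show ?thesis
      unfolding q ring_morphismD(3)[OF ring_morphism_poly_via[OF c]]
      by (simp add: poly_via_pCons[OF c] ring_morphismD[OF c])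
  qed
qed

text \<open>A Laurent series \<open>\<alpha> + y\<close> with \<open>y\<close> of positive order is transcendental over the constants: after
  the substitution \<open>X \<mapsto> X + \<alpha>\<close> the lowest nonzero term of the polynomial determines the order of
  its value at \<open>y\<close>.\<close>

lemma transcendental_fls:
  fixes c :: "'a::comm_ring_1 \<Rightarrow> 'r::field"
  assumes c: "ring_morphism c" and inj: "\<And>a. c a = 0 \<Longrightarrow> a = 0"
    and y: "y \<noteq> 0" "fls_subdegree y > 0"
    and p: "poly_via (\<lambda>a. fls_const (c a)) (fls_const \<alpha> + y) p = 0"
  shows "p = 0"
proof (rule ccontr)
  assume "p \<noteq> 0"
  define q where "q = pcompose (map_poly c p) [:\<alpha>, 1:]"
  have c0: "c 0 = 0" by (rule ring_morphismD(4)[OF c])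
  have "map_poly c p \<noteq> 0" using \<open>p \<noteq> 0\<close> inj c0 by (metis coeff_map_poly poly_eqI coeff_0)
  then have "q \<noteq> 0" by (simp add: q_def pcompose_eq_0_iff)
  define n where "n = order 0 q"
  obtain r where r: "q = [:0, 1:] ^ n * r" "poly r 0 \<noteq> 0"
    using order_decomp[OF \<open>q \<noteq> 0\<close>, of 0] unfolding n_def
    by (metis minus_zero poly_eq_0_iff_dvd)
  note cm = ring_morphism_fls_const[where 'a='r]
  have "poly_via (\<lambda>a. fls_const (c a)) (fls_const \<alpha> + y) p = poly_via fls_const y q"
  proof -
    have "poly_via (\<lambda>a. fls_const (c a)) (fls_const \<alpha> + y) p = poly_via fls_const (fls_const \<alpha> + y) (map_poly c p)"
      using c0 by (simp add: poly_via_def map_poly_map_poly o_def)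
    also have "poly_via fls_const (fls_const \<alpha> + y) s = poly_via fls_const y (pcompose s [:\<alpha>, 1:])" for s
      by (induction s)
        (simp_all add: pcompose_pCons poly_via_pCons[OF cm] poly_via_smult[OF cm] algebra_simps ring_morphismD[OF ring_morphism_poly_via[OF cm]])
    then have "poly_via fls_const (fls_const \<alpha> + y) (map_poly c p) = poly_via fls_const y q"
      unfolding q_def .
    finally show ?thesis .
  qed
  also have "\<dots> = y ^ n * poly_via fls_const y r"
    unfolding r(1) ring_morphismD[OF ring_morphism_poly_via[OF cm]] by (simp add: poly_via_pCons[OF cm])
  finally have "poly_via fls_const y r = 0" using p y by simp
  moreover have "fls_nth (poly_via fls_const y s) 0 = poly s 0 \<and> fls_subdegree (poly_via fls_const y s) \<ge> 0" for s
  proof (induction s)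
    case (pCons a s)
    have "fls_subdegree (y * poly_via fls_const y s) \<ge> 0"
      using pCons.IH y by (cases "poly_via fls_const y s = 0") auto
    moreover have "fls_nth (y * poly_via fls_const y s) 0 = 0"
      using pCons.IH y by (intro fls_times_nth_eq0) auto
    ultimately show ?case
      using fls_plus_subdegree
      by (auto simp: poly_via_pCons[OF cm] intro!: fls_subdegree_ge0I)
  qed simp
  ultimately show False using r(2) by (metis fls_zero_nth)
qed

lemma poly_eq_0_if_vanishes:
  fixes p :: "'k::{field_char_0} poly"
  assumes "\<And>x. poly p x = 0" shows "p = 0"
  using assms poly_all_0_iff_0 by blast

section \<open>Leading terms and the ruled residue theorem\<close>

definition subring_set :: "'a::comm_ring_1 set \<Rightarrow> bool"
  where "subring_set R \<longleftrightarrow> 1 \<in> R \<and> (\<forall>x\<in>R. \<forall>y\<in>R. x - y \<in> R \<and> x * y \<in> R)"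

lemma subring_setD:
  assumes "subring_set R"
  shows "1 \<in> R" "0 \<in> R" "x \<in> R \<Longrightarrow> - x \<in> R" "x \<in> R \<Longrightarrow> y \<in> R \<Longrightarrow> x - y \<in> R"
    "x \<in> R \<Longrightarrow> y \<in> R \<Longrightarrow> x + y \<in> R" "x \<in> R \<Longrightarrow> y \<in> R \<Longrightarrow> x * y \<in> R"
    "x \<in> R \<Longrightarrow> x ^ n \<in> R"
proof -
  show one: "1 \<in> R" and diff: "\<And>x y. x \<in> R \<Longrightarrow> y \<in> R \<Longrightarrow> x - y \<in> R"
    and times: "\<And>x y. x \<in> R \<Longrightarrow> y \<in> R \<Longrightarrow> x * y \<in> R"
    using assms unfolding subring_set_def by blast+
  show zero: "0 \<in> R" using diff[OF one one] by simp
  show minus: "\<And>x. x \<in> R \<Longrightarrow> - x \<in> R" using diff[OF zero] by simp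
  show "\<And>x y. x \<in> R \<Longrightarrow> y \<in> R \<Longrightarrow> x + y \<in> R" using diff minus by (metis diff_minus_eq_add)
  show "\<And>x. x \<in> R \<Longrightarrow> x ^ n \<in> R" by (induction n) (auto simp: one times)
qed

lemma subring_sum: "subring_set R \<Longrightarrow> (\<And>i. i \<in> A \<Longrightarrow> f i \<in> R) \<Longrightarrow> (\<Sum>i\<in>A. f i) \<in> R"
  by (induction A rule: infinite_finite_induct) (auto intro: subring_setD)

lemma subring_prod: "subring_set R \<Longrightarrow> (\<And>i. i \<in> A \<Longrightarrow> f i \<in> R) \<Longrightarrow> (\<Prod>i\<in>A. f i) \<in> R"
  by (induction A rule: infinite_finite_induct) (auto intro: subring_setD)

definition coeffs_in :: "'a::comm_ring_1 set \<Rightarrow> 'a poly set"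
  where "coeffs_in R = {p. \<forall>i. coeff p i \<in> R}"

lemma subring_coeffs_in:
  assumes "subring_set R" shows "subring_set (coeffs_in R)"
  unfolding subring_set_def coeffs_in_def
  by (auto simp: coeff_mult coeff_1 intro!: subring_sum[OF assms] intro: subring_setD[OF assms])

lemma pCons_in_coeffs_in: "pCons a p \<in> coeffs_in R \<longleftrightarrow> a \<in> R \<and> p \<in> coeffs_in R"
proof
  assume "pCons a p \<in> coeffs_in R"
  then have "coeff (pCons a p) 0 \<in> R" "coeff (pCons a p) (Suc i) \<in> R" for i
    unfolding coeffs_in_def by blast+
  then show "a \<in> R \<and> p \<in> coeffs_in R" by (simp add: coeffs_in_def)
next
  assume "a \<in> R \<and> p \<in> coeffs_in R"
  then show "pCons a p \<in> coeffs_in R" by (auto simp: coeffs_in_def coeff_pCons split: nat.split)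
qed

text \<open>The ring \<open>R[y]\<close>.\<close>

definition adjoin :: "'a::comm_ring_1 set \<Rightarrow> 'a \<Rightarrow> 'a set"
  where "adjoin R y = (\<lambda>p. poly p y) ` coeffs_in R"

lemma subring_adjoin:
  assumes "subring_set R" shows "subring_set (adjoin R y)"
proof -
  note S = subring_setD[OF subring_coeffs_in[OF assms]]
  show ?thesis unfolding subring_set_def adjoin_def
  proof (intro conjI ballI)
    show "1 \<in> (\<lambda>p. poly p y) ` coeffs_in R" using S(1) by (intro image_eqI[of _ _ 1]) auto
    fix a b assume "a \<in> (\<lambda>p. poly p y) ` coeffs_in R" "b \<in> (\<lambda>p. poly p y) ` coeffs_in R"
    then obtain p q where "p \<in> coeffs_in R" "q \<in> coeffs_in R" "a = poly p y" "b = poly q y" by blast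
    then show "a - b \<in> (\<lambda>p. poly p y) ` coeffs_in R" "a * b \<in> (\<lambda>p. poly p y) ` coeffs_in R"
      using S(4)[of p q] S(6)[of p q] by (auto simp flip: poly_diff poly_mult)
  qed
qed

lemma subset_adjoin:
  assumes "subring_set R" shows "R \<subseteq> adjoin R y" "y \<in> adjoin R y"
proof -
  note S = subring_setD[OF assms] and z = subring_setD(2)[OF subring_coeffs_in[OF assms]]
  show "R \<subseteq> adjoin R y"
  proof
    fix a assume "a \<in> R"
    then have "[:a:] \<in> coeffs_in R" using S(1,2) z by (simp add: pCons_in_coeffs_in)
    then show "a \<in> adjoin R y" unfolding adjoin_def by (intro image_eqI[of _ _ "[:a:]"]) auto
  qed
  have "[:0, 1:] \<in> coeffs_in R" using S(1,2) z by (simp add: pCons_in_coeffs_in)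
  then show "y \<in> adjoin R y" unfolding adjoin_def by (intro image_eqI[of _ _ "[:0, 1:]"]) auto
qed

lemma subring_range:
  assumes "ring_morphism c" shows "subring_set (range c)"
  unfolding subring_set_def
  using rangeI[of c 1] rangeI[of c]
  by (auto simp: ring_morphismD(1)[OF assms] simp flip: ring_morphismD(3,6)[OF assms])

text \<open>A valuation with values in \<open>\<int>\<^sup>2\<close>, together with a multiplicative choice of leading coefficients in
  the residue field. The ordering of the value group enters only through the fact that the leading
  term of a sum is one of the two leading terms if the values differ.\<close>

locale leading_terms =
  fixes val :: "'f::idom \<Rightarrow> int \<times> int" and lc :: "'f \<Rightarrow> 'r::field"
  assumes lc_nonzero: "a \<noteq> 0 \<Longrightarrow> lc a \<noteq> 0"
    and val_mult: "a \<noteq> 0 \<Longrightarrow> b \<noteq> 0 \<Longrightarrow> val (a * b) = (fst (val a) + fst (val b), snd (val a) + snd (val b))"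
    and lc_mult: "a \<noteq> 0 \<Longrightarrow> b \<noteq> 0 \<Longrightarrow> lc (a * b) = lc a * lc b"
    and add_neq: "a \<noteq> 0 \<Longrightarrow> b \<noteq> 0 \<Longrightarrow> val a \<noteq> val b \<Longrightarrow>
      a + b \<noteq> 0 \<and> (val (a + b) = val a \<and> lc (a + b) = lc a \<or> val (a + b) = val b \<and> lc (a + b) = lc b)"
    and add_eq: "a \<noteq> 0 \<Longrightarrow> b \<noteq> 0 \<Longrightarrow> val a = val b \<Longrightarrow> lc a + lc b \<noteq> 0 \<Longrightarrow>
      a + b \<noteq> 0 \<and> val (a + b) = val a \<and> lc (a + b) = lc a + lc b"
begin

lemma adjoin_independent:
  fixes C :: "'r set"
  assumes R: "subring_set R" and C: "subring_set C"
    and vR: "\<And>a. a \<in> R \<Longrightarrow> a \<noteq> 0 \<Longrightarrow> val a \<in> L \<and> lc a \<in> C"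
    and y: "y \<noteq> 0" "lc y \<in> C"
    and indep: "\<And>g h j. g \<in> L \<Longrightarrow> h \<in> L \<Longrightarrow> j > 0 \<Longrightarrow>
      (fst g + int j * fst (val y), snd g + int j * snd (val y)) \<noteq> h"
    and a: "a \<in> adjoin R y" "a \<noteq> 0"
  shows "(\<exists>g\<in>L. \<exists>j. val a = (fst g + int j * fst (val y), snd g + int j * snd (val y))) \<and> lc a \<in> C"
proof -
  obtain Q where Q: "Q \<in> coeffs_in R" "a = poly Q y" using a(1) unfolding adjoin_def by blast
  have "poly Q y = 0 \<or>
    (\<exists>g\<in>L. \<exists>j. val (poly Q y) = (fst g + int j * fst (val y), snd g + int j * snd (val y))) \<and> lc (poly Q y) \<in> C"
    using Q(1)
  proof (induction Q)
    case (pCons b Q)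
    then have b: "b \<in> R" and IH: "poly Q y = 0 \<or>
      (\<exists>g\<in>L. \<exists>j. val (poly Q y) = (fst g + int j * fst (val y), snd g + int j * snd (val y))) \<and> lc (poly Q y) \<in> C"
      by (auto simp: pCons_in_coeffs_in)
    show ?case
    proof (cases "poly Q y = 0")
      case True
      show ?thesis
      proof (cases "b = 0")
        case False
        then show ?thesis using vR[OF b False] True by (auto intro!: bexI[of _ "val b"] exI[of _ 0])
      qed (simp add: True)
    next
      case False
      then obtain g j where g: "g \<in> L" "val (poly Q y) = (fst g + int j * fst (val y), snd g + int j * snd (val y))"
        and lcC: "lc (poly Q y) \<in> C" using IH by blast
      have v: "val (y * poly Q y) = (fst g + int (Suc j) * fst (val y), snd g + int (Suc j) * snd (val y))"
        using val_mult[OF y(1) False] g(2) by (simp add: algebra_simps)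
      have l: "lc (y * poly Q y) \<in> C"
        using lc_mult[OF y(1) False] lcC y(2) subring_setD(6)[OF C] by simp
      have P: "\<exists>g\<in>L. \<exists>j. val (y * poly Q y) = (fst g + int j * fst (val y), snd g + int j * snd (val y))"
        using v g(1) by blast
      show ?thesis
      proof (cases "b = 0")
        case True
        then show ?thesis using P l by simp
      next
        case b0: False
        have "val b \<noteq> val (y * poly Q y)"
          using indep[OF g(1), of "val b" "Suc j"] vR[OF b b0] v by auto
        moreover have "y * poly Q y \<noteq> 0" using y(1) False by simp
        ultimately have "val (b + y * poly Q y) = val b \<and> lc (b + y * poly Q y) = lc b \<or>
            val (b + y * poly Q y) = val (y * poly Q y) \<and> lc (b + y * poly Q y) = lc (y * poly Q y)"
          using add_neq[of b "y * poly Q y"] b0 by blast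
        moreover have "\<exists>g\<in>L. \<exists>j. val b = (fst g + int j * fst (val y), snd g + int j * snd (val y))"
          using vR[OF b b0] by (intro bexI[of _ "val b"] exI[of _ 0]) auto
        ultimately show ?thesis using P l vR[OF b b0] by (metis poly_pCons)
      qed
    qed
  qed simp
  then show ?thesis using a(2) Q(2) by blast
qed

end

text \<open>Unlike division, pseudo-division keeps the coefficients of quotient and remainder in \<open>R\<close>.\<close>

lemma pseudo_division_in:
  fixes P Q :: "'f::idom poly"
  assumes R: "subring_set R" and P: "P \<in> coeffs_in R" "P \<noteq> 0" and Q: "Q \<in> coeffs_in R"
  shows "\<exists>b A S. b \<in> R \<and> b \<noteq> 0 \<and> A \<in> coeffs_in R \<and> S \<in> coeffs_in R \<and> smult b Q = A * P + S \<and>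
    (S = 0 \<or> degree S < degree P)"
  using Q
proof (induction "degree Q" arbitrary: Q rule: less_induct)
  case less
  note RR = subring_setD[OF R] and RP = subring_setD[OF subring_coeffs_in[OF R]]
  show ?case
  proof (cases "Q = 0 \<or> degree Q < degree P")
    case True
    then show ?thesis using less.prems RR(1) RP(2)
      by (intro exI[of _ 1] exI[of _ 0] exI[of _ Q]) auto
  next
    case False
    define p q n where "p = lead_coeff P" and "q = lead_coeff Q" and "n = degree Q - degree P"
    have p: "p \<in> R" "p \<noteq> 0" and q: "q \<in> R" "q \<noteq> 0"
      using P less.prems False by (auto simp: p_def q_def coeffs_in_def)
    define M where "M = monom q n"
    have M: "M \<in> coeffs_in R" using q(1) RR(2) by (auto simp: M_def coeffs_in_def)
    have sm: "smult b U \<in> coeffs_in R" if "b \<in> R" "U \<in> coeffs_in R" for b U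
      using that RR(6) by (auto simp: coeffs_in_def)
    define Q' where "Q' = smult p Q - M * P"
    have Q': "Q' \<in> coeffs_in R" unfolding Q'_def 
      by (intro RP(4) RP(6) sm p(1) less.prems M P(1))
    have small: "Q' = 0 \<or> degree Q' < degree Q"
    proof -
      have "degree (M * P) = degree Q"
        using q(2) P(2) False unfolding M_def n_def by (subst degree_mult_eq) (auto simp: degree_monom_eq)
      moreover have "degree (smult p Q) = degree Q" using p(2) by simp
      moreover have "coeff (M * P) (degree Q) = q * p"
        using False unfolding M_def n_def p_def by (simp add: coeff_monom_mult)
      ultimately have "degree Q' \<le> degree Q" "coeff Q' (degree Q) = 0"
        unfolding Q'_def by (auto simp: q_def degree_diff_le)
      then show ?thesis by (metis eq_zero_or_degree_less)
    qed
    have "\<exists>b A S. b \<in> R \<and> b \<noteq> 0 \<and> A \<in> coeffs_in R \<and> S \<in> coeffs_in R \<and> smult b Q' = A * P + S \<and>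
      (S = 0 \<or> degree S < degree P)"
    proof (cases "Q' = 0")
      case True
      then show ?thesis using RR(1) RP(2) by (intro exI[of _ 1] exI[of _ 0]) auto
    next
      case False
      then show ?thesis using less.hyps[OF _ Q'] small by blast
    qed
    then obtain b A S where b: "b \<in> R" "b \<noteq> 0" "A \<in> coeffs_in R" "S \<in> coeffs_in R"
      "smult b Q' = A * P + S" "S = 0 \<or> degree S < degree P" by blast
    have "smult (b * p) Q = (A + smult b M) * P + S"
    proof -
      have "smult (b * p) Q = smult b Q' + smult b (M * P)" by (simp add: Q'_def smult_diff_right)
      then show ?thesis using b(5) by (simp add: algebra_simps)
    qed
    moreover have "b * p \<in> R" "b * p \<noteq> 0" using b p RR(6) by auto
    moreover have "A + smult b M \<in> coeffs_in R" by (intro RP(5) sm b M)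
    ultimately show ?thesis using b by blast
  qed
qed

text \<open>If the leading coefficients of \<open>R\<close> are constants, then those of \<open>R[z]\<close> are polynomials in a
  single \<open>\<tau>\<close>. Let \<open>P\<close> be a polynomial over \<open>R\<close> of least degree such that the leading coefficient \<open>\<tau>\<close> of \<open>P(z)\<close>
  is not constant. Pseudo-division by \<open>P\<close> writes any other polynomial as \<open>A P + S\<close>, where by minimality
  \<open>S(z)\<close> has a constant leading coefficient. The leading coefficient of \<open>A(z) P(z)\<close> is a multiple of
  \<open>\<tau>\<close> in \<open>k[\<tau>]\<close> and so cannot cancel against this constant, because \<open>\<tau>\<close> is transcendental.\<close>

lemma (in leading_terms) ruled_residue:
  fixes c :: "'k::alg_closed_field \<Rightarrow> 'r"
  assumes c: "ring_morphism c" and R: "subring_set R"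
    and vR: "\<And>a. a \<in> R \<Longrightarrow> a \<noteq> 0 \<Longrightarrow> lc a \<in> range c"
  shows "\<exists>\<tau>. \<forall>a\<in>adjoin R z. a \<noteq> 0 \<longrightarrow> (\<exists>f. lc a = poly_via c \<tau> f)"
proof (cases "\<forall>a\<in>adjoin R z. a \<noteq> 0 \<longrightarrow> lc a \<in> range c")
  case True
  then show ?thesis using poly_via_const[OF c] by (metis rangeE)
next
  case False
  note RR = subring_setD[OF R]
  define bad where "bad Q \<longleftrightarrow> Q \<in> coeffs_in R \<and> poly Q z \<noteq> 0 \<and> lc (poly Q z) \<notin> range c" for Q
  have "\<exists>Q. bad Q" using False unfolding bad_def adjoin_def by auto
  then obtain P where P: "bad P" and min: "\<And>Q. bad Q \<Longrightarrow> degree P \<le> degree Q"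
    using exists_least_iff[of "\<lambda>n. \<exists>Q. bad Q \<and> degree Q = n"] by (metis not_less)
  define \<tau> where "\<tau> = lc (poly P z)"
  have \<tau>: "\<tau> \<notin> range c" and PR: "P \<in> coeffs_in R" and Pz: "poly P z \<noteq> 0"
    using P by (auto simp: bad_def \<tau>_def)
  have P0: "P \<noteq> 0" using Pz by auto
  have degP: "degree P > 0"
  proof (rule ccontr)
    assume "\<not> ?thesis"
    then obtain b where "P = [:b:]" by (metis degree_eq_zeroE not_gr_zero)
    then show False using P vR[of b] by (auto simp: bad_def pCons_in_coeffs_in)
  qed
  have small: "lc (poly S z) \<in> range c" if "S \<in> coeffs_in R" "degree S < degree P" "poly S z \<noteq> 0" for S
    using min[of S] that by (auto simp: bad_def)
  have "\<exists>f. lc (poly Q z) = poly_via c \<tau> f" if "Q \<in> coeffs_in R" "poly Q z \<noteq> 0" for Q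
    using that
  proof (induction "degree Q" arbitrary: Q rule: less_induct)
    case less
    obtain b A S where b: "b \<in> R" "b \<noteq> 0" and A: "A \<in> coeffs_in R" and S: "S \<in> coeffs_in R"
      and eq: "smult b Q = A * P + S" and degS: "S = 0 \<or> degree S < degree P"
      using pseudo_division_in[OF R PR P0 less.prems(1)] by blast
    obtain e where e: "lc b = c e" using vR[OF b] by blast
    have e0: "e \<noteq> 0" using lc_nonzero[OF b(2)] e ring_morphismD(4)[OF c] by auto
    have degA: "degree A < degree Q" if "A \<noteq> 0"
    proof -
      have "A * P = smult b Q - S" using eq by simp
      then have "degree A + degree P \<le> max (degree Q) (degree S)"
        using that P0 degree_diff_le_max[of "smult b Q" S] b(2) by (simp flip: degree_mult_eq)
      then show ?thesis using degS degP by auto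
    qed
    have eqz: "b * poly Q z = poly A z * poly P z + poly S z"
      using arg_cong[OF eq, of "\<lambda>p. poly p z"] by simp
    have bQ: "b * poly Q z \<noteq> 0" using b less.prems by simp
    have "\<exists>f. lc (b * poly Q z) = poly_via c \<tau> f"
    proof (cases "poly A z = 0")
      case True
      then have "b * poly Q z = poly S z" using eqz by simp
      moreover from this have "S \<noteq> 0" using bQ by auto
      ultimately obtain d where "lc (b * poly Q z) = c d" using small[OF S] degS bQ by (metis rangeE)
      then show ?thesis using poly_via_const[OF c] by metis
    next
      case Az: False
      then have "A \<noteq> 0" by auto
      then obtain f where f: "lc (poly A z) = poly_via c \<tau> f" using less.hyps[OF degA A] Az by blast
      have AP: "poly A z * poly P z \<noteq> 0" using Az Pz by simp
      have lAP: "lc (poly A z * poly P z) = poly_via c \<tau> (pCons 0 f)"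
        using lc_mult[OF Az Pz] f by (simp add: poly_via_pCons[OF c] \<tau>_def ring_morphismD(4)[OF c])
      show ?thesis
      proof (cases "poly S z = 0")
        case True
        then show ?thesis using eqz lAP by auto
      next
        case Sz: False
        then obtain d where d: "lc (poly S z) = c d" using small[OF S _ Sz] degS by auto
        show ?thesis
        proof (cases "val (poly A z * poly P z) = val (poly S z)")
          case True
          have sum: "lc (poly A z * poly P z) + lc (poly S z) = poly_via c \<tau> (pCons d f)"
            unfolding lAP d by (simp add: poly_via_pCons[OF c] ring_morphismD(4)[OF c])
          have "d \<noteq> 0" using d lc_nonzero[OF Sz] ring_morphismD(4)[OF c] by auto
          then have "poly_via c \<tau> (pCons d f) \<noteq> 0"
            by (intro transcendental_if_not_constant[OF c \<tau>]) auto
          then show ?thesis using add_eq[OF AP Sz True] sum eqz by auto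
        next
          case False
          then show ?thesis using add_neq[OF AP Sz False] lAP d eqz poly_via_const[OF c] by metis
        qed
      qed
    qed
    then obtain f where f: "lc (b * poly Q z) = poly_via c \<tau> f" by blast
    have "lc (b * poly Q z) = c e * lc (poly Q z)" using lc_mult[OF b(2) less.prems(2)] e by simp
    moreover have "c e \<noteq> 0" using e0 ring_morphism_inj[OF c] by blast
    ultimately have "lc (poly Q z) = c (inverse e) * poly_via c \<tau> f"
      using f ring_morphism_divide[OF c, of 1 e] by (simp add: ring_morphismD(1)[OF c] divide_inverse)
    then have "lc (poly Q z) = poly_via c \<tau> (smult (inverse e) f)" by (simp add: poly_via_smult[OF c])
    then show ?case by blast
  qed
  then show ?thesis unfolding adjoin_def by blast
qed

text \<open>As the values of \<open>x\<close> and \<open>y\<close> are independent, distinct monomials in \<open>x\<close> and \<open>y\<close> have distinct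
  values. So the leading coefficient of an element of \<open>k[x, y]\<close> is that of a single monomial,
  which is a constant.\<close>

lemma (in leading_terms) residue_of_purely_monomial_extension:
  fixes k :: "'k::alg_closed_field \<Rightarrow> 'f" and c :: "'k \<Rightarrow> 'r"
  assumes k: "ring_morphism k" and c: "ring_morphism c"
    and kc: "\<And>a. a \<noteq> 0 \<Longrightarrow> val (k a) = (0, 0) \<and> lc (k a) = c a"
    and x: "x \<noteq> 0" "lc x = 1" and y: "y \<noteq> 0" "lc y = 1"
    and indep: "fst (val x) * snd (val y) \<noteq> snd (val x) * fst (val y)"
  shows "\<exists>\<tau>. \<forall>a\<in>adjoin (adjoin (adjoin (range k) x) y) z. a \<noteq> 0 \<longrightarrow> (\<exists>f. lc a = poly_via c \<tau> f)"
proof -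
  have C: "subring_set (range c)" using subring_range[OF c] .
  have one: "1 \<in> range c" using subring_setD(1)[OF C] .
  have R0: "subring_set (range k)" using subring_range[OF k] .
  have R1: "subring_set (adjoin (range k) x)" using subring_adjoin[OF R0] .
  have R2: "subring_set (adjoin (adjoin (range k) x) y)" using subring_adjoin[OF R1] .
  define L where "L = {(int i * fst (val x), int i * snd (val x)) |i. True}"
  have v0: "val a \<in> {(0, 0)} \<and> lc a \<in> range c" if "a \<in> range k" "a \<noteq> 0" for a
  proof -
    obtain b where b: "a = k b" using \<open>a \<in> range k\<close> by blast
    then have "b \<noteq> 0" using \<open>a \<noteq> 0\<close> ring_morphismD(4)[OF k] by auto
    then show ?thesis using kc[of b] b by simp
  qed
  have v1: "val a \<in> L \<and> lc a \<in> range c" if "a \<in> adjoin (range k) x" "a \<noteq> 0" for a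
  proof -
    have "(\<exists>g\<in>{(0,0)}. \<exists>j. val a = (fst g + int j * fst (val x), snd g + int j * snd (val x))) \<and> lc a \<in> range c"
      by (rule adjoin_independent[OF R0 C v0]) (use x one that indep in auto)
    then show ?thesis unfolding L_def by auto
  qed
  have v2: "lc a \<in> range c" if "a \<in> adjoin (adjoin (range k) x) y" "a \<noteq> 0" for a
  proof -
    have "(\<exists>g\<in>L. \<exists>j. val a = (fst g + int j * fst (val y), snd g + int j * snd (val y))) \<and> lc a \<in> range c"
    proof (rule adjoin_independent[OF R1 C v1])
      fix g h :: "int \<times> int" and j :: nat assume "g \<in> L" "h \<in> L" and j: "j > 0"
      then obtain i i' where g: "g = (int i * fst (val x), int i * snd (val x))"
        and h: "h = (int i' * fst (val x), int i' * snd (val x))" unfolding L_def by blast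
      show "(fst g + int j * fst (val y), snd g + int j * snd (val y)) \<noteq> h"
      proof
        assume eq: "(fst g + int j * fst (val y), snd g + int j * snd (val y)) = h"
        then have e: "int j * fst (val y) = (int i' - int i) * fst (val x)"
            "int j * snd (val y) = (int i' - int i) * snd (val x)"
          unfolding g h by (auto simp: algebra_simps)
        have "int j * (fst (val x) * snd (val y)) = fst (val x) * (int j * snd (val y))" by simp
        also have "\<dots> = snd (val x) * (int j * fst (val y))" unfolding e by simp
        also have "\<dots> = int j * (snd (val x) * fst (val y))" by simp
        finally show False using indep j by simp
      qed
    qed (use y one that in auto)
    then show ?thesis by blast
  qed
  show ?thesis by (rule ruled_residue[OF c R2 v2])
qed

section \<open>Iterated Laurent series\<close>

definition fls_lead :: "'a::zero fls \<Rightarrow> 'a"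
  where "fls_lead f = fls_nth f (fls_subdegree f)"

lemma fls_lead_nonzero: "f \<noteq> 0 \<Longrightarrow> fls_lead f \<noteq> 0"
  by (simp add: fls_lead_def)

lemma fls_lead_mult:
  fixes f g :: "'a::idom fls"
  assumes "f \<noteq> 0" "g \<noteq> 0"
  shows "fls_subdegree (f * g) = fls_subdegree f + fls_subdegree g" "fls_lead (f * g) = fls_lead f * fls_lead g"
proof -
  show "fls_subdegree (f * g) = fls_subdegree f + fls_subdegree g" using assms by simp
  then show "fls_lead (f * g) = fls_lead f * fls_lead g" by (simp add: fls_lead_def)
qed

lemma fls_lead_add_less:
  fixes f g :: "'a::ab_group_add fls"
  assumes "f \<noteq> 0" "g = 0 \<or> fls_subdegree f < fls_subdegree g"
  shows "f + g \<noteq> 0" "fls_subdegree (f + g) = fls_subdegree f" "fls_lead (f + g) = fls_lead f"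
proof -
  show sub: "fls_subdegree (f + g) = fls_subdegree f"
    using assms fls_subdegree_add_eq1[of f g] by auto
  show lead: "fls_lead (f + g) = fls_lead f"
    using assms(2) unfolding fls_lead_def sub by auto
  show "f + g \<noteq> 0" using lead fls_lead_nonzero[OF assms(1)] by (metis fls_lead_def fls_zero_nth)
qed

lemma fls_lead_add_eq:
  fixes f g :: "'a::ab_group_add fls"
  assumes "fls_subdegree f = fls_subdegree g" "fls_lead f + fls_lead g \<noteq> 0"
  shows "f + g \<noteq> 0" "fls_subdegree (f + g) = fls_subdegree f" "fls_lead (f + g) = fls_lead f + fls_lead g"
proof -
  have nz: "fls_nth (f + g) (fls_subdegree f) \<noteq> 0" using assms by (simp add: fls_lead_def)
  show sub: "fls_subdegree (f + g) = fls_subdegree f"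
    using nz assms(1) by (intro fls_subdegree_eqI) auto
  show "fls_lead (f + g) = fls_lead f + fls_lead g" unfolding fls_lead_def sub using assms(1) by simp
  show "f + g \<noteq> 0" using nz by (metis fls_zero_nth)
qed

lemma fls_lead_const [simp]: "fls_lead (fls_const c) = c" "fls_lead (1 :: 'b::{zero_neq_one} fls) = 1"
    "fls_lead (fls_X :: 'b fls) = 1"
  by (auto simp: fls_lead_def)

definition val2 :: "'a::zero fls fls \<Rightarrow> int \<times> int"
  where "val2 f = (fls_subdegree f, fls_subdegree (fls_lead f))"

definition lc2 :: "'a::zero fls fls \<Rightarrow> 'a"
  where "lc2 f = fls_lead (fls_lead f)"

lemma leading_terms_fls: "leading_terms val2 (lc2 :: 'r::field fls fls \<Rightarrow> 'r)"
proof
  fix a b :: "'r fls fls"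
  assume a: "a \<noteq> 0"
  note la = fls_lead_nonzero[OF a]
  show "lc2 a \<noteq> 0" using la by (simp add: lc2_def fls_lead_nonzero)
  assume b: "b \<noteq> 0"
  note lb = fls_lead_nonzero[OF b]
  show "val2 (a * b) = (fst (val2 a) + fst (val2 b), snd (val2 a) + snd (val2 b))"
    using fls_lead_mult[OF a b] fls_lead_mult[OF la lb] by (simp add: val2_def)
  show "lc2 (a * b) = lc2 a * lc2 b"
    using fls_lead_mult[OF a b] fls_lead_mult[OF la lb] by (simp add: lc2_def)
  have less: "a + b \<noteq> 0 \<and> val2 (a + b) = val2 a \<and> lc2 (a + b) = lc2 a"
    if "fst (val2 a) < fst (val2 b) \<or> fst (val2 a) = fst (val2 b) \<and> snd (val2 a) < snd (val2 b)" "a \<noteq> 0" "b \<noteq> 0"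
    for a b :: "'r fls fls"
  proof (cases "fls_subdegree a < fls_subdegree b")
    case True
    then show ?thesis using fls_lead_add_less[of a b] that by (simp add: val2_def lc2_def)
  next
    case False
    then have e: "fls_subdegree a = fls_subdegree b" and l: "fls_subdegree (fls_lead a) < fls_subdegree (fls_lead b)"
      using that by (auto simp: val2_def)
    note i = fls_lead_add_less[OF fls_lead_nonzero[OF that(2)], of "fls_lead b"]
    show ?thesis using fls_lead_add_eq[OF e] i l by (simp add: val2_def lc2_def)
  qed
  show "a + b \<noteq> 0 \<and> (val2 (a + b) = val2 a \<and> lc2 (a + b) = lc2 a \<or> val2 (a + b) = val2 b \<and> lc2 (a + b) = lc2 b)"
    if "val2 a \<noteq> val2 b"
  proof -
    from that consider "fst (val2 a) < fst (val2 b) \<or> fst (val2 a) = fst (val2 b) \<and> snd (val2 a) < snd (val2 b)"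
      | "fst (val2 b) < fst (val2 a) \<or> fst (val2 b) = fst (val2 a) \<and> snd (val2 b) < snd (val2 a)"
      by (metis linorder_neqE_linordered_idom prod.collapse)
    then show ?thesis
    proof cases
      case 1 then show ?thesis using less[of a b] a b by blast
    next
      case 2 then show ?thesis using less[of b a] a b by (simp add: add.commute)
    qed
  qed
  show "a + b \<noteq> 0 \<and> val2 (a + b) = val2 a \<and> lc2 (a + b) = lc2 a + lc2 b"
    if "val2 a = val2 b" "lc2 a + lc2 b \<noteq> 0"
  proof -
    have e: "fls_subdegree a = fls_subdegree b" "fls_subdegree (fls_lead a) = fls_subdegree (fls_lead b)"
      using that(1) by (auto simp: val2_def)
    have l: "fls_lead (fls_lead a) + fls_lead (fls_lead b) \<noteq> 0" using that(2) by (simp add: lc2_def)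
    note i = fls_lead_add_eq[OF e(2) l]
    show ?thesis using fls_lead_add_eq[OF e(1) i(1)] i by (simp add: val2_def lc2_def)
  qed
qed

text \<open>The effect on leading coefficients of replacing the uniformizers by multiples of themselves.\<close>

lemma (in leading_terms) rescaled:
  assumes "\<alpha> \<noteq> 0" "\<beta> \<noteq> 0"
  shows "leading_terms val (\<lambda>a. lc a * (\<alpha> powi fst (val a) * \<beta> powi snd (val a)))"
proof
  fix a b :: 'f
  assume a: "a \<noteq> 0"
  show "lc a * (\<alpha> powi fst (val a) * \<beta> powi snd (val a)) \<noteq> 0"
    using lc_nonzero[OF a] assms by simp
  assume b: "b \<noteq> 0"
  show "val (a * b) = (fst (val a) + fst (val b), snd (val a) + snd (val b))" by (rule val_mult[OF a b])
  show "lc (a * b) * (\<alpha> powi fst (val (a * b)) * \<beta> powi snd (val (a * b))) =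
      lc a * (\<alpha> powi fst (val a) * \<beta> powi snd (val a)) * (lc b * (\<alpha> powi fst (val b) * \<beta> powi snd (val b)))"
    unfolding val_mult[OF a b] lc_mult[OF a b] using assms by (simp add: power_int_add mult_ac)
  show "a + b \<noteq> 0 \<and> (val (a + b) = val a \<and> lc (a + b) * (\<alpha> powi fst (val (a + b)) * \<beta> powi snd (val (a + b))) =
        lc a * (\<alpha> powi fst (val a) * \<beta> powi snd (val a)) \<or>
      val (a + b) = val b \<and> lc (a + b) * (\<alpha> powi fst (val (a + b)) * \<beta> powi snd (val (a + b))) =
        lc b * (\<alpha> powi fst (val b) * \<beta> powi snd (val b)))" if "val a \<noteq> val b"
    using add_neq[OF a b that] by auto
  show "a + b \<noteq> 0 \<and> val (a + b) = val a \<and> lc (a + b) * (\<alpha> powi fst (val (a + b)) * \<beta> powi snd (val (a + b))) =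
      lc a * (\<alpha> powi fst (val a) * \<beta> powi snd (val a)) + lc b * (\<alpha> powi fst (val b) * \<beta> powi snd (val b))"
    if v: "val a = val b" and s: "lc a * (\<alpha> powi fst (val a) * \<beta> powi snd (val a)) + lc b * (\<alpha> powi fst (val b) * \<beta> powi snd (val b)) \<noteq> 0"
  proof -
    have "lc a + lc b \<noteq> 0" using s unfolding v by (auto simp flip: distrib_right)
    then show ?thesis using add_eq[OF a b v] v by (simp add: distrib_right)
  qed
qed

text \<open>Cramer's rule in the exponents, after extracting roots of order \<open>e1 f2 - f1 e2\<close>. With this, the uniformizers
  can be rescaled such that two given elements with independent values get leading coefficient 1.\<close>

lemma monomial_equations_solvable:
  fixes x y :: "'r::alg_closed_field"
  assumes "x \<noteq> 0" "y \<noteq> 0" and det: "e1 * f2 \<noteq> f1 * e2"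
  shows "\<exists>\<alpha> \<beta>. \<alpha> \<noteq> 0 \<and> \<beta> \<noteq> 0 \<and> \<alpha> powi e1 * \<beta> powi f1 = x \<and> \<alpha> powi e2 * \<beta> powi f2 = y"
proof -
  define d where "d = e1 * f2 - f1 * e2"
  have root: "\<exists>r. r \<noteq> 0 \<and> r powi d = z" if "z \<noteq> 0" for z :: 'r
  proof -
    have pos: "nat \<bar>d\<bar> > 0" using det by (simp add: d_def)
    obtain r where r: "r ^ nat \<bar>d\<bar> = z" using nth_root_exists[OF pos] by blast
    have r0: "r \<noteq> 0" using r pos that by auto
    show ?thesis
    proof (cases "d \<ge> 0")
      case True
      then show ?thesis using r r0 by (auto simp: power_int_def)
    next
      case False
      then show ?thesis using r r0 by (intro exI[of _ "inverse r"]) (auto simp: power_int_def)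
    qed
  qed
  obtain r where r: "r \<noteq> 0" "r powi d = x" using root[OF assms(1)] by blast
  obtain s where s: "s \<noteq> 0" "s powi d = y" using root[OF assms(2)] by blast
  define \<alpha> \<beta> where "\<alpha> = r powi f2 * s powi (- f1)" and "\<beta> = r powi (- e2) * s powi e1"
  have ar: "r powi m * r powi n = r powi (m + n)" and as: "s powi m * s powi n = s powi (m + n)" for m n
    using r(1) s(1) by (simp_all add: power_int_add)
  have calc: "\<alpha> powi e * \<beta> powi f = r powi (f2 * e - e2 * f) * s powi (e1 * f - f1 * e)" for e f
  proof -
    have "\<alpha> powi e * \<beta> powi f = (r powi (f2 * e) * r powi (- e2 * f)) * (s powi (- f1 * e) * s powi (e1 * f))"
      unfolding \<alpha>_def \<beta>_def power_int_mult_distrib power_int_mult by (simp add: mult_ac)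
    also have "\<dots> = r powi (f2 * e + - e2 * f) * s powi (- f1 * e + e1 * f)"
      unfolding ar as ..
    finally show ?thesis by (simp add: algebra_simps)
  qed
  have "\<alpha> powi e1 * \<beta> powi f1 = x"
    unfolding calc using r(2) by (simp add: d_def mult.commute)
  moreover have "\<alpha> powi e2 * \<beta> powi f2 = y"
    unfolding calc using s(2) by (simp add: d_def mult.commute)
  moreover have "\<alpha> \<noteq> 0" "\<beta> \<noteq> 0" using r(1) s(1) by (auto simp: \<alpha>_def \<beta>_def)
  ultimately show ?thesis by blast
qed

text \<open>The substitution \<open>X \<mapsto> e X\<close> for a sign \<open>e\<close>, combined with \<open>h\<close> on the coefficients.\<close>

definition fls_twist :: "('a::comm_ring_1 \<Rightarrow> 'a) \<Rightarrow> 'a \<Rightarrow> 'a fls \<Rightarrow> 'a fls"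
  where "fls_twist h e f = Abs_fls (\<lambda>n. (if odd n then e else 1) * h (fls_nth f n))"

lemma fls_twist_nth:
  assumes "h 0 = 0"
  shows "fls_nth (fls_twist h e f) n = (if odd n then e else 1) * h (fls_nth f n)"
  unfolding fls_twist_def
  by (rule nth_Abs_fls_lower_bound[of "fls_subdegree f"]) (simp add: assms)

locale twist =
  fixes h :: "'a::field \<Rightarrow> 'a" and e :: 'a
  assumes h: "ring_morphism h" and e: "e = 1 \<or> e = -1"
begin

lemma nth: "fls_nth (fls_twist h e f) n = (if odd n then e else 1) * h (fls_nth f n)"
  by (rule fls_twist_nth) (rule ring_morphismD(4)[OF h])

lemma subdegree: "fls_subdegree (fls_twist h e f) = fls_subdegree f"
proof (cases "f = 0")
  case True
  then show ?thesis by (simp add: fls_twist_def ring_morphismD(4)[OF h] zero_fls_def[symmetric])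
next
  case False
  then have "h (fls_nth f (fls_subdegree f)) \<noteq> 0" using ring_morphism_inj[OF h] by fastforce
  then show ?thesis using e
    by (intro fls_subdegree_eqI) (auto simp: nth ring_morphismD(4)[OF h])
qed

lemma lead: "fls_lead (fls_twist h e f) = (if odd (fls_subdegree f) then e else 1) * h (fls_lead f)"
  by (simp add: fls_lead_def subdegree nth)

lemma morphism: "ring_morphism (fls_twist h e)"
  unfolding ring_morphism_def
proof (intro conjI allI)
  note H = ring_morphismD[OF h]
  show "fls_twist h e 1 = 1" by (rule fls_eqI) (simp add: nth H)
  show "fls_twist h e (f + g) = fls_twist h e f + fls_twist h e g" for f g
    by (rule fls_eqI) (simp add: nth H algebra_simps)
  show "fls_twist h e (f * g) = fls_twist h e f * fls_twist h e g" for f g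
  proof (rule fls_eqI)
    fix n
    show "fls_nth (fls_twist h e (f * g)) n = fls_nth (fls_twist h e f * fls_twist h e g) n"
      unfolding nth fls_times_nth(2) subdegree ring_morphism_sum[OF h] sum_distrib_left
      by (rule sum.cong) (use e in \<open>auto simp: H nth\<close>)
  qed
qed

lemma const: "fls_twist h e (fls_const c) = fls_const (h c)"
  by (rule fls_eqI) (simp add: nth ring_morphismD[OF h])

lemma X: "fls_twist h e fls_X = fls_const e * fls_X"
  by (rule fls_eqI) (auto simp: nth ring_morphismD[OF h])

end

lemma twist_sign: "twist (\<lambda>a::'a::field. a) (-1)"
  by unfold_locales (auto simp: ring_morphism_id)

definition swap_u :: "'r::field fls fls \<Rightarrow> 'r fls fls"
  where "swap_u = fls_twist (\<lambda>a. a) (-1)"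

definition swap_w :: "'r::field fls fls \<Rightarrow> 'r fls fls"
  where "swap_w = fls_twist (fls_twist (\<lambda>a. a) (-1)) 1"

interpretation sign: twist "\<lambda>a::'r::field. a" "-1"
  by (rule twist_sign)

interpretation sign_w: twist "fls_twist (\<lambda>a::'r::field. a) (-1)" 1
  by unfold_locales (auto simp: sign.morphism)

lemmas swap_morphism = sign.morphism[where 'r = "'r::field fls", folded swap_u_def] sign_w.morphism[folded swap_w_def]

text \<open>The leading coefficient of an eigenfunction of \<open>u \<mapsto> -u\<close> is multiplied by the sign \<open>(-1)\<^sup>n\<close>, where \<open>n\<close>
  is the order in \<open>u\<close>, so the eigenvalue is that sign.\<close>

lemma parity_u:
  fixes f :: "'r::field_char_0 fls fls"
  assumes "f \<noteq> 0"
  shows "swap_u f = f \<Longrightarrow> even (fst (val2 f))" "swap_u f = - f \<Longrightarrow> odd (fst (val2 f))"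
proof -
  have l: "fls_lead (swap_u f) = (if odd (fls_subdegree f) then -1 else 1) * fls_lead f"
    unfolding swap_u_def by (rule sign.lead)
  note nz = fls_lead_nonzero[OF assms]
  show "even (fst (val2 f))" if "swap_u f = f"
    using l nz that by (auto simp: val2_def split: if_splits)
  have "fls_lead (- f) = - fls_lead f" by (simp add: fls_lead_def)
  then show "odd (fst (val2 f))" if "swap_u f = - f"
    using l nz that by (auto simp: val2_def split: if_splits)
qed

lemma parity_w:
  fixes f :: "'r::field_char_0 fls fls"
  assumes "f \<noteq> 0"
  shows "swap_w f = f \<Longrightarrow> even (snd (val2 f))" "swap_w f = - f \<Longrightarrow> odd (snd (val2 f))"
proof -
  have "fls_lead (swap_w f) = fls_twist (\<lambda>a. a) (-1) (fls_lead f)"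
    unfolding swap_w_def sign_w.lead by simp
  then have l: "fls_lead (fls_lead (swap_w f)) =
      (if odd (fls_subdegree (fls_lead f)) then -1 else 1) * fls_lead (fls_lead f)"
    by (simp add: sign.lead)
  note nz = fls_lead_nonzero[OF fls_lead_nonzero[OF assms]]
  show "even (snd (val2 f))" if "swap_w f = f"
    using l nz that by (auto simp: val2_def split: if_splits)
  have "fls_lead (fls_lead (- f)) = - fls_lead (fls_lead f)" by (simp add: fls_lead_def)
  then show "odd (snd (val2 f))" if "swap_w f = - f"
    using l nz that by (auto simp: val2_def split: if_splits)
qed

section \<open>The generic point along the elliptic curve\<close>

definition const2 :: "'r::zero \<Rightarrow> 'r fls fls" where "const2 c = fls_const (fls_const c)"

lemma ring_morphism_const2: "ring_morphism (const2 :: 'r::comm_ring_1 \<Rightarrow> _)"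
  unfolding const2_def
  by (rule ring_morphism_comp[OF ring_morphism_fls_const ring_morphism_fls_const])

text \<open>Let \<open>s\<^sup>2 = q(T)\<close> and \<open>l = l(T)\<close> at the generic point of \<open>E\<close>. The conic \<open>g\<^sup>2 = s\<^sup>2 + l V\<^sup>2\<close> has the
  rational point \<open>(g, V) = (s, 0)\<close>; \<open>gen_V'\<close> and \<open>gen_g'\<close> are its parametrization by the lines through
  this point, with parameter \<open>w\<close>. Changing the sign of \<open>w\<close> changes that of \<open>V\<close> and fixes \<open>g\<close>.\<close>

definition gen_V' :: "'r::field \<Rightarrow> 'r \<Rightarrow> 'r fls"
  where "gen_V' s l = fls_const (2 * s) * fls_X / (1 - fls_const l * fls_X ^ 2)"

definition gen_g' :: "'r::field \<Rightarrow> 'r \<Rightarrow> 'r fls"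
  where "gen_g' s l = fls_const s * (1 + fls_const l * fls_X ^ 2) / (1 - fls_const l * fls_X ^ 2)"

definition gen_V :: "'r::field \<Rightarrow> 'r \<Rightarrow> 'r fls fls" where "gen_V s l = fls_const (gen_V' s l)"

text \<open>The coordinate \<open>x\<^sub>1\<close>, where \<open>x\<^sub>1 x\<^sub>2 = g\<^sup>2\<close>. As \<open>x\<^sub>2 = g (1 - u) / (1 + u)\<close>, exchanging \<open>x\<^sub>1\<close> and \<open>x\<^sub>2\<close>
  amounts to changing the sign of \<open>u\<close>.\<close>

definition gen_A :: "'r::field \<Rightarrow> 'r \<Rightarrow> 'r fls fls"
  where "gen_A s l = fls_const (gen_g' s l) * ((1 + fls_X) / (1 - fls_X))"

lemma lead_one_plus:
  fixes f :: "'r::field fls"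
  assumes "f = 0 \<or> fls_subdegree f > 0"
  shows "1 + f \<noteq> 0" "fls_subdegree (1 + f) = 0" "fls_lead (1 + f) = 1"
    "1 - f \<noteq> 0" "fls_subdegree (1 - f) = 0" "fls_lead (1 - f) = 1"
  using fls_lead_add_less[of 1 f] fls_lead_add_less[of 1 "-f"] assms by auto

lemma lead_divide:
  fixes f g :: "'r::field fls"
  assumes "f \<noteq> 0" "g \<noteq> 0"
  shows "fls_subdegree (f / g) = fls_subdegree f - fls_subdegree g" "fls_lead (f / g) = fls_lead f / fls_lead g"
proof -
  have "f / g \<noteq> 0" "f / g * g = f" using assms by auto
  then show "fls_subdegree (f / g) = fls_subdegree f - fls_subdegree g" "fls_lead (f / g) = fls_lead f / fls_lead g"
    using fls_lead_mult[of "f / g" g] assms(2) fls_lead_nonzero[OF assms(2)] by (auto simp: field_simps)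
qed

lemma lX:
  fixes l :: "'r::field"
  shows "fls_const l * fls_X ^ 2 = 0 \<or> fls_subdegree (fls_const l * fls_X ^ 2 :: 'r fls) > 0"
  by (cases "l = 0") (simp_all add: fls_subdegree_pow)

lemma gen_V'_props:
  fixes s :: "'r::field_char_0"
  assumes "s \<noteq> 0"
  shows "gen_V' s l \<noteq> 0" "fls_subdegree (gen_V' s l) = 1"
proof -
  note L = lead_one_plus[OF lX[of l]]
  have n: "fls_const (2 * s) * fls_X \<noteq> 0" "fls_subdegree (fls_const (2 * s) * fls_X) = 1"
    using assms by auto
  show "gen_V' s l \<noteq> 0" using n L by (auto simp: gen_V'_def)
  show "fls_subdegree (gen_V' s l) = 1"
    unfolding gen_V'_def lead_divide(1)[OF n(1) L(4)] using n(2) L(5) by simp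
qed

lemma gen_g'_props:
  fixes s :: "'r::field_char_0"
  assumes "s \<noteq> 0"
  shows "gen_g' s l \<noteq> 0" "fls_subdegree (gen_g' s l) = 0" "fls_lead (gen_g' s l) = s"
    "gen_g' s l ^ 2 = fls_const (s ^ 2) + gen_V' s l ^ 2 * fls_const l"
proof -
  note L = lead_one_plus[OF lX[of l]]
  have s0: "fls_const s \<noteq> 0" using assms by simp
  have n: "fls_const s * (1 + fls_const l * fls_X ^ 2) \<noteq> 0"
    "fls_subdegree (fls_const s * (1 + fls_const l * fls_X ^ 2)) = 0"
    "fls_lead (fls_const s * (1 + fls_const l * fls_X ^ 2)) = s"
    using fls_lead_mult[OF s0 L(1)] s0 L by auto
  show "gen_g' s l \<noteq> 0" using n L by (auto simp: gen_g'_def)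
  show "fls_subdegree (gen_g' s l) = 0" "fls_lead (gen_g' s l) = s"
    unfolding gen_g'_def lead_divide[OF n(1) L(4)] using n L by simp_all
  define S Y where "S = fls_const s" and "Y = fls_const l * (fls_X :: 'r fls) ^ 2"
  have Y: "1 - Y \<noteq> 0" using L(4) by (simp add: Y_def)
  have g: "gen_g' s l = S * (1 + Y) / (1 - Y)" by (simp add: gen_g'_def S_def Y_def)
  have "gen_V' s l = 2 * S * fls_X / (1 - Y)"
    by (simp add: gen_V'_def S_def Y_def flip: fls_const_mult_const)
  then have "gen_V' s l ^ 2 * fls_const l = 4 * S ^ 2 * Y / (1 - Y) ^ 2"
    by (simp add: power_divide power_mult_distrib Y_def)
  then have "fls_const (s ^ 2) + gen_V' s l ^ 2 * fls_const l = S ^ 2 + 4 * S ^ 2 * Y / (1 - Y) ^ 2"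
    by (simp add: S_def fls_const_power)
  also have "\<dots> = S ^ 2 * ((1 - Y) ^ 2 + 4 * Y) / (1 - Y) ^ 2" using Y by (simp add: field_simps)
  also have "(1 - Y) ^ 2 + 4 * Y = (1 + Y) ^ 2" by (simp add: power2_eq_square algebra_simps)
  finally show "gen_g' s l ^ 2 = fls_const (s ^ 2) + gen_V' s l ^ 2 * fls_const l"
    unfolding g by (simp add: power_divide power_mult_distrib)
qed

lemma one_pm_X:
  "1 + fls_X \<noteq> (0 :: 'r::field fls)" "1 - fls_X \<noteq> (0 :: 'r fls)"
  "fls_subdegree (1 + fls_X :: 'r fls) = 0" "fls_lead (1 + fls_X :: 'r fls) = 1"
  "fls_subdegree (1 - fls_X :: 'r fls) = 0" "fls_lead (1 - fls_X :: 'r fls) = 1"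
  using lead_one_plus[of "fls_X :: 'r fls"] by auto

lemma gen_A_props:
  fixes s :: "'r::field_char_0"
  assumes "s \<noteq> 0"
  shows "gen_A s l \<noteq> 0" "val2 (gen_A s l) = (0, 0)" "lc2 (gen_A s l) = s"
    "\<exists>y. y \<noteq> 0 \<and> fls_subdegree y > 0 \<and> gen_A s l = fls_const (gen_g' s l) + y"
proof -
  note G = gen_g'_props[OF assms, of l]
  note X = one_pm_X[where 'r = "'r fls"]
  have q: "(1 + fls_X) / (1 - fls_X) \<noteq> (0 :: 'r fls fls)" using X by simp
  have c: "fls_const (gen_g' s l) \<noteq> 0" using G by simp
  show "gen_A s l \<noteq> 0" using q c by (simp add: gen_A_def)
  have l1: "fls_subdegree (gen_A s l) = 0" "fls_lead (gen_A s l) = gen_g' s l"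
    unfolding gen_A_def fls_lead_mult[OF c q] lead_divide[OF X(1,2)] by (simp_all add: X)
  then show "val2 (gen_A s l) = (0, 0)" "lc2 (gen_A s l) = s" using G by (simp_all add: val2_def lc2_def)
  define y where "y = fls_const (gen_g' s l) * (fls_const 2 * fls_X / (1 - fls_X))"
  have two: "fls_const 2 * fls_X \<noteq> (0 :: 'r fls fls)" by simp
  have y2: "fls_const 2 * fls_X / (1 - fls_X) \<noteq> (0 :: 'r fls fls)" using two X by simp
  have "y \<noteq> 0" using c y2 unfolding y_def by simp
  moreover have "fls_subdegree y > 0"
    unfolding y_def fls_lead_mult(1)[OF c y2] lead_divide(1)[OF two X(2)] by (simp add: X)
  moreover have "gen_A s l = fls_const (gen_g' s l) + y"
  proof -
    have "(1 + fls_X) / (1 - fls_X) = 1 + fls_const 2 * fls_X / (1 - fls_X :: 'r fls fls)"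
      using X by (simp add: field_simps)
    then show ?thesis by (simp add: gen_A_def y_def algebra_simps)
  qed
  ultimately show "\<exists>y. y \<noteq> 0 \<and> fls_subdegree y > 0 \<and> gen_A s l = fls_const (gen_g' s l) + y" by blast
qed

lemma swap_const2: "swap_u (const2 c) = const2 c" "swap_w (const2 c) = const2 c"
proof -
  show "swap_u (const2 c) = const2 c" by (simp add: swap_u_def const2_def sign.const)
  show "swap_w (const2 c) = const2 c" by (simp add: swap_w_def const2_def sign.const sign_w.const)
qed

lemma swap_gen:
  fixes s :: "'r::field_char_0"
  assumes "s \<noteq> 0"
  shows "swap_u (gen_A s l) = fls_const (gen_g' s l ^ 2) / gen_A s l" "swap_u (gen_A s l) \<noteq> gen_A s l"
    "swap_u (gen_V s l) = gen_V s l" "swap_w (gen_A s l) = gen_A s l" "swap_w (gen_V s l) = - gen_V s l"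
proof -
  note u = ring_morphismD[OF swap_morphism(1)] ring_morphism_divide[OF swap_morphism(1)]
  note w = ring_morphismD[OF swap_morphism(2)] ring_morphism_divide[OF swap_morphism(2)]
  note v = ring_morphismD[OF sign.morphism] ring_morphism_divide[OF sign.morphism]
  note G = gen_g'_props[OF assms, of l]
  note X = one_pm_X[where 'r = "'r fls"]
  have uc: "swap_u (fls_const g) = fls_const g" for g :: "'r fls" by (simp add: swap_u_def sign.const)
  have uX: "swap_u fls_X = - (fls_X :: 'r fls fls)" by (simp add: swap_u_def sign.X)
  have wX: "swap_w fls_X = (fls_X :: 'r fls fls)" by (simp add: swap_w_def sign_w.X)
  have wc: "swap_w (fls_const g) = fls_const (fls_twist (\<lambda>a. a) (-1) g)" for g :: "'r fls"
    by (simp add: swap_w_def sign_w.const)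
  have vX: "fls_twist (\<lambda>a. a) (-1) fls_X = - (fls_X :: 'r fls)" by (simp add: sign.X)
  have gg: "fls_twist (\<lambda>a. a) (-1) (gen_g' s l) = gen_g' s l"
    by (simp add: gen_g'_def v vX sign.const)
  have vv: "fls_twist (\<lambda>a. a) (-1) (gen_V' s l) = - gen_V' s l"
    by (simp add: gen_V'_def v vX sign.const)
  show "swap_w (gen_A s l) = gen_A s l" by (simp add: gen_A_def w wc wX gg)
  show "swap_w (gen_V s l) = - gen_V s l" by (simp add: gen_V_def wc vv)
  show "swap_u (gen_V s l) = gen_V s l" by (simp add: gen_V_def uc)
  have uA: "swap_u (gen_A s l) = fls_const (gen_g' s l) * ((1 - fls_X) / (1 + fls_X))"
    by (simp add: gen_A_def u uc uX)
  have g0: "fls_const (gen_g' s l) \<noteq> 0" using G by simp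
  show "swap_u (gen_A s l) = fls_const (gen_g' s l ^ 2) / gen_A s l"
  proof -
    have "g * (a / b) = g ^ 2 / (g * (b / a))" if "g \<noteq> 0" "a \<noteq> 0" "b \<noteq> 0" for g a b :: "'r fls fls"
      using that by (simp add: field_simps power2_eq_square)
    from this[OF g0 X(2,1)] show ?thesis unfolding uA unfolding gen_A_def fls_const_power .
  qed
  show "swap_u (gen_A s l) \<noteq> gen_A s l"
  proof
    assume "swap_u (gen_A s l) = gen_A s l"
    then have "(1 - fls_X) / (1 + fls_X) = (1 + fls_X) / (1 - fls_X :: 'r fls fls)"
      unfolding uA unfolding gen_A_def by (rule mult_left_cancel[THEN iffD1, OF g0])
    then have "(1 - fls_X) * (1 - fls_X) = (1 + fls_X) * (1 + fls_X :: 'r fls fls)"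
      using X by (simp add: frac_eq_eq)
    then have "4 * fls_X = (0 :: 'r fls fls)" by (simp add: algebra_simps)
    then show False by simp
  qed
qed

lemma ring_morphism_fixed:
  assumes "ring_morphism h" shows "subring_set {f. h f = f}"
  by (auto simp: subring_set_def ring_morphismD[OF assms])

text \<open>No nonzero linear form over the field with two elements vanishes on all reductions modulo 2 of the
  vectors, so these reductions span the plane and two of them form a basis.\<close>

lemma odd_determinant:
  fixes v :: "'i \<Rightarrow> int \<times> int"
  assumes "\<exists>i\<in>I. odd (fst (v i))" "\<exists>i\<in>I. odd (snd (v i))" "\<exists>i\<in>I. odd (fst (v i) + snd (v i))"
  shows "\<exists>i\<in>I. \<exists>j\<in>I. odd (fst (v i) * snd (v j) - snd (v i) * fst (v j))"
proof -
  obtain a b c where abc: "a \<in> I" "odd (fst (v a))" "b \<in> I" "odd (snd (v b))" "c \<in> I" "odd (fst (v c) + snd (v c))"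
    using assms by blast
  show ?thesis
  proof (cases "even (snd (v a))")
    case True
    then have "odd (fst (v a) * snd (v b) - snd (v a) * fst (v b))" using abc by simp
    then show ?thesis using abc by blast
  next
    case False
    then have "odd (fst (v a) * snd (v c) - snd (v a) * fst (v c))" using abc by (simp; blast)
    then show ?thesis using abc by blast
  qed
qed

text \<open>If \<open>\<tau>\<close> were constant, then so would be \<open>t\<close>; hence \<open>\<tau>\<close> is transcendental and the equation for \<open>s\<close> and \<open>t\<close>
  becomes an identity of polynomials in \<open>\<tau>\<close>.\<close>

lemma elliptic_generic_point_not_rational:
  fixes c :: "'k::{alg_closed_field, field_char_0} \<Rightarrow> 'r::field"
  assumes c: "ring_morphism c" and t: "t \<notin> range c"
    and r: "r1 \<noteq> r2" "r1 \<noteq> r3" "r2 \<noteq> r3" and e: "e \<noteq> 0"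
    and s: "s ^ 2 = c e * ((t - c r1) * (t - c r2) * (t - c r3))"
    and ft: "t * poly_via c \<tau> B = poly_via c \<tau> A" "poly_via c \<tau> B \<noteq> 0"
    and fs: "s * poly_via c \<tau> D = poly_via c \<tau> C" "poly_via c \<tau> D \<noteq> 0"
  shows False
proof -
  note P = ring_morphismD[OF ring_morphism_poly_via[OF c, of \<tau>]]
  note C = ring_morphismD[OF c]
  have \<tau>: "\<tau> \<notin> range c"
  proof
    assume "\<tau> \<in> range c"
    then obtain z where "\<tau> = c z" by blast
    then have ev: "poly_via c \<tau> f = c (poly f z)" for f
      using poly_via_morphism[OF c ring_morphism_id(1), of z f] by (simp add: poly_via_id)
    have "t = c (poly A z / poly B z)"
      using ft unfolding ev ring_morphism_divide[OF c] by (simp add: field_simps)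
    then show False using t by blast
  qed
  let ?E = "C ^ 2 * B ^ 3 - smult e (D ^ 2 * ((A - smult r1 B) * (A - smult r2 B) * (A - smult r3 B)))"
  define b d where "b = poly_via c \<tau> B" and "d = poly_via c \<tau> D"
  have lin: "poly_via c \<tau> (A - smult r B) = (t - c r) * b" for r
    unfolding P poly_via_smult[OF c] ft(1)[symmetric] b_def by (simp add: algebra_simps)
  have "poly_via c \<tau> ?E = (s * d) ^ 2 * b ^ 3 - c e * (d ^ 2 * (((t - c r1) * b) * ((t - c r2) * b) * ((t - c r3) * b)))"
    unfolding P(6)[where x = "C ^ 2 * B ^ 3"] poly_via_smult[OF c, of \<tau> e] P(3,7) lin fs(1)[symmetric] b_def d_def ..
  also have "\<dots> = (s ^ 2 - c e * ((t - c r1) * (t - c r2) * (t - c r3))) * (d ^ 2 * b ^ 3)"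
    by (simp add: power2_eq_square power3_eq_cube algebra_simps)
  also have "\<dots> = 0" by (simp add: s)
  finally have "?E = 0" using transcendental_if_not_constant[OF c \<tau>] by blast
  then have eq: "C ^ 2 * B ^ 3 = smult e (D ^ 2 * ((A - smult r1 B) * (A - smult r2 B) * (A - smult r3 B)))" by simp
  have "B \<noteq> 0" "D \<noteq> 0" using ft(2) fs(2) by auto
  then obtain z where "A = smult z B" using cubic_curve_not_rational[OF _ _ e r eq] by blast
  then have "t * poly_via c \<tau> B = c z * poly_via c \<tau> B" using ft(1) by (simp add: poly_via_smult[OF c])
  then have "t = c z" using ft(2) by simp
  then show False using t by blast
qed

text \<open>The \<open>Y i\<close> are affine coordinates of the model, in which the involutions are diagonal; \<open>H1\<close>, \<open>H3\<close>, \<open>H4\<close>, \<open>H5\<close> are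
  the homogeneous coordinates of the point of \<open>X\<close> as polynomials in the \<open>Y i\<close>. Neither involution nor their product fixes
  all \<open>Y i\<close>, since it would then fix \<open>x\<^sub>1/x\<^sub>3\<close> and \<open>V\<close>. So the values of two of the \<open>Y i\<close> have an odd
  determinant, and the ruled residue theorem applies with at most one further generator. The
  leading coefficients of \<open>H4 + H5\<close> and \<open>H1\<close>, divided by that of \<open>H3\<close>, are \<open>t\<close> and \<open>s\<close>.\<close>

theorem no_diagonal_model:
  fixes c :: "'k::{alg_closed_field, field_char_0} \<Rightarrow> 'r::{alg_closed_field, field_char_0}"
    and Y :: "'m::finite \<Rightarrow> 'r fls fls"
  assumes c: "ring_morphism c" and t: "t \<notin> range c"
    and r: "r1 \<noteq> r2" "r1 \<noteq> r3" "r2 \<noteq> r3" and e: "e \<noteq> 0"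
    and s: "s ^ 2 = c e * ((t - c r1) * (t - c r2) * (t - c r3))"
    and card: "CARD('m) \<le> 4" and n0: "Y n0 = 1"
    and Yu: "\<And>i. swap_u (Y i) = Y i \<or> swap_u (Y i) = - Y i"
    and Yw: "\<And>i. swap_w (Y i) = Y i \<or> swap_w (Y i) = - Y i"
    and gen: "\<And>R. subring_set R \<Longrightarrow> range (\<lambda>a. const2 (c a)) \<subseteq> R \<Longrightarrow> range Y \<subseteq> R \<Longrightarrow>
       H1 \<in> R \<and> H3 \<in> R \<and> H4 \<in> R \<and> H5 \<in> R"
    and H: "H3 \<noteq> 0" "H1 = gen_A s l * H3" "H4 + H5 = const2 t * H3" "H4 - H5 = gen_V s l * H3"
  shows False
proof -
  interpret L: leading_terms val2 "lc2 :: 'r fls fls \<Rightarrow> 'r" by (rule leading_terms_fls)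
  have s0: "s \<noteq> 0"
  proof
    assume "s = 0"
    then have "t - c r1 = 0 \<or> t - c r2 = 0 \<or> t - c r3 = 0 \<or> c e = 0" using s by auto
    then show False using t e ring_morphism_inj[OF c] by auto
  qed
  define k where "k = (\<lambda>a. const2 (c a))"
  have k: "ring_morphism k" unfolding k_def by (rule ring_morphism_comp[OF ring_morphism_const2 c])
  have genk: "H1 \<in> R \<and> H3 \<in> R \<and> H4 \<in> R \<and> H5 \<in> R"
    if "subring_set R" "range k \<subseteq> R" "range Y \<subseteq> R" for R
    using gen that unfolding k_def by blast
  have fixed: False if h: "ring_morphism h" "\<And>a. h (const2 a) = const2 a" "\<And>i. h (Y i) = Y i"
    "h (gen_A s l) \<noteq> gen_A s l \<or> h (gen_V s l) \<noteq> gen_V s l" for h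
  proof -
    have "subring_set {f. h f = f}" "range (\<lambda>a. const2 (c a)) \<subseteq> {f. h f = f}" "range Y \<subseteq> {f. h f = f}"
      using ring_morphism_fixed[OF h(1)] h(2,3) by auto
    then have "h H1 = H1" "h H3 = H3" "h H4 = H4" "h H5 = H5" using gen by auto
    then have "h (gen_A s l) * H3 = gen_A s l * H3" "h (gen_V s l) * H3 = gen_V s l * H3"
      using ring_morphismD(3,6)[OF h(1)] H(2,4) by metis+
    then show False using h(4) H(1) by simp
  qed
  have V0: "gen_V s l \<noteq> 0" using gen_V'_props(1)[OF s0] by (simp add: gen_V_def)
  then have V2: "- gen_V s l \<noteq> gen_V s l"
  proof -
    have "2 * gen_V s l \<noteq> 0" using V0 by simp
    then show ?thesis by (metis add.right_inverse mult_2)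
  qed
  have eo: "(swap_u (Y i) = Y i \<longleftrightarrow> even (fst (val2 (Y i)))) \<and> (swap_w (Y i) = Y i \<longleftrightarrow> even (snd (val2 (Y i))))"
    if "Y i \<noteq> 0" for i
    using parity_u[OF that] parity_w[OF that] Yu[of i] Yw[of i] by auto
  have z0: "swap_u (0 :: 'r fls fls) = 0" "swap_w (0 :: 'r fls fls) = 0"
    by (simp_all add: ring_morphismD[OF swap_morphism(1)] ring_morphismD[OF swap_morphism(2)])
  define I where "I = {i. Y i \<noteq> 0}"
  have 1: "\<exists>i\<in>I. odd (fst (val2 (Y i)))"
  proof (rule ccontr)
    assume "\<not> ?thesis"
    then have *: "swap_u (Y i) = Y i" for i using eo z0 by (cases "Y i = 0") (auto simp: I_def)
    show False
      by (rule fixed[OF swap_morphism(1) swap_const2(1) *]) (simp add: swap_gen(2)[OF s0])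
  qed
  have 2: "\<exists>i\<in>I. odd (snd (val2 (Y i)))"
  proof (rule ccontr)
    assume "\<not> ?thesis"
    then have *: "swap_w (Y i) = Y i" for i using eo z0 by (cases "Y i = 0") (auto simp: I_def)
    show False
      by (rule fixed[OF swap_morphism(2) swap_const2(2) *]) (simp add: swap_gen(5)[OF s0] V2)
  qed
  have 3: "\<exists>i\<in>I. odd (fst (val2 (Y i)) + snd (val2 (Y i)))"
  proof (rule ccontr)
    assume *: "\<not> ?thesis"
    have uw: "swap_u (swap_w (Y i)) = Y i" for i
    proof (cases "Y i = 0")
      case False
      then have "even (fst (val2 (Y i)) + snd (val2 (Y i)))" using * by (auto simp: I_def)
      then show ?thesis
        using eo[OF False] Yu[of i] Yw[of i] ring_morphismD(5)[OF swap_morphism(1), of "Y i"] by auto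
    qed (simp add: z0)
    have "swap_u (swap_w (gen_V s l)) \<noteq> gen_V s l"
      using swap_gen(3,5)[OF s0, of l] V2 ring_morphismD(5)[OF swap_morphism(1), of "gen_V s l"] by simp
    then show False
      by (intro fixed[OF ring_morphism_comp[OF swap_morphism(1) swap_morphism(2)] _ uw] disjI2)
        (simp_all add: swap_const2)
  qed
  obtain i j where ij: "i \<in> I" "j \<in> I"
    "odd (fst (val2 (Y i)) * snd (val2 (Y j)) - snd (val2 (Y i)) * fst (val2 (Y j)))"
    using odd_determinant[OF 1 2 3] by blast
  then have det: "fst (val2 (Y i)) * snd (val2 (Y j)) \<noteq> snd (val2 (Y i)) * fst (val2 (Y j))"
    by (metis diff_self even_zero)
  have v1: "val2 (1 :: 'r fls fls) = (0, 0)" by (simp add: val2_def)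
  have dist: "i \<noteq> j" "i \<noteq> n0" "j \<noteq> n0" using det n0 v1 by (auto simp: mult.commute)
  obtain z where z: "range Y \<subseteq> {1, Y i, Y j, z}"
  proof -
    let ?S = "{n0, i, j}"
    have "card ?S = 3" using dist by simp
    then have *: "card (UNIV - ?S) \<le> Suc 0" using card by (subst card_Diff_subset) simp_all
    have uniq: "a = b" if "a \<notin> ?S" "b \<notin> ?S" for a b
    proof -
      have "a \<in> UNIV - ?S" "b \<in> UNIV - ?S" using that by blast+
      moreover have "finite (UNIV - ?S)" by simp
      ultimately show ?thesis using * card_le_Suc0_iff_eq by metis
    qed
    define z where "z = (if \<exists>n. n \<notin> ?S then Y (SOME n. n \<notin> ?S) else 1)"
    have "Y a \<in> {1, Y i, Y j, z}" for a
    proof (cases "a \<in> ?S")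
      case True
      then show ?thesis using n0 by (elim insertE) simp_all
    next
      case False
      then have "(SOME n. n \<notin> ?S) = a" using uniq[OF _ False] someI[of "\<lambda>n. n \<notin> ?S", OF False] by blast
      then have "z = Y a" unfolding z_def using False by metis
      then show ?thesis by simp
    qed
    then have "range Y \<subseteq> {1, Y i, Y j, z}" by (rule image_subsetI)
    then show ?thesis by (rule that)
  qed
  have Yi: "Y i \<noteq> 0" and Yj: "Y j \<noteq> 0" using ij by (auto simp: I_def)
  have "inverse (lc2 (Y i)) \<noteq> 0" "inverse (lc2 (Y j)) \<noteq> 0" using L.lc_nonzero Yi Yj by auto
  \<comment> \<open>Rescale the uniformizers such that \<open>Y i\<close> and \<open>Y j\<close> get leading coefficient 1.\<close>
  then obtain \<alpha> \<beta> where ab: "\<alpha> \<noteq> 0" "\<beta> \<noteq> 0"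
    "\<alpha> powi fst (val2 (Y i)) * \<beta> powi snd (val2 (Y i)) = inverse (lc2 (Y i))"
    "\<alpha> powi fst (val2 (Y j)) * \<beta> powi snd (val2 (Y j)) = inverse (lc2 (Y j))"
    using monomial_equations_solvable[OF _ _ det] by metis
  define lc' where "lc' = (\<lambda>a. lc2 a * (\<alpha> powi fst (val2 a) * \<beta> powi snd (val2 a)))"
  interpret M: leading_terms val2 lc' unfolding lc'_def by (rule L.rescaled[OF ab(1,2)])
  have lc0: "lc' a = lc2 a" if "val2 a = (0, 0)" for a using that by (simp add: lc'_def)
  have cc: "val2 (const2 a) = (0, 0) \<and> lc2 (const2 a) = a" for a :: 'r
    by (simp add: val2_def lc2_def const2_def)
  have kc: "val2 (k a) = (0, 0) \<and> lc' (k a) = c a" for a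
    unfolding k_def using cc lc0 by metis
  have lx: "lc' (Y i) = 1" "lc' (Y j) = 1"
    unfolding lc'_def ab(3,4) using L.lc_nonzero Yi Yj by auto
  let ?R = "adjoin (adjoin (adjoin (range k) (Y i)) (Y j)) z"
  obtain \<tau> where \<tau>: "\<And>a. a \<in> ?R \<Longrightarrow> a \<noteq> 0 \<Longrightarrow> \<exists>f. lc' a = poly_via c \<tau> f"
    using M.residue_of_purely_monomial_extension[OF k c kc Yi lx(1) Yj lx(2) det] by blast
  note R0 = subring_range[OF k]
  note R1 = subring_adjoin[OF R0, of "Y i"]
  note R2 = subring_adjoin[OF R1, of "Y j"]
  note R3 = subring_adjoin[OF R2, of z]
  have sub: "range k \<subseteq> ?R" "Y i \<in> ?R" "Y j \<in> ?R" "z \<in> ?R"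
    using subset_adjoin[OF R0, of "Y i"] subset_adjoin[OF R1, of "Y j"] subset_adjoin[OF R2, of z] by blast+
  have "{1, Y i, Y j, z} \<subseteq> ?R"
    by (intro insert_subsetI empty_subsetI sub subring_setD(1)[OF R3])
  then have "range Y \<subseteq> ?R" using z by (rule order_trans[rotated])
  then have HR': "H1 \<in> ?R \<and> H3 \<in> ?R \<and> H4 \<in> ?R \<and> H5 \<in> ?R"
    by (rule genk[OF R3 sub(1)])
  then have HR: "H1 \<in> ?R" "H3 \<in> ?R" "H4 + H5 \<in> ?R" using subring_setD(5)[OF R3, of H4 H5] by blast+
  have t0: "const2 t \<noteq> 0" using t ring_morphismD(4)[OF c] by (auto simp: const2_def)
  obtain B where B: "lc' H3 = poly_via c \<tau> B" using \<tau>[OF HR(2) H(1)] by blast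
  have B0: "poly_via c \<tau> B \<noteq> 0" using M.lc_nonzero[OF H(1)] B by simp
  have "lc' (H4 + H5) = t * lc' H3" unfolding H(3) M.lc_mult[OF t0 H(1)] using cc lc0 by metis
  moreover have "H4 + H5 \<noteq> 0" unfolding H(3) using t0 H(1) by simp
  ultimately obtain A where A: "t * poly_via c \<tau> B = poly_via c \<tau> A" using \<tau>[OF HR(3)] B by metis
  note GA = gen_A_props[OF s0, of l]
  have "lc' H1 = s * lc' H3" unfolding H(2) M.lc_mult[OF GA(1) H(1)] using GA(2,3) lc0 by metis
  moreover have "H1 \<noteq> 0" unfolding H(2) using GA(1) H(1) by simp
  ultimately obtain C where C: "s * poly_via c \<tau> B = poly_via c \<tau> C" using \<tau>[OF HR(1)] B by metis
  show False by (rule elliptic_generic_point_not_rational[OF c t r e s A B0 C B0])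
qed

section \<open>Polynomials in several variables\<close>

lemma eval_in_morphism:
  assumes "ring_morphism h"
  shows "h (eval_in c a f) = eval_in (\<lambda>x. h (c x)) (\<lambda>i. h (a i)) f"
  unfolding eval_in_def ring_morphism_sum[OF assms] ring_morphismD(3)[OF assms]
    ring_morphism_prod[OF assms] ring_morphismD(7)[OF assms] ..

lemma peval_eval_in: "peval f v = eval_in (\<lambda>x. x) (\<lambda>i. v $ i) f"
  by (simp add: peval_def eval_in_def)

lemma eval_in_scale:
  assumes "homogeneous d f"
  shows "eval_in c (\<lambda>i. s * a i) f = s ^ d * eval_in c a f"
proof -
  have "(\<Prod>i\<in>UNIV. (s * a i) ^ Poly_Mapping.lookup m i) = s ^ d * (\<Prod>i\<in>UNIV. a i ^ Poly_Mapping.lookup m i)"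
    if "m \<in> Poly_Mapping.keys f" for m
    using assms that unfolding homogeneous_def
    by (simp add: power_mult_distrib prod.distrib flip: power_sum)
  then show ?thesis by (simp add: eval_in_def sum_distrib_left mult_ac)
qed

lemma peval_scale:
  assumes "homogeneous d f" shows "peval f (s *s v) = s ^ d * peval f v"
proof -
  have "(\<lambda>i. (s *s v) $ i) = (\<lambda>i. s * v $ i)" by (rule ext) simp
  then show ?thesis unfolding peval_eval_in using eval_in_scale[OF assms, of "\<lambda>x. x" s "\<lambda>i. v $ i"] by metis
qed

lemma eval_in_superset:
  assumes "finite S" "Poly_Mapping.keys f \<subseteq> S" "c 0 = 0"
  shows "eval_in c a f = (\<Sum>m\<in>S. c (Poly_Mapping.lookup f m) * (\<Prod>i\<in>UNIV. a i ^ Poly_Mapping.lookup m i))"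
  unfolding eval_in_def using assms
  by (intro sum.mono_neutral_left) (auto simp: in_keys_iff)

lemma eval_in_add:
  assumes "ring_morphism c"
  shows "eval_in c a (f + g) = eval_in c a f + eval_in c a g"
proof -
  let ?S = "Poly_Mapping.keys f \<union> Poly_Mapping.keys g"
  have S: "finite ?S" "Poly_Mapping.keys f \<subseteq> ?S" "Poly_Mapping.keys g \<subseteq> ?S" "Poly_Mapping.keys (f + g) \<subseteq> ?S"
    using Poly_Mapping.keys_add[of f g] by auto
  note c = ring_morphismD[OF assms]
  show ?thesis
    unfolding eval_in_superset[where c = c, OF S(1,2) c(4)] eval_in_superset[where c = c, OF S(1,3) c(4)]
      eval_in_superset[where c = c, OF S(1,4) c(4)]
    by (simp add: lookup_add c algebra_simps sum.distrib)
qed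

lemma eval_in_single:
  assumes "ring_morphism c"
  shows "eval_in c a (Poly_Mapping.single m x) = c x * (\<Prod>i\<in>UNIV. a i ^ Poly_Mapping.lookup m i)"
  by (cases "x = 0") (simp_all add: eval_in_def ring_morphismD(4)[OF assms])

lemma eval_in_sum:
  assumes "ring_morphism c"
  shows "eval_in c a (\<Sum>i\<in>A. f i) = (\<Sum>i\<in>A. eval_in c a (f i))"
proof (induction A rule: infinite_finite_induct)
  case (insert x F)
  then show ?case by (simp add: eval_in_add[OF assms])
qed (simp_all add: eval_in_def)

text \<open>Restriction of a polynomial to a polynomial curve.\<close>

definition along :: "('n::finite \<Rightarrow> 'k::field poly) \<Rightarrow> ('n, 'k) mpoly \<Rightarrow> 'k poly"
  where "along C f = eval_in (\<lambda>x. [:x:]) C f"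

lemma poly_along: "poly (along C f) s = peval f (\<chi> i. poly (C i) s)"
proof -
  have "ring_morphism (\<lambda>p. poly p s)" by (simp add: ring_morphism_def)
  from eval_in_morphism[OF this, of "\<lambda>x. [:x:]" C f] show ?thesis
    by (simp add: along_def peval_eval_in)
qed

lemma peval_partial_deriv:
  "peval (partial_deriv j f) v =
    (\<Sum>m\<in>Poly_Mapping.keys f. of_nat (Poly_Mapping.lookup m j) * Poly_Mapping.lookup f m *
      (v $ j ^ (Poly_Mapping.lookup m j - 1) * (\<Prod>i\<in>UNIV - {j}. v $ i ^ Poly_Mapping.lookup m i)))"
  unfolding peval_eval_in partial_deriv_def eval_in_sum[OF ring_morphism_id(1)] eval_in_single[OF ring_morphism_id(1)]
proof (rule sum.cong[OF refl])
  fix m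
  have "(\<Prod>i\<in>UNIV. v $ i ^ Poly_Mapping.lookup (m - Poly_Mapping.single j 1) i) =
      v $ j ^ Poly_Mapping.lookup (m - Poly_Mapping.single j 1) j *
      (\<Prod>i\<in>UNIV - {j}. v $ i ^ Poly_Mapping.lookup (m - Poly_Mapping.single j 1) i)"
    by (rule prod.remove) auto
  also have "\<dots> = v $ j ^ (Poly_Mapping.lookup m j - 1) * (\<Prod>i\<in>UNIV - {j}. v $ i ^ Poly_Mapping.lookup m i)"
    by (intro arg_cong2[where f = "(*)"] prod.cong) (auto simp: lookup_minus lookup_single when_def)
  finally show "of_nat (Poly_Mapping.lookup m j) * Poly_Mapping.lookup f m *
      (\<Prod>i\<in>UNIV. v $ i ^ Poly_Mapping.lookup (m - Poly_Mapping.single j 1) i) =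
    of_nat (Poly_Mapping.lookup m j) * Poly_Mapping.lookup f m *
      (v $ j ^ (Poly_Mapping.lookup m j - 1) * (\<Prod>i\<in>UNIV - {j}. v $ i ^ Poly_Mapping.lookup m i))" by simp
qed

lemma pderiv_sum': "pderiv (\<Sum>i\<in>A. f i) = (\<Sum>i\<in>A. pderiv (f i))"
  by (induction A rule: infinite_finite_induct) (simp_all add: pderiv_add)

lemma pderiv_power': "pderiv (p ^ n) = smult (of_nat n) (p ^ (n - 1) * pderiv p)"
  by (cases n) (simp_all add: pderiv_power_Suc del: power_Suc)

lemma chain_rule:
  "poly (pderiv (along C f)) s =
    (\<Sum>j\<in>UNIV. poly (pderiv (C j)) s * peval (partial_deriv j f) (\<chi> i. poly (C i) s))"
proof -
  have "poly (pderiv (along C f)) s = (\<Sum>m\<in>Poly_Mapping.keys f. \<Sum>j\<in>UNIV.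
      Poly_Mapping.lookup f m * (\<Prod>i\<in>UNIV - {j}. poly (C i) s ^ Poly_Mapping.lookup m i) *
      (of_nat (Poly_Mapping.lookup m j) * (poly (C j) s ^ (Poly_Mapping.lookup m j - 1) * poly (pderiv (C j)) s)))"
    unfolding along_def eval_in_def pderiv_sum' poly_sum
  proof (rule sum.cong[OF refl])
    fix m
    have "pderiv ([:Poly_Mapping.lookup f m:] * (\<Prod>i\<in>UNIV. C i ^ Poly_Mapping.lookup m i)) =
      [:Poly_Mapping.lookup f m:] * (\<Sum>j\<in>UNIV. (\<Prod>i\<in>UNIV - {j}. C i ^ Poly_Mapping.lookup m i) * pderiv (C j ^ Poly_Mapping.lookup m j))"
      by (simp add: pderiv_smult pderiv_prod)
    then show "poly (pderiv ([:Poly_Mapping.lookup f m:] * (\<Prod>i\<in>UNIV. C i ^ Poly_Mapping.lookup m i))) s =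
      (\<Sum>j\<in>UNIV. Poly_Mapping.lookup f m * (\<Prod>i\<in>UNIV - {j}. poly (C i) s ^ Poly_Mapping.lookup m i) *
      (of_nat (Poly_Mapping.lookup m j) * (poly (C j) s ^ (Poly_Mapping.lookup m j - 1) * poly (pderiv (C j)) s)))"
      by (simp add: pderiv_power' poly_sum poly_prod sum_distrib_left mult_ac)
  qed
  also have "\<dots> = (\<Sum>j\<in>UNIV. \<Sum>m\<in>Poly_Mapping.keys f.
      Poly_Mapping.lookup f m * (\<Prod>i\<in>UNIV - {j}. poly (C i) s ^ Poly_Mapping.lookup m i) *
      (of_nat (Poly_Mapping.lookup m j) * (poly (C j) s ^ (Poly_Mapping.lookup m j - 1) * poly (pderiv (C j)) s)))"
    by (rule sum.swap)
  also have "\<dots> = (\<Sum>j\<in>UNIV. poly (pderiv (C j)) s * peval (partial_deriv j f) (\<chi> i. poly (C i) s))"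
    unfolding peval_partial_deriv sum_distrib_left
    by (intro sum.cong refl) (simp add: mult_ac)
  finally show ?thesis .
qed

lemma exhaust_5': "(\<Sum>i\<in>(UNIV :: 5 set). g i) = g 1 + g 2 + g 3 + g 4 + g 5"
  "(\<Prod>i\<in>(UNIV :: 5 set). h i) = h 1 * h 2 * h 3 * h 4 * h 5"
  for g :: "5 \<Rightarrow> 'a::comm_monoid_add" and h :: "5 \<Rightarrow> 'b::comm_monoid_mult"
  unfolding UNIV_5 by (simp_all add: add_ac mult_ac)

section \<open>The symmetric cubic threefolds\<close>

text \<open>The general cubic form in \<open>x = x\<^sub>3\<close>, \<open>T = x\<^sub>4 + x\<^sub>5\<close>, \<open>V = x\<^sub>4 - x\<^sub>5\<close> that is invariant under \<open>V \<mapsto> -V\<close>.\<close>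

definition cubN :: "'r::comm_ring_1 \<Rightarrow> 'r \<Rightarrow> 'r \<Rightarrow> 'r \<Rightarrow> 'r \<Rightarrow> 'r \<Rightarrow> 'r \<Rightarrow> 'r \<Rightarrow> 'r \<Rightarrow> 'r"
  where "cubN c0 c1 c2 c3 c4 c5 x T V =
    c0 * x ^ 3 + c1 * x ^ 2 * T + x * (c2 * T ^ 2 + c3 * V ^ 2) + T * (c4 * T ^ 2 + c5 * V ^ 2)"

lemma all_5: "(\<forall>i::5. P i) \<longleftrightarrow> P 1 \<and> P 2 \<and> P 3 \<and> P 4 \<and> P 5"
proof -
  have "(\<forall>i\<in>(UNIV :: 5 set). P i) \<longleftrightarrow> P 1 \<and> P 2 \<and> P 3 \<and> P 4 \<and> P 5" unfolding UNIV_5 by simp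
  then show ?thesis by simp
qed

lemma vec_eq_5: "v = w \<longleftrightarrow> v $ 1 = w $ 1 \<and> v $ 2 = w $ 2 \<and> v $ 3 = w $ 3 \<and> v $ 4 = w $ 4 \<and> v $ 5 = w $ 5"
  for v w :: "'a^5"
  unfolding vec_eq_iff all_5 ..

lemma line_eq: "line v = {c *s v |c. True}"
  unfolding line_def by (auto simp: vec.span_singleton)

lemma line_self: "v \<in> line v"
  unfolding line_eq by (auto intro!: exI[of _ 1])

lemma line_eqD:
  assumes "line v = line w" "v \<noteq> 0" obtains c where "c \<noteq> 0" "v = c *s w"
proof -
  have "v \<in> line w" using line_self[of v] assms(1) by simp
  then obtain c where "v = c *s w" unfolding line_eq by blast
  then show ?thesis using assms(2) that by (cases "c = 0") auto
qed

lemma along_vanishes: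
  fixes f :: "('n::finite, 'k::field_char_0) mpoly"
  assumes "finite S" "\<And>s. s \<notin> S \<Longrightarrow> peval f (\<chi> i. poly (C i) s) = 0"
  shows "along C f = 0" "peval f (\<chi> i. poly (C i) s) = 0"
proof -
  show 0: "along C f = 0"
  proof (rule ccontr)
    assume "along C f \<noteq> 0"
    then have "finite {s. poly (along C f) s = 0}" by (rule poly_roots_finite)
    moreover have "- S \<subseteq> {s. poly (along C f) s = 0}" using assms(2) by (auto simp: poly_along)
    ultimately have "finite (- S)" by (rule rev_finite_subset)
    then show False using assms(1) infinite_UNIV_char_0[where 'a = 'k] by (metis Compl_partition finite_Un)
  qed
  show "peval f (\<chi> i. poly (C i) s) = 0" using 0 poly_along[of C f s] by simp
qed

locale symmetric_cubic =
  fixes F :: "(5, 'k::{alg_closed_field, field_char_0}) mpoly" and c0 c1 c2 c3 c4 c5 :: 'k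
  assumes F: "\<And>v. peval F v = v $ 1 * v $ 2 * v $ 3 + cubN c0 c1 c2 c3 c4 c5 (v $ 3) (v $ 4 + v $ 5) (v $ 4 - v $ 5)"
    and sing: "card (singular_locus F) = 2"
begin

abbreviation N :: "'k \<Rightarrow> 'k \<Rightarrow> 'k \<Rightarrow> 'k" where "N \<equiv> cubN c0 c1 c2 c3 c4 c5"

lemma along_F:
  "along C F = C 1 * C 2 * C 3 + cubN [:c0:] [:c1:] [:c2:] [:c3:] [:c4:] [:c5:] (C 3) (C 4 + C 5) (C 4 - C 5)"
proof -
  have "poly (along C F) s = poly (C 1 * C 2 * C 3 + cubN [:c0:] [:c1:] [:c2:] [:c3:] [:c4:] [:c5:] (C 3) (C 4 + C 5) (C 4 - C 5)) s" for s
    unfolding poly_along F by (simp add: cubN_def)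
  then show ?thesis by (simp add: poly_eq_poly_eq_iff[symmetric] fun_eq_iff)
qed

definition Nx :: "'k \<Rightarrow> 'k \<Rightarrow> 'k \<Rightarrow> 'k"
  where "Nx x T V = 3 * c0 * x ^ 2 + 2 * c1 * x * T + c2 * T ^ 2 + c3 * V ^ 2"

definition NT :: "'k \<Rightarrow> 'k \<Rightarrow> 'k \<Rightarrow> 'k"
  where "NT x T V = c1 * x ^ 2 + 2 * c2 * x * T + 3 * c4 * T ^ 2 + c5 * V ^ 2"

definition NV :: "'k \<Rightarrow> 'k \<Rightarrow> 'k \<Rightarrow> 'k"
  where "NV x T V = 2 * c3 * x * V + 2 * c5 * T * V"

lemma poly_pderiv_cubN:
  fixes X T V :: "'k poly" and s :: 'k
  shows "poly (pderiv (cubN [:c0:] [:c1:] [:c2:] [:c3:] [:c4:] [:c5:] X T V)) s =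
    Nx (poly X s) (poly T s) (poly V s) * poly (pderiv X) s +
    NT (poly X s) (poly T s) (poly V s) * poly (pderiv T) s +
    NV (poly X s) (poly T s) (poly V s) * poly (pderiv V) s"
proof -
  have p2: "poly (pderiv (p ^ 2)) s = 2 * poly p s * poly (pderiv p) s" for p :: "'k poly"
    by (simp add: power2_eq_square pderiv_mult algebra_simps)
  have p3: "poly (pderiv (p ^ 3)) s = 3 * poly p s ^ 2 * poly (pderiv p) s" for p :: "'k poly"
    by (simp add: power3_eq_cube power2_eq_square pderiv_mult algebra_simps)
  show ?thesis
    unfolding cubN_def pderiv_add pderiv_mult poly_add poly_mult p2 p3 Nx_def NT_def NV_def
    by (simp add: pderiv_pCons poly_power algebra_simps power2_eq_square power3_eq_cube)
qed

lemma partials: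
  fixes v :: "'k^5"
  shows "peval (partial_deriv 1 F) v = v $ 2 * v $ 3"
    "peval (partial_deriv 2 F) v = v $ 1 * v $ 3"
    "peval (partial_deriv 3 F) v = v $ 1 * v $ 2 + Nx (v $ 3) (v $ 4 + v $ 5) (v $ 4 - v $ 5)"
    "peval (partial_deriv 4 F) v = NT (v $ 3) (v $ 4 + v $ 5) (v $ 4 - v $ 5) + NV (v $ 3) (v $ 4 + v $ 5) (v $ 4 - v $ 5)"
    "peval (partial_deriv 5 F) v = NT (v $ 3) (v $ 4 + v $ 5) (v $ 4 - v $ 5) - NV (v $ 3) (v $ 4 + v $ 5) (v $ 4 - v $ 5)"
proof -
  have "poly (pderiv (along (\<lambda>j. [:v $ j, if j = i then 1 else 0:]) F)) 0 = peval (partial_deriv i F) v" for i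
  proof -
    let ?C = "\<lambda>j. [:v $ j, if j = i then 1 else 0:]"
    have v: "(\<chi> j. poly (?C j) 0) = v" unfolding vec_eq_iff by simp
    have "poly (pderiv (along ?C F)) 0 = (\<Sum>j\<in>UNIV. poly (pderiv (?C j)) 0 * peval (partial_deriv j F) v)"
      using chain_rule[of ?C F 0] unfolding v .
    also have "\<dots> = (\<Sum>j\<in>UNIV. if j = i then peval (partial_deriv j F) v else 0)"
      by (rule sum.cong[OF refl]) (simp add: pderiv_pCons)
    also have "\<dots> = peval (partial_deriv i F) v" by (simp only: sum.delta finite UNIV_I if_True)
    finally show ?thesis .
  qed
  note * = this[symmetric, unfolded along_F pderiv_add poly_add poly_pderiv_cubN pderiv_mult poly_mult]
  show "peval (partial_deriv 1 F) v = v $ 2 * v $ 3"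
    unfolding * by (simp add: pderiv_pCons pderiv_diff)
  show "peval (partial_deriv 2 F) v = v $ 1 * v $ 3"
    unfolding * by (simp add: pderiv_pCons pderiv_diff)
  show "peval (partial_deriv 3 F) v = v $ 1 * v $ 2 + Nx (v $ 3) (v $ 4 + v $ 5) (v $ 4 - v $ 5)"
    unfolding * by (simp add: pderiv_pCons pderiv_diff)
  show "peval (partial_deriv 4 F) v = NT (v $ 3) (v $ 4 + v $ 5) (v $ 4 - v $ 5) + NV (v $ 3) (v $ 4 + v $ 5) (v $ 4 - v $ 5)"
    unfolding * by (simp add: pderiv_pCons pderiv_diff)
  show "peval (partial_deriv 5 F) v = NT (v $ 3) (v $ 4 + v $ 5) (v $ 4 - v $ 5) - NV (v $ 3) (v $ 4 + v $ 5) (v $ 4 - v $ 5)"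
    unfolding * by (simp add: pderiv_pCons pderiv_diff)
qed

lemmas partials' = partials[unfolded Nx_def NT_def NV_def]

lemma singularI:
  assumes "v \<noteq> 0" "peval F v = 0" "peval (partial_deriv 1 F) v = 0" "peval (partial_deriv 2 F) v = 0"
    "peval (partial_deriv 3 F) v = 0" "peval (partial_deriv 4 F) v = 0" "peval (partial_deriv 5 F) v = 0"
  shows "line v \<in> singular_locus F"
  using assms unfolding singular_locus_def by (auto simp: all_5 intro!: exI[of _ v])

text \<open>The points are pairwise distinct if \<open>a \<noteq> 0\<close>, but there are only two singular points.\<close>

lemma no_singular_curve:
  assumes "\<And>s. line (vector [1, y s, 0, a * s, b * s]) \<in> singular_locus F"
  shows "a = 0"
proof (rule ccontr)
  assume a: "a \<noteq> 0"
  have inj: "inj (\<lambda>s. line (vector [1, y s, 0, a * s, b * s] :: 'k^5))"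
  proof (rule injI)
    fix s s' assume eq: "line (vector [1, y s, 0, a * s, b * s] :: 'k^5) = line (vector [1, y s', 0, a * s', b * s'])"
    have "vector [1, y s, 0, a * s, b * s] \<noteq> (0 :: 'k^5)" unfolding vec_eq_5 vector_5 by simp
    from line_eqD[OF eq this] obtain c where
      "(vector [1, y s, 0, a * s, b * s] :: 'k^5) = c *s vector [1, y s', 0, a * s', b * s']" by blast
    then show "s = s'" using a unfolding vec_eq_5 vector_smult_component vector_5 by auto
  qed
  then have "infinite (range (\<lambda>s. line (vector [1, y s, 0, a * s, b * s] :: 'k^5)))"
    using finite_imageD[OF _ inj] infinite_UNIV_char_0 by blast
  moreover have "range (\<lambda>s. line (vector [1, y s, 0, a * s, b * s] :: 'k^5)) \<subseteq> singular_locus F" using assms by blast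
  ultimately have "infinite (singular_locus F)" using finite_subset by blast
  then show False using sing by simp
qed

lemma c4_nonzero: "c4 \<noteq> 0"
proof
  assume "c4 = 0"
  then have "line (vector [1, - c2 * (2 * s) ^ 2, 0, 1 * s, 1 * s]) \<in> singular_locus F" for s
    by (intro singularI) (simp_all add: F partials' vector_5 cubN_def vec_eq_5)
  then have "(1 :: 'k) = 0" by (rule no_singular_curve)
  then show False by simp
qed

lemma c5_nonzero: "c5 \<noteq> 0"
proof
  assume "c5 = 0"
  then have "line (vector [1, - c3 * (2 * s) ^ 2, 0, 1 * s, (- 1) * s]) \<in> singular_locus F" for s
    by (intro singularI) (simp_all add: F partials' vector_5 cubN_def vec_eq_5)
  then have "(1 :: 'k) = 0" by (rule no_singular_curve)
  then show False by simp
qed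

definition q :: "'k poly" where "q = [:- c0, - c1, - c2, - c4:]"
definition l :: "'k poly" where "l = [:- c3, - c5:]"

text \<open>A double root \<open>r\<close> makes \<open>[0 : 0 : 1 : r/2 : r/2]\<close> singular by Euler's relation, in addition to
  \<open>[1 : 0 : 0 : 0 : 0]\<close> and \<open>[0 : 1 : 0 : 0 : 0]\<close>.\<close>

lemma q_simple_roots:
  assumes "poly q r = 0" shows "poly (pderiv q) r \<noteq> 0"
proof
  assume d: "poly (pderiv q) r = 0"
  let ?v = "vector [0, 0, 1, r / 2, r / 2] :: 'k^5"
  have q0: "c0 + c1 * r + c2 * r ^ 2 + c4 * r ^ 3 = 0"
    using assms by (simp add: q_def algebra_simps power2_eq_square power3_eq_cube add_eq_0_iff)
  have q1: "c1 + 2 * c2 * r + 3 * c4 * r ^ 2 = 0"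
    using d by (simp add: q_def pderiv_pCons algebra_simps power2_eq_square add_eq_0_iff)
  have q2: "3 * c0 + 2 * c1 * r + c2 * r ^ 2 = 0"
  proof -
    have "3 * c0 + 2 * c1 * r + c2 * r ^ 2 = 3 * (c0 + c1 * r + c2 * r ^ 2 + c4 * r ^ 3) - r * (c1 + 2 * c2 * r + 3 * c4 * r ^ 2)"
      by (simp add: algebra_simps power2_eq_square power3_eq_cube)
    then show ?thesis using q0 q1 by simp
  qed
  have v: "?v $ 4 + ?v $ 5 = r" "?v $ 4 - ?v $ 5 = 0" by (simp_all add: vector_5)
  have 3: "line ?v \<in> singular_locus F"
  proof (rule singularI)
    show "?v \<noteq> 0" by (simp add: vec_eq_5 vector_5)
    have "peval F ?v = c0 + c1 * r + c2 * r ^ 2 + c4 * r ^ 3"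
      unfolding F v cubN_def by (simp add: vector_5 power2_eq_square power3_eq_cube)
    then show "peval F ?v = 0" using q0 by simp
    show "peval (partial_deriv 1 F) ?v = 0" "peval (partial_deriv 2 F) ?v = 0"
      unfolding partials by (simp_all add: vector_5)
    have "peval (partial_deriv 3 F) ?v = 3 * c0 + 2 * c1 * r + c2 * r ^ 2"
      unfolding partials' v by (simp add: vector_5)
    then show "peval (partial_deriv 3 F) ?v = 0" using q2 by simp
    have "peval (partial_deriv 4 F) ?v = c1 + 2 * c2 * r + 3 * c4 * r ^ 2"
      "peval (partial_deriv 5 F) ?v = c1 + 2 * c2 * r + 3 * c4 * r ^ 2"
      unfolding partials' v by (simp_all add: vector_5)
    then show "peval (partial_deriv 4 F) ?v = 0" "peval (partial_deriv 5 F) ?v = 0" using q1 by simp_all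
  qed
  have 1: "line (vector [1, 0, 0, 0, 0] :: 'k^5) \<in> singular_locus F"
    by (intro singularI) (simp_all add: F partials' vector_5 cubN_def vec_eq_5)
  have 2: "line (vector [0, 1, 0, 0, 0] :: 'k^5) \<in> singular_locus F"
    by (intro singularI) (simp_all add: F partials' vector_5 cubN_def vec_eq_5)
  have ne: "line v \<noteq> line w" if "v \<noteq> 0" "\<And>c. v \<noteq> c *s w" for v w :: "'k^5"
    using line_eqD that by metis
  have "line (vector [1, 0, 0, 0, 0] :: 'k^5) \<noteq> line (vector [0, 1, 0, 0, 0])"
    "line (vector [1, 0, 0, 0, 0] :: 'k^5) \<noteq> line ?v" "line (vector [0, 1, 0, 0, 0] :: 'k^5) \<noteq> line ?v"
    by (rule ne; simp add: vec_eq_5 vector_5)+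
  then have "card {line (vector [1, 0, 0, 0, 0] :: 'k^5), line (vector [0, 1, 0, 0, 0]), line ?v} = 3" by simp
  moreover have "finite (singular_locus F)" using sing by (intro card_ge_0_finite) simp
  ultimately have "3 \<le> card (singular_locus F)"
    using card_mono[of "singular_locus F" "{line (vector [1, 0, 0, 0, 0]), line (vector [0, 1, 0, 0, 0]), line ?v}"] 1 2 3 by simp
  then show False using sing by simp
qed

lemma q_factorization:
  obtains r1 r2 r3 where "r1 \<noteq> r2" "r1 \<noteq> r3" "r2 \<noteq> r3"
    "q = smult (- c4) ([:- r1, 1:] * ([:- r2, 1:] * [:- r3, 1:]))"
proof -
  have deg: "degree q = 3" and lc: "lead_coeff q = - c4" and q0: "q \<noteq> 0" using c4_nonzero by (auto simp: q_def)
  obtain A where A: "size A = 3" "q = smult (- c4) (\<Prod>x\<in>#A. [:- x, 1:])"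
    using alg_closed_imp_factorization[OF q0] deg lc by metis
  obtain r1 A1 where A1: "A = add_mset r1 A1" "size A1 = 2"
    using A(1) size_eq_Suc_imp_eq_union[of A 2] by auto
  obtain r2 A2 where A2: "A1 = add_mset r2 A2" "size A2 = 1"
    using A1(2) size_eq_Suc_imp_eq_union[of A1 1] by auto
  obtain r3 where "A2 = {#r3#}" using A2(2) size_1_singleton_mset by blast
  with A1 A2 have A3: "A = {#r1, r2, r3#}" by simp
  have qf: "q = smult (- c4) ([:- r1, 1:] * ([:- r2, 1:] * [:- r3, 1:]))" using A(2) unfolding A3 by simp
  have dist: "a \<noteq> b" if "q = smult (- c4) ([:- a, 1:] * ([:- b, 1:] * h))" for a b h
  proof
    assume "a = b"
    then have "poly q a = 0" "poly (pderiv q) a = 0"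
      using that by (simp_all add: pderiv_smult pderiv_minus pderiv_mult pderiv_pCons del: mult_pCons_left)
    then show False using q_simple_roots by blast
  qed
  have "r1 \<noteq> r2" by (rule dist[OF qf])
  moreover have "r1 \<noteq> r3" by (rule dist[of r1 r3 "[:- r2, 1:]"]) (simp only: qf mult_ac)
  moreover have "r2 \<noteq> r3" by (rule dist[of r2 r3 "[:- r1, 1:]"]) (simp only: qf mult_ac)
  ultimately show ?thesis using that qf by blast
qed

end

section \<open>The dimension of the linear model\<close>

lemma nontrivial_kernel:
  fixes A :: "'k::field^'m^'n"
  assumes "CARD('n) < CARD('m)"
  obtains w where "w \<noteq> 0" "A *v w = 0"
proof -
  have "\<exists>w. w \<noteq> 0 \<and> A *v w = 0"
  proof (rule ccontr)
    assume no: "\<not> ?thesis"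
    have "inj ((*v) A)"
    proof (rule injI)
      fix x y assume "A *v x = A *v y"
      then have "A *v (x - y) = 0" by (simp add: matrix_vector_mult_diff_distrib)
      then have "x - y = 0" using no by blast
      then show "x = y" by simp
    qed
    then have "vec.dim (range ((*v) A)) = vec.dim (UNIV :: ('k^'m) set)"
      by (intro vec.dim_image_eq) (auto intro: inj_on_subset)
    also have "\<dots> = CARD('m)" by (rule vec_dim_card)
    finally show False using dim_subset_UNIV_cart_gen[of "range ((*v) A)"] assms by simp
  qed
  then show ?thesis using that by blast
qed

lemma euler:
  fixes f :: "('n::finite, 'k::field_char_0) mpoly"
  assumes "homogeneous d f"
  shows "(\<Sum>j\<in>UNIV. v $ j * peval (partial_deriv j f) v) = of_nat d * peval f v"
proof -
  let ?C = "\<lambda>j. [:v $ j, v $ j:]"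
  have v: "(\<chi> j. poly (?C j) 0) = v" unfolding vec_eq_iff by simp
  have "poly (pderiv (along ?C f)) 0 = (\<Sum>j\<in>UNIV. poly (pderiv (?C j)) 0 * peval (partial_deriv j f) v)"
    using chain_rule[of ?C f 0] unfolding v .
  also have "\<dots> = (\<Sum>j\<in>UNIV. v $ j * peval (partial_deriv j f) v)"
    by (rule sum.cong) (simp_all add: pderiv_pCons)
  finally have 1: "poly (pderiv (along ?C f)) 0 = (\<Sum>j\<in>UNIV. v $ j * peval (partial_deriv j f) v)" .
  have "poly (along ?C f) s = poly (smult (peval f v) ([:1, 1:] ^ d)) s" for s
  proof -
    have "(\<chi> j. poly (?C j) s) = (1 + s) *s v" by (simp add: vec_eq_iff algebra_simps)
    then show ?thesis unfolding poly_along using peval_scale[OF assms, of "1 + s" v] by (simp add: poly_power mult.commute)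
  qed
  then have "along ?C f = smult (peval f v) ([:1, 1:] ^ d)" by (simp add: poly_eq_poly_eq_iff[symmetric] fun_eq_iff)
  then have "poly (pderiv (along ?C f)) 0 = of_nat d * peval f v"
    by (simp add: pderiv_smult pderiv_power' pderiv_pCons poly_power mult.commute)
  with 1 show ?thesis by simp
qed

lemma partial_deriv_degree_0:
  assumes "homogeneous 0 f" shows "peval (partial_deriv j f) v = 0"
  unfolding peval_partial_deriv using assms by (intro sum.neutral) (auto simp: homogeneous_def)

lemma poly_eq_0_if_cofinite:
  fixes p :: "'k::field_char_0 poly"
  assumes "finite S" "\<And>s. s \<notin> S \<Longrightarrow> poly p s = 0" shows "p = 0"
proof (rule ccontr)
  assume "p \<noteq> 0"
  then have "finite {s. poly p s = 0}" by (rule poly_roots_finite)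
  moreover have "- S \<subseteq> {s. poly p s = 0}" using assms(2) by auto
  ultimately have "finite (- S)" by (rule rev_finite_subset)
  then show False using assms(1) infinite_UNIV_char_0[where 'a = 'k] by (metis Compl_partition finite_Un)
qed

context symmetric_cubic
begin

text \<open>Let \<open>g\<close> and \<open>h\<close> represent mutually inverse maps between \<open>X\<close> and the projective space. The affine cone
  over \<open>X\<close> is smooth of dimension 4 at \<open>h(w0)\<close>, with tangent directions determined by the
  coordinates 1, 3, 4, 5. If the projective space had dimension above 3, then the derivative of \<open>h\<close> at \<open>w0\<close>
  would vanish in some direction \<open>w\<close>. Then \<open>g(h(w0 + \<epsilon> w))\<close> is constant up to order \<open>\<epsilon>\<^sup>2\<close> and
  proportional to \<open>w0 + \<epsilon> w\<close>, so \<open>w\<close> is a multiple of \<open>w0\<close>. Euler's relation leaves only the case that \<open>h\<close>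
  is constant, in which every direction \<open>w\<close> would be a multiple of \<open>w0\<close>.\<close>

lemma dimension_bound:
  fixes g :: "'m::finite \<Rightarrow> (5, 'k) mpoly" and h :: "5 \<Rightarrow> ('m, 'k) mpoly" and f1 :: "('m, 'k) mpoly"
    and v0 :: "'k^5"
  defines "w0 \<equiv> peval_map g v0"
  assumes g: "\<And>i. homogeneous d (g i)" and h: "\<And>n. homogeneous e (h n)"
    and v0: "v0 $ 1 \<noteq> 0" "v0 $ 3 \<noteq> 0" and w0: "w0 \<noteq> 0"
    and inv: "peval_map h w0 = \<mu> *s v0" "\<mu> \<noteq> 0" and f1: "peval f1 w0 \<noteq> 0"
    and near: "\<And>w. w \<noteq> 0 \<Longrightarrow> peval f1 w \<noteq> 0 \<Longrightarrow> peval_map h w \<noteq> 0 \<Longrightarrow>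
      peval F (peval_map h w) = 0 \<and>
      (\<forall>i j. peval (g i) (peval_map h w) * w $ j = peval (g j) (peval_map h w) * w $ i)"
  shows "CARD('m) \<le> 4"
proof (rule ccontr)
  assume big: "\<not> ?thesis"
  obtain k where k: "w0 $ k \<noteq> 0" using w0 by (auto simp: vec_eq_iff)
  \<comment> \<open>\<open>D w\<close> is the derivative of \<open>h\<close> at \<open>w0\<close> in direction \<open>w\<close>.\<close>
  define D where "D w n = (\<Sum>j\<in>UNIV. w $ j * peval (partial_deriv j (h n)) w0)" for w :: "'k^'m" and n
  have par: "w0 $ i * w $ j = w0 $ j * w $ i"
    if ker: "D w 1 = 0" "D w 3 = 0" "D w 4 = 0" "D w 5 = 0" for w i j
  proof -
    define C where "C i = [:w0 $ i, w $ i:]" for i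
    have C0: "(\<chi> i. poly (C i) 0) = w0" by (simp add: C_def vec_eq_iff)
    define x where "x n = along C (h n)" for n
    have x: "(\<chi> n. poly (x n) s) = peval_map h (\<chi> i. poly (C i) s)" for s
      by (simp add: x_def poly_along peval_map_def)
    have x0: "(\<chi> n. poly (x n) 0) = \<mu> *s v0" unfolding x C0 by (rule inv(1))
    have dx: "poly (pderiv (x n)) 0 = D w n" for n
      unfolding x_def chain_rule C0 D_def by (simp add: C_def pderiv_pCons)
    define p where "p = along C f1 * (x 3 * C k)"
    have p0: "poly p 0 \<noteq> 0"
    proof -
      have "poly (x 3) 0 = \<mu> * v0 $ 3" using arg_cong[OF x0, of "\<lambda>v. v $ 3"] by simp
      moreover have "poly (C k) 0 = w0 $ k" by (simp add: C_def)
      moreover have "poly (along C f1) 0 = peval f1 w0" unfolding poly_along C0 ..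
      ultimately show ?thesis using f1 inv(2) v0(2) k by (simp add: p_def)
    qed
    define S where "S = {s. poly p s = 0}"
    have "p \<noteq> 0" using p0 by auto
    then have S: "finite S" unfolding S_def by (rule poly_roots_finite)
    have near': "peval F (\<chi> n. poly (x n) s) = 0"
      "peval (g i) (\<chi> n. poly (x n) s) * poly (C j) s = peval (g j) (\<chi> n. poly (x n) s) * poly (C i) s"
      if s: "s \<notin> S" for s i j
    proof -
      let ?w = "\<chi> i. poly (C i) s"
      have nz: "poly (along C f1) s \<noteq> 0" "poly (x 3) s \<noteq> 0" "poly (C k) s \<noteq> 0"
        using s by (auto simp: S_def p_def)
      have "?w \<noteq> 0" using nz(3) by (auto simp: vec_eq_iff)
      moreover have "peval f1 ?w \<noteq> 0" using nz(1) unfolding poly_along .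
      moreover have "peval_map h ?w \<noteq> 0"
      proof
        assume "peval_map h ?w = 0"
        then have "(\<chi> n. poly (x n) s) $ 3 = 0" unfolding x by simp
        then show False using nz(2) by simp
      qed
      ultimately have "peval F (peval_map h ?w) = 0 \<and>
        (\<forall>i j. peval (g i) (peval_map h ?w) * ?w $ j = peval (g j) (peval_map h ?w) * ?w $ i)"
        by (rule near)
      then show "peval F (\<chi> n. poly (x n) s) = 0"
        "peval (g i) (\<chi> n. poly (x n) s) * poly (C j) s = peval (g j) (\<chi> n. poly (x n) s) * poly (C i) s"
        unfolding x by auto
    qed
    have "along x F = 0" by (rule along_vanishes(1)[OF S near'(1)])
    then have "poly (pderiv (along x F)) 0 = 0" by simp
    then have "D w 2 * (\<mu> * v0 $ 1 * (\<mu> * v0 $ 3)) = 0"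
      unfolding chain_rule x0 exhaust_5' dx partials(2) by (simp add: ker)
    then have "D w 2 = 0" using inv(2) v0 by simp
    then have "D w n = 0" for n using ker all_5[of "\<lambda>n. D w n = 0"] by blast
    then have dG: "poly (pderiv (along x (g i))) 0 = 0" for i
      unfolding chain_rule dx by simp
    have "poly (along x (g i) * C j) s = poly (along x (g j) * C i) s" if "s \<notin> S" for s i j
      using near'(2)[OF that] by (simp add: poly_along)
    then have "along x (g i) * C j - along x (g j) * C i = 0" for i j
      using S by (intro poly_eq_0_if_cofinite[of S]) auto
    then have "along x (g i) * C j = along x (g j) * C i" by simp
    then have "poly (pderiv (along x (g i) * C j)) 0 = poly (pderiv (along x (g j) * C i)) 0" by simp
    then have "poly (along x (g i)) 0 * w $ j = poly (along x (g j)) 0 * w $ i"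
      unfolding pderiv_mult poly_add poly_mult dG by (simp add: C_def pderiv_pCons)
    moreover have "poly (along x (g i)) 0 = \<mu> ^ d * w0 $ i" for i
      unfolding poly_along x0 peval_scale[OF g] by (simp add: w0_def peval_map_def)
    ultimately show ?thesis using inv(2) by simp
  qed
  define A :: "'k^'m^4" where "A = (\<chi> n. \<chi> j. peval (partial_deriv j (h (if n = 1 then 1 else if n = 2 then 3 else if n = 3 then 4 else 5))) w0)"
  obtain w where w: "w \<noteq> 0" "A *v w = 0" using nontrivial_kernel[of A] big by auto
  have comp: "(A *v w) $ n = D w (if n = 1 then 1 else if n = 2 then 3 else if n = 3 then 4 else 5)" for n
    by (simp add: A_def matrix_vector_mult_def D_def mult.commute)
  have "D w 1 = 0" "D w 3 = 0" "D w 4 = 0" "D w 5 = 0"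
    using comp[of 1] comp[of 2] comp[of 3] comp[of 4] w(2) by simp_all
  then have par_w: "w0 $ i * w $ j = w0 $ j * w $ i" for i j by (rule par)
  have "w $ k \<noteq> 0"
  proof
    assume "w $ k = 0"
    then have "w $ j = 0" for j using par_w[of k j] k by simp
    then show False using w(1) by (simp add: vec_eq_iff)
  qed
  have w0w: "w0 $ j = w0 $ k / w $ k * w $ j" for j
    using par_w[of k j] \<open>w $ k \<noteq> 0\<close> by (simp add: field_simps)
  have "of_nat e * peval (h 3) w0 = D w0 3" unfolding D_def by (rule euler[OF h, symmetric])
  also have "\<dots> = w0 $ k / w $ k * D w 3"
    unfolding D_def sum_distrib_left by (intro sum.cong refl) (subst w0w, simp)
  also have "\<dots> = 0" using \<open>D w 3 = 0\<close> by simp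
  finally have "of_nat e * peval (h 3) w0 = 0" .
  moreover have "peval (h 3) w0 = \<mu> * v0 $ 3"
    using arg_cong[OF inv(1), of "\<lambda>v. v $ 3"] by (simp add: peval_map_def)
  ultimately have "e = 0" using inv(2) v0(2) by simp
  then have "D w n = 0" for w n
    unfolding D_def using partial_deriv_degree_0 h by (metis (no_types, lifting) mult_zero_right sum.neutral)
  then have par_all: "w0 $ i * w $ j = w0 $ j * w $ i" for w i j using par by blast
  have "UNIV \<noteq> {k}"
  proof
    assume "UNIV = {k}"
    then have "CARD('m) = card {k}" by simp
    then show False using big by simp
  qed
  then obtain j where "j \<noteq> k" by blast
  then show False using par_all[of k "axis j 1" j] k by (simp add: axis_def)
qed

end

context symmetric_cubic
begin

section \<open>Generic points\<close>

definition gGam :: "('k \<Rightarrow> 'r::comm_ring_1) \<Rightarrow> 'r \<Rightarrow> 'r \<Rightarrow> 'r"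
  where "gGam c T V = poly_via c T q + V ^ 2 * poly_via c T l"

text \<open>The point with \<open>x\<^sub>1/x\<^sub>3 = A\<close>, \<open>(x\<^sub>4 + x\<^sub>5)/x\<^sub>3 = T\<close>, \<open>(x\<^sub>4 - x\<^sub>5)/x\<^sub>3 = V\<close>, scaled such that its coordinates
  are polynomials in \<open>T\<close>, \<open>V\<close>, \<open>A\<close>.\<close>

definition gpt :: "('k \<Rightarrow> 'r::comm_ring_1) \<Rightarrow> 'r \<Rightarrow> 'r \<Rightarrow> 'r \<Rightarrow> 'r^5"
  where "gpt c T V A = vector [2 * A ^ 2, 2 * gGam c T V, 2 * A, A * (T + V), A * (T - V)]"

abbreviation Gam :: "'k \<Rightarrow> 'k \<Rightarrow> 'k" where "Gam \<equiv> gGam (\<lambda>x. x)"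
abbreviation pt :: "'k \<Rightarrow> 'k \<Rightarrow> 'k \<Rightarrow> 'k^5" where "pt \<equiv> gpt (\<lambda>x. x)"

lemma gpt_nth:
  "gpt c T V A $ 1 = 2 * A ^ 2" "gpt c T V A $ 2 = 2 * gGam c T V" "gpt c T V A $ 3 = 2 * A"
  "gpt c T V A $ 4 = A * (T + V)" "gpt c T V A $ 5 = A * (T - V)"
  by (simp_all add: gpt_def vector_5)

lemma N_Gam: "N (2 * A) (2 * A * T) (2 * A * V) = - 8 * A ^ 3 * Gam T V"
  by (simp add: cubN_def gGam_def q_def l_def poly_via_id algebra_simps power2_eq_square power3_eq_cube)

lemma pt_on: "peval F (pt T V A) = 0"
proof -
  have "A * (T + V) + A * (T - V) = 2 * A * T" "A * (T + V) - A * (T - V) = 2 * A * V" by (simp_all add: algebra_simps)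
  then show ?thesis unfolding F gpt_nth by (simp only: N_Gam) (simp add: power2_eq_square power3_eq_cube)
qed

lemma pt_cover:
  assumes v: "peval F v = 0" "v $ 1 \<noteq> 0" "v $ 3 \<noteq> 0"
  obtains T V A c where "A \<noteq> 0" "c \<noteq> 0" "v = c *s pt T V A"
proof -
  define A T V where "A = v $ 1 / v $ 3" and "T = (v $ 4 + v $ 5) / v $ 3" and "V = (v $ 4 - v $ 5) / v $ 3"
  define c where "c = v $ 3 / (2 * A)"
  have A: "A \<noteq> 0" "c \<noteq> 0" using v by (auto simp: A_def c_def)
  have c: "c * (2 * A) = v $ 3" using A by (simp add: c_def)
  have "v $ 3 * A = v $ 1" "v $ 3 * T = v $ 4 + v $ 5" "v $ 3 * V = v $ 4 - v $ 5" using v by (simp_all add: A_def T_def V_def)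
  note e = this
  have e1: "c * (2 * A ^ 2) = v $ 1" using c e(1) by (simp add: power2_eq_square algebra_simps)
  have "2 * (c * (A * (T + V))) = c * (2 * A) * T + c * (2 * A) * V"
    "2 * (c * (A * (T - V))) = c * (2 * A) * T - c * (2 * A) * V" by (simp_all add: algebra_simps)
  then have "2 * (c * (A * (T + V))) = 2 * v $ 4" "2 * (c * (A * (T - V))) = 2 * v $ 5"
    unfolding c e by simp_all
  then have e45: "c * (A * (T + V)) = v $ 4" "c * (A * (T - V)) = v $ 5" by simp_all
  have eT: "c * (2 * A * T) = v $ 4 + v $ 5" and eV: "c * (2 * A * V) = v $ 4 - v $ 5"
    unfolding mult.assoc[symmetric] e(2,3)[symmetric] c[symmetric] by simp_all
  have e2: "c * (2 * Gam T V) = v $ 2"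
  proof -
    have "N (c * (2 * A)) (c * (2 * A * T)) (c * (2 * A * V)) = c ^ 3 * N (2 * A) (2 * A * T) (2 * A * V)"
      by (simp add: cubN_def algebra_simps power2_eq_square power3_eq_cube)
    also have "\<dots> = - (c * (2 * A ^ 2)) * (c * (2 * A)) * (c * (2 * Gam T V))"
      unfolding N_Gam by (simp add: algebra_simps power2_eq_square power3_eq_cube)
    finally have "N (v $ 3) (v $ 4 + v $ 5) (v $ 4 - v $ 5) = - v $ 1 * v $ 3 * (c * (2 * Gam T V))"
      unfolding e1 c eT eV .
    then have "v $ 1 * v $ 3 * (v $ 2 - c * (2 * Gam T V)) = 0"
      using v(1) unfolding F by (simp add: algebra_simps)
    then show ?thesis using v by simp
  qed
  have "v = c *s pt T V A" unfolding vec_eq_5 by (simp add: gpt_nth e1 e2 e45 c)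
  then show ?thesis using that A by blast
qed

lemma curve_limit:
  assumes "finite S" and "\<And>s. s \<notin> S \<Longrightarrow> peval f (\<chi> i. poly (vector [C1, C2, C3, C4, C5] $ i) s) = 0"
  shows "peval f (vector [poly C1 0, poly C2 0, poly C3 0, poly C4 0, poly C5 0] :: 'k^5) = 0"
proof -
  have "peval f (\<chi> i. poly (vector [C1, C2, C3, C4, C5] $ i) 0) = 0"
    by (rule along_vanishes(2)[OF assms])
  moreover have "(\<chi> i. poly (vector [C1, C2, C3, C4, C5] $ i) 0) =
      (vector [poly C1 0, poly C2 0, poly C3 0, poly C4 0, poly C5 0] :: 'k^5)"
    by (simp add: vec_eq_5 vector_5)
  ultimately show ?thesis by simp
qed

end

context symmetric_cubic
begin
text \<open>The points with nonzero \<open>x\<^sub>1\<close> and \<open>x\<^sub>3\<close> are dense in \<open>X\<close>: each of the other points is a limit of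
  them along a polynomial curve. The delicate points are those in the planes that make up the
  section \<open>x\<^sub>3 = 0\<close>; they can be left in the direction of \<open>T\<close>, because these planes are distinct and so
  the derivative in this direction does not vanish.\<close>

lemma density:
  assumes f: "homogeneous d f" and van: "\<And>T V A. A \<noteq> 0 \<Longrightarrow> peval f (pt T V A) = 0"
    and v: "peval F v = 0"
  shows "peval f v = 0"
proof -
  have gen: "peval f x = 0" if "peval F x = 0" "x $ 1 \<noteq> 0" "x $ 3 \<noteq> 0" for x
  proof -
    from pt_cover[OF that] obtain T V A c where "A \<noteq> 0" "c \<noteq> 0" "x = c *s pt T V A" .
    then show ?thesis using peval_scale[OF f] van by simp
  qed
  have vv: "u = vector [u $ 1, u $ 2, u $ 3, u $ 4, u $ 5]" for u :: "'k^5" by (simp add: vec_eq_5 vector_5)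
  have third: "peval f x = 0" if x: "peval F x = 0" "x $ 3 \<noteq> 0" "x $ 1 = 0" for x
  proof (cases "x $ 2 = 0")
    case True
    have "peval f (vector [poly [:0, 1:] 0, poly [:0:] 0, poly [:x $ 3:] 0, poly [:x $ 4:] 0, poly [:x $ 5:] 0]) = 0"
    proof (rule curve_limit)
      fix s :: 'k assume "s \<notin> {0}"
      then show "peval f (\<chi> i. poly (vector [[:0, 1:], [:0:], [:x $ 3:], [:x $ 4:], [:x $ 5:]] $ i) s) = 0"
        using x True by (intro gen) (simp_all add: F vector_5)
    qed simp
    then show ?thesis using x True by (subst vv) simp
  next
    case False
    define T V where "T = x $ 4 + x $ 5" and "V = x $ 4 - x $ 5"
    define P where "P = cubN [:c0:] [:c1:] [:c2:] [:c3:] [:c4:] [:c5:] [:x $ 3:] [:T, 1:] [:V:]"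
    have P: "poly P s = N (x $ 3) (s + T) V" for s by (simp add: P_def cubN_def algebra_simps)
    have P0: "P \<noteq> 0"
    proof -
      have "coeff P 3 = c4" by (simp add: P_def cubN_def power3_eq_cube power2_eq_square numeral_3_eq_3)
      then show ?thesis using c4_nonzero by auto
    qed
    define a where "a = - 1 / (x $ 2 * x $ 3)"
    have a1: "a * (x $ 2 * x $ 3) = - 1" using x(2) False by (simp add: a_def)
    then have a0: "a \<noteq> 0" by auto
    have "a * n * x $ 2 * x $ 3 = a * (x $ 2 * x $ 3) * n" for n by (simp only: mult_ac)
    then have a: "a * n * x $ 2 * x $ 3 = - n" for n unfolding a1 by simp
    have "peval f (vector [poly (smult a P) 0, poly [:x $ 2:] 0, poly [:x $ 3:] 0, poly [:x $ 4, 1/2:] 0, poly [:x $ 5, 1/2:] 0]) = 0"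
    proof (rule curve_limit)
      show "finite {s. poly P s = 0}" by (rule poly_roots_finite[OF P0])
      fix s :: 'k assume s: "s \<notin> {s. poly P s = 0}"
      let ?u = "(\<chi> i. poly (vector [smult a P, [:x $ 2:], [:x $ 3:], [:x $ 4, 1/2:], [:x $ 5, 1/2:]] $ i) s) :: 'k^5"
      have u: "?u $ 1 = a * N (x $ 3) (s + T) V" "?u $ 2 = x $ 2" "?u $ 3 = x $ 3"
        by (simp_all add: vector_5 P)
      have u45: "?u $ 4 + ?u $ 5 = s + T" "?u $ 4 - ?u $ 5 = V" by (simp_all add: vector_5 T_def V_def)
      show "peval f ?u = 0"
      proof (rule gen)
        show "peval F ?u = 0" unfolding F u45 unfolding u a by simp
        show "?u $ 1 \<noteq> 0" unfolding u(1) using s a0 by (simp add: P)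
        show "?u $ 3 \<noteq> 0" unfolding u(3) by (rule x(2))
      qed
    qed
    moreover have "poly P 0 = 0" using x unfolding P F by (simp add: T_def V_def)
    ultimately show ?thesis using x by (subst vv) simp
  qed
  have plane: "peval f x = 0" if x: "peval F x = 0" "x $ 3 = 0" "x $ 1 \<noteq> 0" "x $ 4 \<noteq> 0 \<or> x $ 5 \<noteq> 0" for x
  proof -
    define T V where "T = x $ 4 + x $ 5" and "V = x $ 4 - x $ 5"
    have TV: "T * (c4 * T ^ 2 + c5 * V ^ 2) = 0" using x unfolding F by (simp add: cubN_def T_def V_def)
    have TV0: "T \<noteq> 0 \<or> V \<noteq> 0"
    proof (rule ccontr)
      assume "\<not> ?thesis"
      moreover have "2 * x $ 4 = T + V" "2 * x $ 5 = T - V" by (simp_all add: T_def V_def)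
      ultimately have "2 * x $ 4 = 0" "2 * x $ 5 = 0" by simp_all
      then show False using x(4) by simp
    qed
    \<comment> \<open>the derivative of \<open>N\<close> in the direction of \<open>T\<close>, along which the point is moved off the plane\<close>
    define D where "D = 3 * c4 * T ^ 2 + c5 * V ^ 2"
    have D: "D \<noteq> 0"
    proof (cases "T = 0")
      case True
      then have "V ^ 2 \<noteq> 0" using TV0 by simp
      moreover have "D = c5 * V ^ 2" unfolding D_def True by simp
      ultimately show ?thesis using c5_nonzero by (metis mult_eq_0_iff)
    next
      case False
      have "c4 * T ^ 2 + c5 * V ^ 2 = 0" using TV False by (metis mult_eq_0_iff)
      moreover have "(3::'k) = 2 + 1" by simp
      then have "D = 2 * (c4 * T ^ 2) + (c4 * T ^ 2 + c5 * V ^ 2)"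
        unfolding D_def by (simp only: distrib_right mult_1 add.assoc mult.assoc)
      ultimately have "D = 2 * (c4 * T ^ 2)" by (metis add.right_neutral)
      moreover have "c4 * T ^ 2 \<noteq> 0" using False c4_nonzero by (metis mult_eq_0_iff power_eq_0_iff)
      ultimately show ?thesis by (metis mult_eq_0_iff zero_neq_numeral)
    qed
    define m where "m = - (x $ 1 * x $ 2 + c2 * T ^ 2 + c3 * V ^ 2) / D"
    have mD: "m * D = - (x $ 1 * x $ 2 + c2 * T ^ 2 + c3 * V ^ 2)" using D by (simp add: m_def)
    define M where "M = [:c0:] * [:0, 1:] ^ 2 + [:c1:] * [:0, 1:] * [:T, m:] + [:c2:] * [:T, m:] ^ 2 + [:c3 * V ^ 2:] +
      [:m:] * ([:c4:] * ([:T, m:] ^ 2 + [:T, m:] * [:T:] + [:T ^ 2:]) + [:c5 * V ^ 2:])"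
    have polyM: "poly M s = c0 * s ^ 2 + c1 * s * (T + s * m) + c2 * (T + s * m) ^ 2 + c3 * V ^ 2 +
      m * (c4 * ((T + s * m) ^ 2 + (T + s * m) * T + T ^ 2) + c5 * V ^ 2)" for s
      unfolding M_def poly_add poly_mult poly_power by simp
    have M: "N s (T + m * s) V = s * poly M s" for s
    proof -
      have split: "u * (c4 * u ^ 2 + c5 * V ^ 2) =
          (u - T) * (c4 * (u ^ 2 + u * T + T ^ 2) + c5 * V ^ 2) + T * (c4 * T ^ 2 + c5 * V ^ 2)" for u
        by (simp add: algebra_simps power2_eq_square)
      define u where "u = T + s * m"
      have "N s u V = s * (c0 * s ^ 2 + c1 * s * u + c2 * u ^ 2 + c3 * V ^ 2) + u * (c4 * u ^ 2 + c5 * V ^ 2)"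
        unfolding cubN_def by (simp add: algebra_simps power2_eq_square power3_eq_cube)
      also have "\<dots> = s * (c0 * s ^ 2 + c1 * s * u + c2 * u ^ 2 + c3 * V ^ 2) +
          (u - T) * (c4 * (u ^ 2 + u * T + T ^ 2) + c5 * V ^ 2)"
        using split[of u] unfolding TV by simp
      also have "u - T = s * m" by (simp add: u_def)
      finally have "N s u V = s * poly M s" unfolding polyM u_def[symmetric] by (simp only: distrib_left mult.assoc)
      then show ?thesis by (simp add: u_def mult.commute)
    qed
    have M0: "poly M 0 = - (x $ 1 * x $ 2)"
    proof -
      have "poly M 0 = c2 * T ^ 2 + c3 * V ^ 2 + m * D"
        unfolding polyM D_def by (simp add: power2_eq_square algebra_simps)
      then show ?thesis unfolding mD by simp
    qed
    define a where "a = - inverse (x $ 1)"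
    have "peval f (vector [poly [:x $ 1:] 0, poly (smult a M) 0, poly [:0, 1:] 0, poly [:x $ 4, m/2:] 0, poly [:x $ 5, m/2:] 0]) = 0"
    proof (rule curve_limit)
      fix s :: 'k assume s: "s \<notin> {0}"
      let ?u = "(\<chi> i. poly (vector [[:x $ 1:], smult a M, [:0, 1:], [:x $ 4, m/2:], [:x $ 5, m/2:]] $ i) s) :: 'k^5"
      have u: "?u $ 1 = x $ 1" "?u $ 2 = a * poly M s" "?u $ 3 = s" by (simp_all add: vector_5)
      have u': "?u $ 4 = x $ 4 + s * (m/2)" "?u $ 5 = x $ 5 + s * (m/2)" by (simp_all add: vector_5)
      have "s * (m/2) + s * (m/2) = m * s" by (simp flip: distrib_left add: mult.commute)
      then have u45: "?u $ 4 + ?u $ 5 = T + m * s" "?u $ 4 - ?u $ 5 = V" unfolding u' T_def V_def by simp_all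
      have "x $ 1 * a = - 1" using x(3) by (simp add: a_def)
      moreover have "x $ 1 * (a * poly M s) * s = x $ 1 * a * (s * poly M s)" by (simp only: mult_ac)
      ultimately have a1: "x $ 1 * (a * poly M s) * s = - (s * poly M s)" by simp
      show "peval f ?u = 0"
      proof (rule gen)
        show "peval F ?u = 0" unfolding F u45 unfolding u M a1 by simp
        show "?u $ 1 \<noteq> 0" unfolding u(1) by (rule x(3))
        show "?u $ 3 \<noteq> 0" unfolding u(3) using s by simp
      qed
    qed simp
    moreover have "poly (smult a M) 0 = x $ 2" using x(3) by (simp add: M0 a_def)
    ultimately show ?thesis using x(2) by (subst vv) simp
  qed
  have plane': "peval f x = 0" if x: "peval F x = 0" "x $ 3 = 0" "x $ 1 \<noteq> 0" for x
  proof (cases "x $ 4 \<noteq> 0 \<or> x $ 5 \<noteq> 0")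
    case False
    have "peval f (vector [poly [:x $ 1:] 0, poly [:x $ 2:] 0, poly [:0:] 0, poly [:0, 1:] 0, poly [:0, -1:] 0]) = 0"
    proof (rule curve_limit)
      fix s :: 'k assume s: "s \<notin> {0}"
      then show "peval f (\<chi> i. poly (vector [[:x $ 1:], [:x $ 2:], [:0:], [:0, 1:], [:0, -1:]] $ i) s) = 0"
        using x by (intro plane) (simp_all add: F vector_5 cubN_def)
    qed simp
    then show ?thesis using x False by (subst vv) simp
  qed (rule plane[OF x])
  show ?thesis
  proof (cases "v $ 3 = 0")
    case False
    then show ?thesis using gen third v by blast
  next
    case v3: True
    show ?thesis
    proof (cases "v $ 1 = 0")
      case True
      have "peval f (vector [poly [:0, 1:] 0, poly [:v $ 2:] 0, poly [:0:] 0, poly [:v $ 4:] 0, poly [:v $ 5:] 0]) = 0"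
      proof (rule curve_limit)
        fix s :: 'k assume s: "s \<notin> {0}"
        then show "peval f (\<chi> i. poly (vector [[:0, 1:], [:v $ 2:], [:0:], [:v $ 4:], [:v $ 5:]] $ i) s) = 0"
          using v v3 by (intro plane') (simp_all add: F vector_5)
      qed simp
      then show ?thesis using v3 True by (subst vv) simp
    qed (use plane' v v3 in blast)
  qed
qed

end

definition const3 :: "'k::comm_ring_1 \<Rightarrow> 'k poly poly poly" where "const3 c = [:[:[:c:]:]:]"

definition eval3 :: "('k::comm_ring_1 \<Rightarrow> 's::comm_ring_1) \<Rightarrow> 's \<Rightarrow> 's \<Rightarrow> 's \<Rightarrow> 'k poly poly poly \<Rightarrow> 's"
  where "eval3 c t v a p = poly_via (poly_via (poly_via c t) v) a p"

lemma ring_morphism_const3: "ring_morphism const3"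
  by (simp add: ring_morphism_def const3_def one_pCons)

lemma eval3_props:
  assumes "ring_morphism c"
  shows "ring_morphism (eval3 c t v a)" "eval3 c t v a (const3 x) = c x"
    "eval3 c t v a [:[:[:0, 1:]:]:] = t" "eval3 c t v a [:[:0, 1:]:] = v" "eval3 c t v a [:0, 1:] = a"
proof -
  note m1 = ring_morphism_poly_via[OF assms, of t]
  note m2 = ring_morphism_poly_via[OF m1, of v]
  note m3 = ring_morphism_poly_via[OF m2, of a]
  show "ring_morphism (eval3 c t v a)" using m3 by (simp add: eval3_def[abs_def])
  note [simp] = poly_via_pCons[OF assms] poly_via_pCons[OF m1] poly_via_pCons[OF m2]
    ring_morphismD[OF assms] ring_morphismD[OF m1] ring_morphismD[OF m2]
  show "eval3 c t v a (const3 x) = c x" by (simp add: eval3_def const3_def)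
  have "poly_via c t 1 = 1" "poly_via (poly_via c t) v 1 = 1" using ring_morphismD(1)[OF m1] ring_morphismD(1)[OF m2] by auto
  note [simp] = this
  show "eval3 c t v a [:[:[:0, 1:]:]:] = t" "eval3 c t v a [:[:0, 1:]:] = v" "eval3 c t v a [:0, 1:] = a"
    by (simp_all add: eval3_def)
qed

lemma separated_poly:
  fixes c :: "'i \<Rightarrow> 'a::comm_ring_1 \<Rightarrow> 'k::field_char_0"
  assumes c: "\<And>j. ring_morphism (c j)" and sep: "\<And>r. (\<And>j. c j r = 0) \<Longrightarrow> r = 0"
    and p: "\<And>j x. poly_via (c j) x p = 0"
  shows "p = 0"
proof (rule poly_eqI)
  fix n
  have "c j (coeff p n) = 0" for j
  proof -
    have "map_poly (c j) p = 0" using p[of j] by (intro poly_eq_0_if_vanishes) (simp add: poly_via_def)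
    then have "coeff (map_poly (c j) p) n = 0" by simp
    then show ?thesis using ring_morphismD(4)[OF c] by (simp add: coeff_map_poly)
  qed
  then show "coeff p n = coeff 0 n" using sep by simp
qed

text \<open>The base field is infinite.\<close>

lemma eval3_separates:
  fixes p :: "'k::field_char_0 poly poly poly"
  assumes "\<And>t v a. eval3 (\<lambda>x. x) t v a p = 0" shows "p = 0"
proof -
  note i = ring_morphism_id(1)[where 'a = 'k]
  note m1 = ring_morphism_poly_via[OF i]
  note m2 = ring_morphism_poly_via[OF m1]
  have s1: "r = 0" if "\<And>t. poly_via (\<lambda>x. x) t r = 0" for r :: "'k poly"
    using that by (intro poly_eq_0_if_vanishes) (simp add: poly_via_id)
  have s2: "r = 0" if "\<And>tv. poly_via (poly_via (\<lambda>x. x) (fst tv)) (snd tv) r = 0" for r :: "'k poly poly"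
    by (rule separated_poly[of "\<lambda>t. poly_via (\<lambda>x. x) t"]) (use m1 s1 that in \<open>auto simp: split_paired_all\<close>)
  show ?thesis
    by (rule separated_poly[of "\<lambda>tv. poly_via (poly_via (\<lambda>x. x) (fst tv)) (snd tv)"])
      (use m2 s2 assms in \<open>auto simp: eval3_def\<close>)
qed

lemma eval3_generic_injective:
  fixes c :: "'k::alg_closed_field \<Rightarrow> 'r::field"
  assumes c: "ring_morphism c" and t: "t \<notin> range c"
    and V: "V \<noteq> 0" "fls_subdegree V > 0" and y: "y \<noteq> 0" "fls_subdegree y > 0"
    and p: "eval3 (\<lambda>a. const2 (c a)) (const2 t) (fls_const V) (fls_const g + y) p = 0"
  shows "p = 0"
proof -
  note f = ring_morphism_fls_const
  note m0 = ring_morphism_poly_via[OF c, of t]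
  have i0: "r = 0" if "poly_via c t r = 0" for r
    using transcendental_if_not_constant[OF c t] that by blast
  have m1: "ring_morphism (\<lambda>r. fls_const (poly_via c t r))" by (rule ring_morphism_comp[OF f m0])
  note m2 = ring_morphism_poly_via[OF m1, of V]
  have i1: "r = 0" if "poly_via (\<lambda>r. fls_const (poly_via c t r)) V r = 0" for r
    using transcendental_fls[OF m0 i0 V, of 0 r] that by simp
  have i2: "r = 0" if "poly_via (\<lambda>r. fls_const (poly_via (\<lambda>r. fls_const (poly_via c t r)) V r)) (fls_const g + y) r = 0" for r
    by (rule transcendental_fls[OF m2 i1 y that])
  have e1: "poly_via (\<lambda>a. const2 (c a)) (const2 t) = (\<lambda>r. fls_const (fls_const (poly_via c t r)))"
  proof
    fix r
    show "poly_via (\<lambda>a. const2 (c a)) (const2 t) r = fls_const (fls_const (poly_via c t r))"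
      using poly_via_morphism[OF ring_morphism_const2 c, of t r] by (simp add: const2_def)
  qed
  have e2: "poly_via (poly_via (\<lambda>a. const2 (c a)) (const2 t)) (fls_const V) =
      (\<lambda>r. fls_const (poly_via (\<lambda>r. fls_const (poly_via c t r)) V r))"
  proof
    fix r
    show "poly_via (poly_via (\<lambda>a. const2 (c a)) (const2 t)) (fls_const V) r =
      fls_const (poly_via (\<lambda>r. fls_const (poly_via c t r)) V r)"
      unfolding e1 using poly_via_morphism[OF f m1, of V r] by simp
  qed
  show ?thesis using p i2[of p] unfolding eval3_def e2 by blast
qed

context symmetric_cubic
begin

lemma gpt_morphism:
  assumes "ring_morphism h" "ring_morphism c"
  shows "h (gpt c T V A $ i) = gpt (\<lambda>x. h (c x)) (h T) (h V) (h A) $ i"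
proof -
  have g: "h (gGam c T V) = gGam (\<lambda>x. h (c x)) (h T) (h V)"
    unfolding gGam_def using ring_morphismD[OF assms(1)] poly_via_morphism[OF assms] by simp
  have "\<forall>i. h (gpt c T V A $ i) = gpt (\<lambda>x. h (c x)) (h T) (h V) (h A) $ i"
    unfolding all_5 gpt_nth by (simp add: ring_morphismD[OF assms(1)] g)
  then show ?thesis by blast
qed

definition P3 :: "'k poly poly poly^5"
  where "P3 = gpt const3 [:[:[:0, 1:]:]:] [:[:0, 1:]:] [:0, 1:]"

lemma eval3_P3:
  assumes "ring_morphism c"
  shows "eval3 c t v a (P3 $ i) = gpt c t v a $ i"
  unfolding P3_def gpt_morphism[OF eval3_props(1)[OF assms] ring_morphism_const3] eval3_props[OF assms] ..

lemma eval3_eval_in: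
  assumes "ring_morphism c"
  shows "eval3 c t v a (eval_in const3 (\<lambda>i. P3 $ p i) f) = eval_in c (\<lambda>i. gpt c t v a $ p i) f"
  unfolding eval_in_morphism[OF eval3_props(1)[OF assms]] eval3_P3[OF assms] eval3_props(2)[OF assms] ..

end

section \<open>Equivariant rational maps to projective space\<close>

text \<open>Diagonalization in terms of linear forms: the \<open>r i\<close> are common eigenvectors of the two transposed
  matrices. The average over the four sign patterns writes each vector as a sum of common eigenvectors, so these
  span and contain a basis; \<open>c\<close> expresses the coordinates in it.\<close>

lemma commuting_involutions_eigenbasis:
  fixes A B :: "'k::field_char_0^'m^'m"
  assumes AA: "A ** A = mat 1" and BB: "B ** B = mat 1" and AB: "A ** B = B ** A"
  shows "\<exists>(a :: 'm \<Rightarrow> 'k) (b :: 'm \<Rightarrow> 'k) (r :: 'm \<Rightarrow> 'k^'m) (c :: 'm \<Rightarrow> 'm \<Rightarrow> 'k).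
    (\<forall>i. a i = 1 \<or> a i = -1) \<and> (\<forall>i. b i = 1 \<or> b i = -1) \<and>
    (\<forall>i x. (\<Sum>k\<in>UNIV. r i $ k * (A *v x) $ k) = a i * (\<Sum>k\<in>UNIV. r i $ k * x $ k)) \<and>
    (\<forall>i x. (\<Sum>k\<in>UNIV. r i $ k * (B *v x) $ k) = b i * (\<Sum>k\<in>UNIV. r i $ k * x $ k)) \<and>
    (\<forall>n j. (\<Sum>i\<in>UNIV. c n i * r i $ j) = (if j = n then 1 else 0))"
proof -
  define A' B' where "A' = Finite_Cartesian_Product.transpose A" and "B' = Finite_Cartesian_Product.transpose B"
  have AA': "A' *v (A' *v v) = v" and BB': "B' *v (B' *v v) = v" and AB': "A' *v (B' *v v) = B' *v (A' *v v)" for v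
    unfolding matrix_vector_mul_assoc A'_def B'_def matrix_transpose_mul[symmetric] AA BB AB
    by (simp_all add: transpose_mat)
  define E where "E = {v. \<exists>a\<in>{1, -1}. \<exists>b\<in>{1, -1}. A' *v v = a *s v \<and> B' *v v = b *s v}"
  have spanE: "v \<in> vec.span E" for v
  proof -
    define p where "p s t = (1/4) *s (v + s *s (A' *v v) + t *s (B' *v v) + (s * t) *s (A' *v (B' *v v)))" for s t :: 'k
    have "p s t \<in> E" if "s \<in> {1, -1}" "t \<in> {1, -1}" for s t
    proof -
      have s: "s * s = 1" "t * t = 1" using that by auto
      have "A' *v p s t = (1/4) *s (A' *v v + s *s v + t *s (A' *v (B' *v v)) + (s * t) *s (B' *v v))"
        by (simp add: p_def matrix_vector_right_distrib vector_scalar_commute AA' AB')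
      also have "\<dots> = s *s p s t"
        using s by (simp add: p_def vec_eq_iff algebra_simps flip: mult.assoc)
      finally have 1: "A' *v p s t = s *s p s t" .
      have "B' *v p s t = (1/4) *s (B' *v v + s *s (A' *v (B' *v v)) + t *s v + (s * t) *s (A' *v v))"
        by (simp add: p_def matrix_vector_right_distrib vector_scalar_commute BB' AB')
      also have "\<dots> = t *s p s t"
        using s by (simp add: p_def vec_eq_iff algebra_simps flip: mult.assoc)
      finally show ?thesis using 1 that unfolding E_def by blast
    qed
    then have "p 1 1 + p 1 (-1) + p (-1) 1 + p (-1) (-1) \<in> vec.span E"
      by (intro vec.span_add vec.span_base) auto
    also have "p 1 1 + p 1 (-1) + p (-1) 1 + p (-1) (-1) = v"
      by (simp add: p_def vec_eq_iff)
    finally show ?thesis .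
  qed
  obtain S where S: "S \<subseteq> E" "vec.independent S" "E \<subseteq> vec.span S"
    using vec.maximal_independent_subset[of E] by blast
  have "vec.span E \<subseteq> vec.span S" using S(3) by (metis vec.span_mono vec.span_span)
  then have spanS: "v \<in> vec.span S" for v using spanE by blast
  have "card S = vec.dim (UNIV :: ('k^'m) set)"
    by (rule vec.basis_card_eq_dim[OF _ _ S(2)]) (use spanS in auto)
  then have "card S = CARD('m)" unfolding vec_dim_card .
  moreover have fin: "finite S" using S(2) by (rule vec.finiteI_independent)
  ultimately obtain r :: "'m \<Rightarrow> 'k^'m" where r: "bij_betw r UNIV S"
    using finite_same_card_bij[of "UNIV :: 'm set" S] by auto
  have "\<exists>a b. (a = 1 \<or> a = -1) \<and> (b = 1 \<or> b = -1) \<and> A' *v r i = a *s r i \<and> B' *v r i = b *s r i" for i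
  proof -
    have "r i \<in> E" using bij_betwE[OF r] S(1) by blast
    then show ?thesis unfolding E_def by blast
  qed
  then obtain a b where ab: "\<And>i. a i = 1 \<or> a i = -1" "\<And>i. b i = 1 \<or> b i = -1"
    "\<And>i. A' *v r i = a i *s r i" "\<And>i. B' *v r i = b i *s r i" by metis
  have tr: "(\<Sum>k\<in>UNIV. v $ k * (M *v x) $ k) = (\<Sum>k\<in>UNIV. (Finite_Cartesian_Product.transpose M *v v) $ k * x $ k)"
    for M :: "'k^'m^'m" and v x
  proof -
    have "(\<Sum>k\<in>UNIV. v $ k * (M *v x) $ k) = (\<Sum>k\<in>UNIV. \<Sum>j\<in>UNIV. v $ k * (M $ k $ j * x $ j))"
      by (simp add: matrix_vector_mult_def sum_distrib_left)
    also have "\<dots> = (\<Sum>j\<in>UNIV. \<Sum>k\<in>UNIV. v $ k * (M $ k $ j * x $ j))" by (rule sum.swap)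
    also have "\<dots> = (\<Sum>k\<in>UNIV. (Finite_Cartesian_Product.transpose M *v v) $ k * x $ k)"
      by (simp add: matrix_vector_mult_def Finite_Cartesian_Product.transpose_def sum_distrib_left sum_distrib_right mult_ac)
    finally show ?thesis .
  qed
  have eA: "(\<Sum>k\<in>UNIV. r i $ k * (A *v x) $ k) = a i * (\<Sum>k\<in>UNIV. r i $ k * x $ k)" for i x
    unfolding tr A'_def[symmetric] ab(3) by (simp add: sum_distrib_left mult.assoc)
  have eB: "(\<Sum>k\<in>UNIV. r i $ k * (B *v x) $ k) = b i * (\<Sum>k\<in>UNIV. r i $ k * x $ k)" for i x
    unfolding tr B'_def[symmetric] ab(4) by (simp add: sum_distrib_left mult.assoc)
  have "\<exists>u. (\<Sum>i\<in>UNIV. u i *s r i) = axis n 1" for n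
  proof -
    have "axis n 1 \<in> range (\<lambda>u. \<Sum>v\<in>S. u v *s v)" using spanS vec.span_finite[OF fin] by blast
    then obtain u where "axis n 1 = (\<Sum>v\<in>S. u v *s v)" by blast
    also have "\<dots> = (\<Sum>i\<in>UNIV. u (r i) *s r i)"
      by (rule sum.reindex_bij_betw[OF r, symmetric])
    finally show ?thesis by metis
  qed
  then obtain c where c: "\<And>n. (\<Sum>i\<in>UNIV. c n i *s r i) = axis n 1" by metis
  have "(\<Sum>i\<in>UNIV. c n i * r i $ j) = (if j = n then 1 else 0)" for n j
  proof -
    have "(\<Sum>i\<in>UNIV. c n i *s r i) $ j = (axis n 1 :: 'k^'m) $ j" unfolding c ..
    then show ?thesis by (simp add: axis_def)
  qed
  with ab(1,2) eA eB show ?thesis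
    by (intro exI[of _ a] exI[of _ b] exI[of _ r] exI[of _ c] conjI allI)
qed

lemma swap12_nth: "swap12 x $ i = x $ Transposition.transpose 1 2 i"
proof -
  have "\<forall>i. swap12 x $ i = x $ Transposition.transpose 1 2 i"
    unfolding all_5 swap12_def vector_5 by (simp add: Transposition.transpose_def)
  then show ?thesis by blast
qed

lemma swap45_nth: "swap45 x $ i = x $ Transposition.transpose 4 5 i"
proof -
  have "\<forall>i. swap45 x $ i = x $ Transposition.transpose 4 5 i"
    unfolding all_5 swap45_def vector_5 by (simp add: Transposition.transpose_def)
  then show ?thesis by blast
qed

lemma eval_in_in_subring:
  assumes "subring_set R" "range c \<subseteq> R" "\<And>i. a i \<in> R"
  shows "eval_in c a f \<in> R"
  unfolding eval_in_def using assms(2,3)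
  by (intro subring_sum[OF assms(1)] subring_prod[OF assms(1)] subring_setD(6)[OF assms(1)] subring_setD(7)[OF assms(1)]) auto

context symmetric_cubic
begin

text \<open>The forms \<open>g\<close> and \<open>h\<close> represent a birational map and its inverse outside the zeros of \<open>f0\<close>. All
  relations between them hold at the generic point over \<open>k[T, V, A]\<close> and hence at its image \<open>\<eta>\<close> in the iterated Laurent
  series, on which the swaps of the coordinates act as the sign changes of \<open>u\<close> and \<open>w\<close>.\<close>

lemma no_equivariant_forms:
  fixes g :: "'m::finite \<Rightarrow> (5, 'k) mpoly" and h :: "5 \<Rightarrow> ('m, 'k) mpoly" and f0 :: "(5, 'k) mpoly"
    and r :: "'m \<Rightarrow> 'k^'m" and a b :: "'m \<Rightarrow> 'k" and c :: "'m \<Rightarrow> 'm \<Rightarrow> 'k"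
    and \<iota> :: "'k \<Rightarrow> 'r::{alg_closed_field, field_char_0}"
  defines "G \<equiv> \<lambda>i x. \<Sum>k\<in>UNIV. r i $ k * peval (g k) x"
  assumes \<iota>: "ring_morphism \<iota>" and t: "t \<notin> range \<iota>"
    and card: "CARD('m) \<le> 4"
    and f0: "homogeneous d0 f0" and g: "\<And>i. homogeneous d (g i)" and h: "\<And>n. homogeneous e (h n)"
    and pt0: "A0 \<noteq> 0" "Gam T0 V0 \<noteq> 0" "peval f0 (pt T0 V0 A0) \<noteq> 0" "peval_map g (pt T0 V0 A0) \<noteq> 0"
      "peval_map h (peval_map g (pt T0 V0 A0)) \<noteq> 0"
    and inv: "\<And>x m n. x \<noteq> 0 \<Longrightarrow> peval F x = 0 \<Longrightarrow> peval f0 x \<noteq> 0 \<Longrightarrow> peval_map g x \<noteq> 0 \<Longrightarrow>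
      peval (h m) (peval_map g x) * x $ n = peval (h n) (peval_map g x) * x $ m"
    and ab: "\<And>i. a i = 1 \<or> a i = -1" "\<And>i. b i = 1 \<or> b i = -1"
    and rc: "\<And>n j. (\<Sum>i\<in>UNIV. c n i * r i $ j) = (if j = n then 1 else 0)"
    and eq12: "\<And>x i j. x \<noteq> 0 \<Longrightarrow> peval F x = 0 \<Longrightarrow> peval f0 x \<noteq> 0 \<Longrightarrow> peval f0 (swap12 x) \<noteq> 0 \<Longrightarrow>
      G i (swap12 x) * (a j * G j x) = G j (swap12 x) * (a i * G i x)"
    and eq45: "\<And>x i j. x \<noteq> 0 \<Longrightarrow> peval F x = 0 \<Longrightarrow> peval f0 x \<noteq> 0 \<Longrightarrow> peval f0 (swap45 x) \<noteq> 0 \<Longrightarrow>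
      G i (swap45 x) * (b j * G j x) = G j (swap45 x) * (b i * G i x)"
  shows False
proof -
  obtain r1 r2 r3 where rr: "r1 \<noteq> r2" "r1 \<noteq> r3" "r2 \<noteq> r3"
    and q: "q = smult (- c4) ([:- r1, 1:] * ([:- r2, 1:] * [:- r3, 1:]))" by (rule q_factorization)
  obtain s where s: "s ^ 2 = poly_via \<iota> t q" using nth_root_exists[of 2 "poly_via \<iota> t q"] by auto
  define l0 where "l0 = poly_via \<iota> t l"
  have s': "s ^ 2 = \<iota> (- c4) * ((t - \<iota> r1) * (t - \<iota> r2) * (t - \<iota> r3))"
    unfolding s q poly_via_smult[OF \<iota>] ring_morphismD(3)[OF ring_morphism_poly_via[OF \<iota>]]
    by (simp add: poly_via_pCons[OF \<iota>] ring_morphismD[OF \<iota>] mult.assoc)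
  have "q \<noteq> 0" using c4_nonzero by (simp add: q_def)
  then have s0: "s \<noteq> 0" using transcendental_if_not_constant[OF \<iota> t] s by fastforce
  define k where "k = (\<lambda>x. const2 (\<iota> x))"
  have k: "ring_morphism k" unfolding k_def by (rule ring_morphism_comp[OF ring_morphism_const2 \<iota>])
  note K = ring_morphismD[OF k]
  define T V \<alpha> \<gamma> where "T = const2 t" and "V = gen_V s l0" and "\<alpha> = gen_A s l0" and "\<gamma> = fls_const (gen_g' s l0 ^ 2)"
  note g' = gen_g'_props[OF s0, of l0] and A' = gen_A_props[OF s0, of l0] and V' = gen_V'_props[OF s0, of l0]
  have \<alpha>0: "\<alpha> \<noteq> 0" using A' by (simp add: \<alpha>_def)
  have \<gamma>0: "\<gamma> \<noteq> 0" using g'(1) by (simp add: \<gamma>_def)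
  have Gam: "gGam k T V = \<gamma>"
  proof -
    have "poly_via k T p = const2 (poly_via \<iota> t p)" for p
      unfolding k_def T_def using poly_via_morphism[OF ring_morphism_const2 \<iota>, of t p] by simp
    then have "gGam k T V = const2 (s ^ 2) + V ^ 2 * const2 l0" by (simp add: gGam_def s l0_def)
    also have "\<dots> = fls_const (fls_const (s ^ 2) + gen_V' s l0 ^ 2 * fls_const l0)"
      by (simp only: V_def gen_V_def const2_def ring_morphismD[OF ring_morphism_fls_const])
    finally show ?thesis unfolding g'(4)[symmetric] \<gamma>_def .
  qed
  define \<eta> :: "'r fls fls^5" where "\<eta> = vector [2 * \<alpha>, 2 * (\<gamma> / \<alpha>), 2, T + V, T - V]"
  have \<eta>: "\<eta> $ 1 = 2 * \<alpha>" "\<eta> $ 2 = 2 * (\<gamma> / \<alpha>)" "\<eta> $ 3 = 2" "\<eta> $ 4 = T + V" "\<eta> $ 5 = T - V"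
    by (simp_all add: \<eta>_def vector_5)
  have gpt: "gpt k T V \<alpha> $ n = \<alpha> * \<eta> $ n" for n
  proof -
    have "\<forall>n. gpt k T V \<alpha> $ n = \<alpha> * \<eta> $ n"
      unfolding all_5 gpt_nth \<eta> Gam using \<alpha>0 by (simp add: power2_eq_square)
    then show ?thesis by blast
  qed
  define ev where "ev = eval3 k T V \<alpha>"
  have ev: "ring_morphism ev" unfolding ev_def by (rule eval3_props(1)[OF k])
  note EV = ring_morphismD[OF ev]
  have ev_inj: "p = 0" if p: "ev p = 0" for p
  proof -
    obtain y where y: "y \<noteq> 0" "fls_subdegree y > 0" "\<alpha> = fls_const (gen_g' s l0) + y"
      using A'(4) unfolding \<alpha>_def by blast
    show ?thesis
      by (rule eval3_generic_injective[OF \<iota> t V'(1) _ y(1,2), of "gen_g' s l0"])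
        (use p V'(2) in \<open>simp_all add: ev_def k_def T_def V_def gen_V_def y(3)\<close>)
  qed
  define R where "R p f = eval_in const3 (\<lambda>i. P3 $ p i) f" for p and f :: "(5, 'k) mpoly"
  note I = ring_morphism_id(1)[where 'a = 'k]
  have Rk: "eval3 (\<lambda>x. x) t v a' (R p f) = peval f (\<chi> i. pt t v a' $ p i)" for t v a' p f
    unfolding R_def eval3_eval_in[OF I] by (simp add: peval_eval_in)
  have Rid: "eval3 (\<lambda>x. x) t v a' (R (\<lambda>i. i) f) = peval f (pt t v a')" for t v a' f
    unfolding Rk by (simp add: vec_lambda_eta)
  have ptn: "(\<chi> i. pt t v a' $ Transposition.transpose 1 2 i) = swap12 (pt t v a')"
    "(\<chi> i. pt t v a' $ Transposition.transpose 4 5 i) = swap45 (pt t v a')" for t v a'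
    by (simp_all add: vec_eq_iff swap12_nth swap45_nth)
  have R12: "eval3 (\<lambda>x. x) t v a' (R (Transposition.transpose 1 2) f) = peval f (swap12 (pt t v a'))"
    and R45: "eval3 (\<lambda>x. x) t v a' (R (Transposition.transpose 4 5) f) = peval f (swap45 (pt t v a'))" for t v a' f
    unfolding Rk ptn by simp_all
  have evR: "ev (R p f) = \<alpha> ^ d' * eval_in k (\<lambda>i. \<eta> $ p i) f" if "homogeneous d' f" for p f d'
    unfolding R_def ev_def eval3_eval_in[OF k] gpt by (rule eval_in_scale[OF that])
  have nz: "p \<noteq> 0" if "eval3 (\<lambda>x. x) t v a' p \<noteq> 0" for p and t v a' :: 'k
    using that ring_morphismD(4)[OF eval3_props(1)[OF I]] by auto
  note E3 = ring_morphismD[OF eval3_props(1)[OF I]] and S3 = ring_morphism_sum[OF eval3_props(1)[OF I]]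
  define v0 where "v0 = pt T0 V0 A0"
  let ?A3 = "[:0, 1:] :: 'k poly poly poly"
  have A3: "?A3 \<noteq> 0" "eval3 (\<lambda>x. x) t v a' ?A3 = a'" for t v a' :: 'k
    by (simp_all add: eval3_props(5)[OF I])
  have f0R: "R (\<lambda>i. i) f0 \<noteq> 0" by (rule nz[of T0 V0 A0]) (simp add: Rid pt0)
  have f0R12: "R (Transposition.transpose 1 2) f0 \<noteq> 0"
  proof (rule nz[of T0 V0 "Gam T0 V0 / A0"])
    have "swap12 (pt T0 V0 (Gam T0 V0 / A0)) = (Gam T0 V0 / A0 ^ 2) *s pt T0 V0 A0"
      using pt0 by (simp add: vec_eq_5 swap12_def vector_5 gpt_nth power2_eq_square)
    then show "eval3 (\<lambda>x. x) T0 V0 (Gam T0 V0 / A0) (R (Transposition.transpose 1 2) f0) \<noteq> 0"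
      using pt0 unfolding R12 by (simp add: peval_scale[OF f0])
  qed
  have f0R45: "R (Transposition.transpose 4 5) f0 \<noteq> 0"
  proof (rule nz[of T0 "- V0" A0])
    have "swap45 (pt T0 (- V0) A0) = pt T0 V0 A0"
      by (simp add: vec_eq_5 swap45_def vector_5 gpt_nth gGam_def)
    then show "eval3 (\<lambda>x. x) T0 (- V0) A0 (R (Transposition.transpose 4 5) f0) \<noteq> 0"
      using pt0 unfolding R45 by simp
  qed
  \<comment> \<open>An identity that holds at the points where the cutoff \<open>u\<close> does not vanish holds generically.\<close>
  have transfer: "p = 0" if u: "u \<noteq> 0"
    and van: "\<And>t v a'. a' \<noteq> 0 \<Longrightarrow> eval3 (\<lambda>x. x) t v a' u \<noteq> 0 \<Longrightarrow> eval3 (\<lambda>x. x) t v a' p = 0"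
    for u p :: "'k poly poly poly"
  proof -
    have "?A3 * u * p = 0"
    proof (rule eval3_separates)
      fix t v a' :: 'k
      show "eval3 (\<lambda>x. x) t v a' (?A3 * u * p) = 0"
        unfolding E3(3) A3(2) using van[of a' t v] by auto
    qed
    then show ?thesis using u A3(1) by simp
  qed
  have ptX: "pt t v a' \<noteq> 0 \<and> peval F (pt t v a') = 0" if "a' \<noteq> 0" for t v a'
    using pt_on that by (auto simp: vec_eq_5 gpt_nth)
  define gR where "gR p i = (\<Sum>n\<in>UNIV. const3 (r i $ n) * R p (g n))" for p i
  have gRk: "eval3 (\<lambda>x. x) t v a' (gR p i) = G i (\<chi> i. pt t v a' $ p i)" for t v a' p i
    unfolding gR_def S3 E3 eval3_props(2)[OF I] Rk G_def ..
  have gRid: "eval3 (\<lambda>x. x) t v a' (gR (\<lambda>i. i) i) = G i (pt t v a')" for t v a' i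
    unfolding gRk by (simp add: vec_lambda_eta)
  define Z where "Z p i = (\<Sum>n\<in>UNIV. k (r i $ n) * eval_in k (\<lambda>m. \<eta> $ p m) (g n))" for p i
  have evg: "ev (gR p i) = \<alpha> ^ d * Z p i" for p i
    unfolding gR_def ring_morphism_sum[OF ev] EV evR[OF g] Z_def sum_distrib_left
    by (simp add: ev_def eval3_props(2)[OF k] mult_ac)
  have eigen: "Z p i * (k (w j) * Z (\<lambda>i. i) j) = Z p j * (k (w i) * Z (\<lambda>i. i) i)"
    if up: "R p f0 \<noteq> 0"
      and val: "\<And>t v a'. a' \<noteq> 0 \<Longrightarrow> peval f0 (pt t v a') \<noteq> 0 \<Longrightarrow> peval f0 (\<chi> i. pt t v a' $ p i) \<noteq> 0 \<Longrightarrow>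
        G i (\<chi> i. pt t v a' $ p i) * (w j * G j (pt t v a')) = G j (\<chi> i. pt t v a' $ p i) * (w i * G i (pt t v a'))"
    for p i j w
  proof -
    have "gR p i * (const3 (w j) * gR (\<lambda>i. i) j) - gR p j * (const3 (w i) * gR (\<lambda>i. i) i) = 0"
    proof (rule transfer[of "R p f0 * R (\<lambda>i. i) f0"])
      show "R p f0 * R (\<lambda>i. i) f0 \<noteq> 0" using up f0R by simp
      fix t v a' :: 'k
      assume "a' \<noteq> 0" "eval3 (\<lambda>x. x) t v a' (R p f0 * R (\<lambda>i. i) f0) \<noteq> 0"
      then show "eval3 (\<lambda>x. x) t v a' (gR p i * (const3 (w j) * gR (\<lambda>i. i) j) - gR p j * (const3 (w i) * gR (\<lambda>i. i) i)) = 0"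
        using val[of a' t v] unfolding E3 gRk[of _ _ _ p] gRid eval3_props(2)[OF I] Rid Rk[of _ _ _ p] by simp
    qed
    then have "ev (gR p i * (const3 (w j) * gR (\<lambda>i. i) j) - gR p j * (const3 (w i) * gR (\<lambda>i. i) i)) = 0"
      by (simp add: EV)
    moreover have "ev (const3 x) = k x" for x by (simp add: ev_def eval3_props(2)[OF k])
    ultimately have "\<alpha> ^ d * \<alpha> ^ d * (Z p i * (k (w j) * Z (\<lambda>i. i) j)) = \<alpha> ^ d * \<alpha> ^ d * (Z p j * (k (w i) * Z (\<lambda>i. i) i))"
      unfolding EV evg by (simp add: mult_ac)
    then show ?thesis using \<alpha>0 by simp
  qed
  define Z0 where "Z0 i = Z (\<lambda>i. i) i" for i
  note su = ring_morphismD[OF swap_morphism(1)[where 'r = 'r]] ring_morphism_divide[OF swap_morphism(1)[where 'r = 'r]]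
  note sw = ring_morphismD[OF swap_morphism(2)[where 'r = 'r]]
  note sg = swap_gen[OF s0, of l0]
  have su\<gamma>: "swap_u \<gamma> = \<gamma>"
  proof -
    have "swap_u \<alpha> = \<gamma> / \<alpha>" using sg(1) by (simp add: \<alpha>_def \<gamma>_def)
    moreover have "swap_u V = V" "swap_u T = T" using sg(3) by (simp_all add: V_def T_def swap_const2)
    moreover have "swap_u (k x) = k x" for x by (simp add: k_def swap_const2)
    moreover have "swap_u (poly_via k T p) = poly_via (\<lambda>x. swap_u (k x)) (swap_u T) p" for p
      by (rule poly_via_morphism[OF swap_morphism(1) k])
    ultimately show ?thesis unfolding Gam[symmetric] gGam_def by (simp add: su)
  qed
  have sw\<gamma>: "swap_w \<gamma> = \<gamma>"
  proof -
    have "swap_w V = - V" "swap_w T = T" using sg(5) by (simp_all add: V_def T_def swap_const2)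
    moreover have "swap_w (k x) = k x" for x by (simp add: k_def swap_const2)
    moreover have "swap_w (poly_via k T p) = poly_via (\<lambda>x. swap_w (k x)) (swap_w T) p" for p
      by (rule poly_via_morphism[OF swap_morphism(2) k])
    ultimately show ?thesis unfolding Gam[symmetric] gGam_def by (simp add: sw)
  qed
  have u\<eta>: "swap_u (\<eta> $ i) = \<eta> $ Transposition.transpose 1 2 i" for i
  proof -
    have "swap_u \<alpha> = \<gamma> / \<alpha>" "swap_u V = V" "swap_u T = T"
      using sg(1,3) by (simp_all add: \<alpha>_def \<gamma>_def V_def T_def swap_const2)
    then have "\<forall>i. swap_u (\<eta> $ i) = \<eta> $ Transposition.transpose 1 2 i"
      unfolding all_5 using \<gamma>0 \<alpha>0 by (simp add: Transposition.transpose_def \<eta> su su\<gamma>)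
    then show ?thesis by blast
  qed
  have w\<eta>: "swap_w (\<eta> $ i) = \<eta> $ Transposition.transpose 4 5 i" for i
  proof -
    have "swap_w \<alpha> = \<alpha>" "swap_w V = - V" "swap_w T = T"
      using sg(4,5) by (simp_all add: \<alpha>_def V_def T_def swap_const2)
    then have "\<forall>i. swap_w (\<eta> $ i) = \<eta> $ Transposition.transpose 4 5 i"
      unfolding all_5
      by (simp add: Transposition.transpose_def \<eta> sw sw\<gamma> ring_morphism_divide[OF swap_morphism(2)[where 'r = 'r]])
    then show ?thesis by blast
  qed
  have uZ: "swap_u (Z0 i) = Z (Transposition.transpose 1 2) i" and wZ: "swap_w (Z0 i) = Z (Transposition.transpose 4 5) i" for i
    unfolding Z0_def Z_def ring_morphism_sum[OF swap_morphism(1)] ring_morphism_sum[OF swap_morphism(2)]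
      su(3) sw(3) eval_in_morphism[OF swap_morphism(1)] eval_in_morphism[OF swap_morphism(2)] u\<eta> w\<eta>
    by (simp_all add: k_def swap_const2)
  have e12: "swap_u (Z0 i) * (k (a j) * Z0 j) = swap_u (Z0 j) * (k (a i) * Z0 i)" for i j
    unfolding uZ unfolding Z0_def by (rule eigen[OF f0R12]) (use eq12 ptX ptn in metis)
  have e45: "swap_w (Z0 i) * (k (b j) * Z0 j) = swap_w (Z0 j) * (k (b i) * Z0 i)" for i j
    unfolding wZ unfolding Z0_def by (rule eigen[OF f0R45]) (use eq45 ptX ptn in metis)
  obtain n1 where n1: "peval (g n1) (pt T0 V0 A0) \<noteq> 0" using pt0(4) by (auto simp: peval_map_def vec_eq_iff)
  obtain n2 where n2: "peval (h n2) (peval_map g (pt T0 V0 A0)) \<noteq> 0" using pt0(5) by (auto simp: peval_map_def vec_eq_iff)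
  define g\<eta> where "g\<eta> n = eval_in k (\<lambda>m. \<eta> $ m) (g n)" for n
  have gn1: "R (\<lambda>i. i) (g n1) \<noteq> 0" by (rule nz[of T0 V0 A0]) (simp add: Rid n1)
  have evgn: "ev (R (\<lambda>i. i) (g n)) = \<alpha> ^ d * g\<eta> n" for n unfolding g\<eta>_def by (rule evR[OF g])
  have g\<eta>n1: "g\<eta> n1 \<noteq> 0" using ev_inj[of "R (\<lambda>i. i) (g n1)"] gn1 unfolding evgn by auto
  have recon: "g\<eta> n = (\<Sum>i\<in>UNIV. k (c n i) * Z0 i)" for n
  proof -
    have "(\<Sum>i\<in>UNIV. k (c n i) * Z0 i) = (\<Sum>i\<in>UNIV. \<Sum>m\<in>UNIV. k (c n i * r i $ m) * g\<eta> m)"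
      unfolding Z0_def Z_def g\<eta>_def K sum_distrib_left by (simp add: mult.assoc)
    also have "\<dots> = (\<Sum>m\<in>UNIV. \<Sum>i\<in>UNIV. k (c n i * r i $ m) * g\<eta> m)" by (rule sum.swap)
    also have "\<dots> = (\<Sum>m\<in>UNIV. k (\<Sum>i\<in>UNIV. c n i * r i $ m) * g\<eta> m)"
      unfolding ring_morphism_sum[OF k] sum_distrib_right ..
    also have "\<dots> = (\<Sum>m\<in>UNIV. if m = n then g\<eta> m else 0)"
      unfolding rc by (rule sum.cong) (simp_all add: K)
    also have "\<dots> = g\<eta> n" by simp
    finally show ?thesis ..
  qed
  obtain n0 where n0: "Z0 n0 \<noteq> 0"
  proof (rule ccontr)
    assume "\<not> thesis"
    then have "Z0 i = 0" for i using that by blast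
    then have "g\<eta> n1 = 0" unfolding recon by simp
    then show False using g\<eta>n1 by blast
  qed
  define Y where "Y i = Z0 i / Z0 n0" for i
  have sign: "zi' / z0' = zi / z0 \<or> zi' / z0' = - (zi / z0)"
    if "zi' * (w0 * z0) = z0' * (wi * zi)" "z0 \<noteq> 0" "z0' \<noteq> 0" "w0 = 1 \<or> w0 = -1" "wi = 1 \<or> wi = -1"
    for zi zi' z0 z0' w0 wi :: "'r fls fls"
  proof -
    have "zi' * z0 = z0' * zi \<or> zi' * z0 = - (z0' * zi)" using that(1,4,5) by (auto, metis minus_minus)
    then show ?thesis
    proof
      assume "zi' * z0 = z0' * zi"
      then have "zi' * z0 = zi * z0'" by (simp add: mult.commute)
      then have "zi' / z0' = zi / z0" using that(2,3) frac_eq_eq by blast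
      then show ?thesis ..
    next
      assume "zi' * z0 = - (z0' * zi)"
      then have "zi' * z0 = (- zi) * z0'" by (simp add: mult.commute)
      then have "zi' / z0' = (- zi) / z0" using that(2,3) frac_eq_eq by blast
      then show ?thesis by simp
    qed
  qed
  have kab: "k (a i) = 1 \<or> k (a i) = -1" "k (b i) = 1 \<or> k (b i) = -1" for i
    using ab(1)[of i] ab(2)[of i] by (auto simp: K)
  have Yu: "swap_u (Y i) = Y i \<or> swap_u (Y i) = - Y i" for i
    unfolding Y_def su(9)
    by (rule sign[OF e12 n0 _ kab(1) kab(1)]) (use n0 ring_morphism_inj[OF swap_morphism(1)] in blast)
  have Yw: "swap_w (Y i) = Y i \<or> swap_w (Y i) = - Y i" for i
    unfolding Y_def ring_morphism_divide[OF swap_morphism(2)]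
    by (rule sign[OF e45 n0 _ kab(2) kab(2)]) (use n0 ring_morphism_inj[OF swap_morphism(2)] in blast)
  define y where "y j = (\<Sum>i\<in>UNIV. k (c j i) * Y i)" for j
  have g\<eta>y: "g\<eta> j = Z0 n0 * y j" for j
    unfolding recon y_def sum_distrib_left using n0 by (intro sum.cong) (simp_all add: Y_def)
  define H where "H n = eval_in k y (h n)" for n
  define hR where "hR n = eval_in const3 (\<lambda>j. R (\<lambda>i. i) (g j)) (h n)" for n
  have hRk: "eval3 (\<lambda>x. x) t v a' (hR n) = peval (h n) (peval_map g (pt t v a'))" for t v a' n
    unfolding hR_def eval_in_morphism[OF eval3_props(1)[OF I]] eval3_props(2)[OF I] Rid
    by (simp add: peval_eval_in peval_map_def)
  have evh: "ev (hR n) = (\<alpha> ^ d * Z0 n0) ^ e * H n" for n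
  proof -
    have "ev (hR n) = eval_in k (\<lambda>j. (\<alpha> ^ d * Z0 n0) * y j) (h n)"
      unfolding hR_def eval_in_morphism[OF ev] evgn g\<eta>y by (simp add: ev_def eval3_props(2)[OF k] mult.assoc)
    then show ?thesis unfolding eval_in_scale[OF h] H_def .
  qed
  have evP: "ev (P3 $ n) = \<alpha> * \<eta> $ n" for n
    unfolding ev_def eval3_P3[OF k] gpt ..
  have rel: "H m * \<eta> $ n = H n * \<eta> $ m" for m n
  proof -
    have "hR m * P3 $ n - hR n * P3 $ m = 0"
    proof (rule transfer[of "R (\<lambda>i. i) f0 * R (\<lambda>i. i) (g n1)"])
      show "R (\<lambda>i. i) f0 * R (\<lambda>i. i) (g n1) \<noteq> 0" using f0R gn1 by simp
      fix t v a' :: 'k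
      assume a': "a' \<noteq> 0" and nz: "eval3 (\<lambda>x. x) t v a' (R (\<lambda>i. i) f0 * R (\<lambda>i. i) (g n1)) \<noteq> 0"
      have "peval f0 (pt t v a') \<noteq> 0" "peval (g n1) (pt t v a') \<noteq> 0" using nz unfolding E3 Rid by auto
      moreover from this(2) have "peval_map g (pt t v a') \<noteq> 0" by (auto simp: peval_map_def vec_eq_iff)
      ultimately have "peval (h m) (peval_map g (pt t v a')) * pt t v a' $ n = peval (h n) (peval_map g (pt t v a')) * pt t v a' $ m"
        using inv ptX[OF a'] by blast
      then show "eval3 (\<lambda>x. x) t v a' (hR m * P3 $ n - hR n * P3 $ m) = 0"
        unfolding E3 hRk eval3_P3[OF I] by simp
    qed
    then have "ev (hR m * P3 $ n - hR n * P3 $ m) = 0" by (simp add: EV)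
    then have "(\<alpha> ^ d * Z0 n0) ^ e * \<alpha> * (H m * \<eta> $ n) = (\<alpha> ^ d * Z0 n0) ^ e * \<alpha> * (H n * \<eta> $ m)"
      unfolding EV evh evP by (simp add: mult_ac)
    then show ?thesis using \<alpha>0 n0 by simp
  qed
  have H3: "H 3 \<noteq> 0"
  proof
    assume "H 3 = 0"
    then have "H n2 = 0" using rel[of n2 3] by (simp add: \<eta>)
    then have "hR n2 = 0" by (intro ev_inj) (simp add: evh)
    moreover have "hR n2 \<noteq> 0" by (rule nz[of T0 V0 A0]) (simp add: hRk n2)
    ultimately show False by blast
  qed
  have rels: "H 1 * 2 = H 3 * (2 * \<alpha>)" "H 4 * 2 = H 3 * (T + V)" "H 5 * 2 = H 3 * (T - V)"
    using rel[of 1 3] rel[of 4 3] rel[of 5 3] unfolding \<eta> .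
  have half: "x = y" if "2 * x = 2 * y" for x y :: "'r fls fls" using that by simp
  have "2 * H 1 = 2 * (\<alpha> * H 3)" using rels(1) by (simp only: mult_ac)
  then have H1: "H 1 = \<alpha> * H 3" by (rule half)
  have "2 * (H 4 + H 5) = H 4 * 2 + H 5 * 2" by (simp only: distrib_left mult.commute)
  also have "\<dots> = 2 * (T * H 3)" unfolding rels by (simp add: algebra_simps)
  finally have H45: "H 4 + H 5 = T * H 3" by (rule half)
  have "2 * (H 4 - H 5) = H 4 * 2 - H 5 * 2" by (simp only: right_diff_distrib mult.commute)
  also have "\<dots> = 2 * (V * H 3)" unfolding rels by (simp add: algebra_simps)
  finally have H45': "H 4 - H 5 = V * H 3" by (rule half)
  have gen: "H 1 \<in> S \<and> H 3 \<in> S \<and> H 4 \<in> S \<and> H 5 \<in> S"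
    if S: "subring_set S" "range (\<lambda>x. const2 (\<iota> x)) \<subseteq> S" "range Y \<subseteq> S" for S
  proof -
    have kS: "range k \<subseteq> S" using S(2) by (simp add: k_def)
    have "y j \<in> S" for j
      unfolding y_def using kS S(3) by (intro subring_sum[OF S(1)] subring_setD(6)[OF S(1)]) auto
    then have "H n \<in> S" for n unfolding H_def by (intro eval_in_in_subring[OF S(1) kS])
    then show ?thesis by blast
  qed
  have "- c4 \<noteq> 0" using c4_nonzero by simp
  moreover have "Y n0 = 1" using n0 by (simp add: Y_def)
  ultimately show False
    by (rule no_diagonal_model[OF \<iota> t rr _ s' card _ Yu Yw gen H3
      H1[unfolded \<alpha>_def] H45[unfolded T_def] H45'[unfolded V_def]])
qed

end

text \<open>A form that does not vanish at the given point but on all of \<open>Z\<close>.\<close>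

lemma zariski_cutoff:
  fixes v :: "'k::field^'n::finite"
  assumes "zariski_closed Z" "line v \<notin> Z" "v \<noteq> 0"
  shows "\<exists>f d. homogeneous d f \<and> peval f v \<noteq> 0 \<and> (\<forall>x. x \<noteq> 0 \<longrightarrow> peval f x \<noteq> 0 \<longrightarrow> line x \<notin> Z)"
proof -
  from assms(1) obtain S where S: "\<forall>f\<in>S. \<exists>d. homogeneous d f"
    "Z = {line v |v. v \<noteq> 0 \<and> (\<forall>f\<in>S. peval f v = 0)}" unfolding zariski_closed_def by blast
  then obtain f where f: "f \<in> S" "peval f v \<noteq> 0" using assms(2,3) by blast
  then obtain d where d: "homogeneous d f" using S(1) by blast
  have "line x \<notin> Z" if "x \<noteq> 0" "peval f x \<noteq> 0" for x
  proof
    assume "line x \<in> Z"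
    then obtain u where u: "line x = line u" "peval f u = 0" using S(2) f(1) by blast
    from line_eqD[OF u(1) that(1)] obtain c where "x = c *s u" by blast
    then have "peval f x = 0" using u(2) by (simp add: peval_scale[OF d])
    then show False using that(2) by blast
  qed
  then show ?thesis using d f(2) by blast
qed

lemma line_image: "(\<lambda>v. M *v v) ` line w = line (M *v (w :: 'k::field^'m))"
  unfolding line_eq by (auto simp: vector_scalar_commute image_iff) (metis vector_scalar_commute)

lemma swap_line: "swap12 ` line x = line (swap12 x)" "swap45 ` line x = line (swap45 x)"
proof -
  have 1: "swap12 (c *s x) = c *s swap12 x" "swap45 (c *s x) = c *s swap45 x" for c
    by (simp_all add: vec_eq_5 swap12_def swap45_def vector_5)
  show "swap12 ` line x = line (swap12 x)" "swap45 ` line x = line (swap45 x)"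
    unfolding line_eq by (force simp: 1 image_iff)+
qed

lemma swap_swap: "swap12 (swap12 x) = x" "swap45 (swap45 x) = x" "swap12 (swap45 x) = swap45 (swap12 x)"
  by (simp_all add: vec_eq_5 swap12_def swap45_def vector_5)

lemma swap_nonzero: "x \<noteq> 0 \<Longrightarrow> swap12 x \<noteq> 0" "x \<noteq> 0 \<Longrightarrow> swap45 x \<noteq> 0"
  by (auto simp: vec_eq_5 swap12_def swap45_def vector_5)

context symmetric_cubic
begin

lemma F_scale: "peval F (c *s v) = c ^ 3 * peval F v"
proof -
  have "N (c * x) (c * T) (c * V) = c ^ 3 * N x T V" for x T V
    by (simp add: cubN_def power_mult_distrib algebra_simps power2_eq_square power3_eq_cube)
  from this[of "v $ 3" "v $ 4 + v $ 5" "v $ 4 - v $ 5"]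
  have "N (c * v $ 3) (c * v $ 4 + c * v $ 5) (c * v $ 4 - c * v $ 5) = c ^ 3 * N (v $ 3) (v $ 4 + v $ 5) (v $ 4 - v $ 5)"
    by (simp only: distrib_left right_diff_distrib)
  moreover have "c * v $ 1 * (c * v $ 2) * (c * v $ 3) = c ^ 3 * (v $ 1 * v $ 2 * v $ 3)"
    by (simp add: power3_eq_cube)
  ultimately show ?thesis unfolding F vector_smult_component by (simp only: distrib_left)
qed

lemma F_swap: "peval F (swap12 x) = peval F x" "peval F (swap45 x) = peval F x"
  unfolding F swap12_def swap45_def vector_5
  by (simp_all add: cubN_def power2_commute[of "x $ 5"] mult_ac add.commute)

lemma line_in_hypersurface:
  assumes "v \<noteq> 0" shows "line v \<in> hypersurface F \<longleftrightarrow> peval F v = 0"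
proof
  assume "line v \<in> hypersurface F"
  then obtain u where u: "line v = line u" "peval F u = 0" unfolding hypersurface_def by blast
  from line_eqD[OF u(1) assms] obtain c where "v = c *s u" by blast
  then show "peval F v = 0" using u(2) by (simp add: F_scale)
next
  assume "peval F v = 0"
  then show "line v \<in> hypersurface F" using assms unfolding hypersurface_def by blast
qed

lemma open_point:
  assumes f: "homogeneous d f" and v: "peval F v = 0" "peval f v \<noteq> 0"
  obtains T V A where "A \<noteq> 0" "Gam T V \<noteq> 0" "peval f (pt T V A) \<noteq> 0"
proof -
  note I = ring_morphism_id(1)[where 'a = 'k]
  note E3 = ring_morphismD[OF eval3_props(1)[OF I]]
  have ev: "eval3 (\<lambda>x. x) t v a (eval_in const3 (\<lambda>i. P3 $ i) f) = peval f (pt t v a)" for t v a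
    using eval3_eval_in[OF I, of t v a "\<lambda>i. i" f] by (simp add: peval_eval_in)
  have nz: "p \<noteq> 0" if "eval3 (\<lambda>x. x) t v a p \<noteq> 0" for p and t v a :: 'k
    using that E3(4) by auto
  obtain T V A where "A \<noteq> 0" "peval f (pt T V A) \<noteq> 0" using density[OF f _ v(1)] v(2) by blast
  then have "eval_in const3 (\<lambda>i. P3 $ i) f \<noteq> 0" using nz[of T V A] ev by metis
  moreover have "P3 $ 2 \<noteq> 0"
  proof -
    have "q \<noteq> 0" using c4_nonzero by (simp add: q_def)
    then obtain x where "poly q x \<noteq> 0" using poly_all_0_iff_0 by blast
    then have "pt x 0 1 $ 2 \<noteq> 0" unfolding gpt_nth gGam_def by (simp add: poly_via_id)
    then show ?thesis by (intro nz[of x 0 1]) (simp add: eval3_P3[OF I])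
  qed
  moreover have "P3 $ 3 \<noteq> 0"
    by (rule nz[of 0 0 1]) (simp add: eval3_P3[OF I] gpt_nth)
  ultimately have "eval_in const3 (\<lambda>i. P3 $ i) f * (P3 $ 2 * P3 $ 3) \<noteq> 0" by simp
  then obtain t v a where "eval3 (\<lambda>x. x) t v a (eval_in const3 (\<lambda>i. P3 $ i) f * (P3 $ 2 * P3 $ 3)) \<noteq> 0"
    using eval3_separates by blast
  then have "peval f (pt t v a) \<noteq> 0" "pt t v a $ 2 \<noteq> 0" "pt t v a $ 3 \<noteq> 0"
    unfolding E3 ev eval3_P3[OF I] by auto
  then show ?thesis using that[of a t v] by (simp add: gpt_nth)
qed

text \<open>The forms \<open>g\<close>, \<open>h\<close> and the cutoff \<open>f0\<close> come from the definitions of regular maps and of open sets,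
  applied at one point of \<open>U\<close> that \<open>open_point\<close> provides in sufficiently general position, and at its image in \<open>W\<close>.\<close>

lemma no_equivariant_model:
  fixes A B :: "'k^'m::finite^'m" and U :: "('k^5) set set" and W :: "('k^'m) set set"
  assumes U: "zariski_open_in (hypersurface F) U" "U \<noteq> {}"
    and W: "zariski_open_in proj_space W" and \<phi>: "biregular U W \<phi>"
    and AB: "A ** A = mat 1" "B ** B = mat 1" "A ** B = B ** A"
    and eqA: "\<And>x. x \<noteq> 0 \<Longrightarrow> line x \<in> U \<Longrightarrow> line (swap12 x) \<in> U \<Longrightarrow> \<phi> (line (swap12 x)) = (\<lambda>v. A *v v) ` \<phi> (line x)"
    and eqB: "\<And>x. x \<noteq> 0 \<Longrightarrow> line x \<in> U \<Longrightarrow> line (swap45 x) \<in> U \<Longrightarrow> \<phi> (line (swap45 x)) = (\<lambda>v. B *v v) ` \<phi> (line x)"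
  shows False
proof -
  have bij: "bij_betw \<phi> U W" and reg: "regular_on U \<phi>" and reg': "regular_on W (inv_into U \<phi>)"
    using \<phi> unfolding biregular_def by blast+
  obtain ZU where ZU: "zariski_closed ZU" "U = hypersurface F - ZU" using U(1) unfolding zariski_open_in_def by blast
  obtain ZW where ZW: "zariski_closed ZW" "W = proj_space - ZW" using W unfolding zariski_open_in_def by blast
  obtain p where "p \<in> U" using U(2) by blast
  then obtain v where v: "v \<noteq> 0" "peval F v = 0" "line v \<notin> ZU" unfolding ZU(2) hypersurface_def by blast
  from zariski_cutoff[OF ZU(1) v(3,1)] obtain f0 d0 where
    "homogeneous d0 f0 \<and> peval f0 v \<noteq> 0 \<and> (\<forall>x. x \<noteq> 0 \<longrightarrow> peval f0 x \<noteq> 0 \<longrightarrow> line x \<notin> ZU)"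
    by (elim exE)
  then have f0: "homogeneous d0 f0" "peval f0 v \<noteq> 0"
    "\<And>x. x \<noteq> 0 \<Longrightarrow> peval f0 x \<noteq> 0 \<Longrightarrow> line x \<notin> ZU" by simp_all
  have memU: "line x \<in> U" if "x \<noteq> 0" "peval F x = 0" "peval f0 x \<noteq> 0" for x
    using f0(3)[OF that(1,3)] that line_in_hypersurface unfolding ZU(2) by blast
  obtain T0 V0 A0 where pt0: "A0 \<noteq> 0" "Gam T0 V0 \<noteq> 0" "peval f0 (pt T0 V0 A0) \<noteq> 0"
    by (rule open_point[OF f0(1) v(2) f0(2)])
  define v0 where "v0 = pt T0 V0 A0"
  have v0: "v0 \<noteq> 0" "peval F v0 = 0" "v0 $ 1 \<noteq> 0" "v0 $ 3 \<noteq> 0"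
  proof -
    show 3: "v0 $ 3 \<noteq> 0" and "v0 $ 1 \<noteq> 0" using pt0(1) by (simp_all add: v0_def gpt_nth)
    show "v0 \<noteq> 0" using 3 by auto
    show "peval F v0 = 0" unfolding v0_def by (rule pt_on)
  qed
  have v0U: "line v0 \<in> U" using memU v0 pt0(3) unfolding v0_def by blast
  from reg[unfolded regular_on_def, rule_format, OF conjI[OF v0(1) v0U]]
  obtain d g where g': "(\<forall>i. homogeneous d (g i)) \<and> peval_map g v0 \<noteq> 0 \<and>
    (\<forall>x. x \<noteq> 0 \<and> line x \<in> U \<and> peval_map g x \<noteq> 0 \<longrightarrow> \<phi> (line x) = line (peval_map g x))"
    by (elim exE)
  then have g: "\<And>i. homogeneous d (g i)" "peval_map g v0 \<noteq> 0"
    "\<And>x. x \<noteq> 0 \<Longrightarrow> line x \<in> U \<Longrightarrow> peval_map g x \<noteq> 0 \<Longrightarrow> \<phi> (line x) = line (peval_map g x)"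
    by simp_all
  define w0 where "w0 = peval_map g v0"
  have w0: "w0 \<noteq> 0" "\<phi> (line v0) = line w0" using g(2) g(3)[OF v0(1) v0U g(2)] by (auto simp: w0_def)
  have w0W: "line w0 \<in> W" using bij_betwE[OF bij] v0U w0(2) by metis
  then have w0Z: "line w0 \<notin> ZW" using ZW(2) by blast
  from zariski_cutoff[OF ZW(1) w0Z w0(1)] obtain f1 d1 where
    "homogeneous d1 f1 \<and> peval f1 w0 \<noteq> 0 \<and> (\<forall>x. x \<noteq> 0 \<longrightarrow> peval f1 x \<noteq> 0 \<longrightarrow> line x \<notin> ZW)"
    by (elim exE)
  then have f1: "peval f1 w0 \<noteq> 0"
    "\<And>x. x \<noteq> 0 \<Longrightarrow> peval f1 x \<noteq> 0 \<Longrightarrow> line x \<notin> ZW" by simp_all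
  have memW: "line x \<in> W" if "x \<noteq> 0" "peval f1 x \<noteq> 0" for x
    using f1(2)[OF that] that(1) unfolding ZW(2) proj_space_def by blast
  from reg'[unfolded regular_on_def, rule_format, OF conjI[OF w0(1) w0W]]
  obtain e h where h': "(\<forall>n. homogeneous e (h n)) \<and> peval_map h w0 \<noteq> 0 \<and>
    (\<forall>w. w \<noteq> 0 \<and> line w \<in> W \<and> peval_map h w \<noteq> 0 \<longrightarrow> inv_into U \<phi> (line w) = line (peval_map h w))"
    by (elim exE)
  then have h: "\<And>n. homogeneous e (h n)" "peval_map h w0 \<noteq> 0"
    "\<And>w. w \<noteq> 0 \<Longrightarrow> line w \<in> W \<Longrightarrow> peval_map h w \<noteq> 0 \<Longrightarrow> inv_into U \<phi> (line w) = line (peval_map h w)"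
    by simp_all
  have inv1: "inv_into U \<phi> (\<phi> p) = p" if "p \<in> U" for p using bij_betw_inv_into_left[OF bij that] .
  have inv2: "\<phi> (inv_into U \<phi> p) = p" "inv_into U \<phi> p \<in> U" if "p \<in> W" for p
    using bij_betw_inv_into_right[OF bij that] bij_betwE[OF bij_betw_inv_into[OF bij]] that by blast+
  have "line (peval_map h w0) = line v0"
    using h(3)[OF w0(1) w0W h(2)] inv1[OF v0U] w0(2) by simp
  then obtain \<mu> where \<mu>: "\<mu> \<noteq> 0" "peval_map h w0 = \<mu> *s v0" using line_eqD h(2) by metis
  have propor: "x $ i * y $ j = x $ j * y $ i" if "line x = line y" "x \<noteq> 0" for x y :: "'k^'n" and i j
  proof -
    from line_eqD[OF that] obtain c where "x = c *s y" by blast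
    then show ?thesis by (simp add: mult_ac)
  qed
  have inv: "peval (h m) (peval_map g x) * x $ n = peval (h n) (peval_map g x) * x $ m"
    if x: "x \<noteq> 0" "peval F x = 0" "peval f0 x \<noteq> 0" "peval_map g x \<noteq> 0" for x m n
  proof (cases "peval_map h (peval_map g x) = 0")
    case True
    then have "peval (h i) (peval_map g x) = 0" for i by (simp add: peval_map_def vec_eq_iff)
    then show ?thesis by simp
  next
    case False
    have xU: "line x \<in> U" using memU x by blast
    note gx = g(3)[OF x(1) xU x(4)]
    have "line (peval_map g x) \<in> W" using bij_betwE[OF bij] xU gx by metis
    then have "line (peval_map h (peval_map g x)) = line x"
      using h(3)[OF x(4) _ False] inv1[OF xU] gx by simp
    from propor[OF this False, of m n] show ?thesis by (simp add: peval_map_def)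
  qed
  have near: "peval F (peval_map h w) = 0 \<and>
      (\<forall>i j. peval (g i) (peval_map h w) * w $ j = peval (g j) (peval_map h w) * w $ i)"
    if w: "w \<noteq> 0" "peval f1 w \<noteq> 0" "peval_map h w \<noteq> 0" for w
  proof -
    have wW: "line w \<in> W" using memW w by blast
    note hw = h(3)[OF w(1) wW w(3)]
    have hU: "line (peval_map h w) \<in> U" using inv2(2)[OF wW] hw by simp
    then have "peval F (peval_map h w) = 0" using line_in_hypersurface[OF w(3)] unfolding ZU(2) by blast
    moreover have "peval (g i) (peval_map h w) * w $ j = peval (g j) (peval_map h w) * w $ i" for i j
    proof (cases "peval_map g (peval_map h w) = 0")
      case True
      then have "peval (g i) (peval_map h w) = 0" for i by (simp add: peval_map_def vec_eq_iff)
      then show ?thesis by simp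
    next
      case False
      have "line (peval_map g (peval_map h w)) = line w"
        using g(3)[OF w(3) hU False] inv2(1)[OF wW] hw by simp
      from propor[OF this False, of i j] show ?thesis by (simp add: peval_map_def)
    qed
    ultimately show ?thesis by blast
  qed
  have card: "CARD('m) \<le> 4"
    by (rule dimension_bound[OF g(1) h(1) v0(3,4) _ _ \<mu>(1) _ near, of f1])
      (use w0 \<mu>(2) f1(1) in \<open>simp_all add: w0_def\<close>)
  from commuting_involutions_eigenbasis[OF AB]
  obtain a b :: "'m \<Rightarrow> 'k" and r :: "'m \<Rightarrow> 'k^'m" and c :: "'m \<Rightarrow> 'm \<Rightarrow> 'k" where
    "(\<forall>i. a i = 1 \<or> a i = -1) \<and> (\<forall>i. b i = 1 \<or> b i = -1) \<and>
    (\<forall>i x. (\<Sum>k\<in>UNIV. r i $ k * (A *v x) $ k) = a i * (\<Sum>k\<in>UNIV. r i $ k * x $ k)) \<and>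
    (\<forall>i x. (\<Sum>k\<in>UNIV. r i $ k * (B *v x) $ k) = b i * (\<Sum>k\<in>UNIV. r i $ k * x $ k)) \<and>
    (\<forall>n j. (\<Sum>i\<in>UNIV. c n i * r i $ j) = (if j = n then 1 else 0))"
    by (elim exE)
  then have r: "\<And>i. a i = 1 \<or> a i = -1" "\<And>i. b i = 1 \<or> b i = -1"
    "\<And>i x. (\<Sum>k\<in>UNIV. r i $ k * (A *v x) $ k) = a i * (\<Sum>k\<in>UNIV. r i $ k * x $ k)"
    "\<And>i x. (\<Sum>k\<in>UNIV. r i $ k * (B *v x) $ k) = b i * (\<Sum>k\<in>UNIV. r i $ k * x $ k)"
    "\<And>n j. (\<Sum>i\<in>UNIV. c n i * r i $ j) = (if j = n then 1 else 0)"
    by blast+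
  have eig: "(\<Sum>k\<in>UNIV. r i $ k * peval (g k) (s x)) * (u j * (\<Sum>k\<in>UNIV. r j $ k * peval (g k) x)) =
      (\<Sum>k\<in>UNIV. r j $ k * peval (g k) (s x)) * (u i * (\<Sum>k\<in>UNIV. r i $ k * peval (g k) x))"
    if x: "x \<noteq> 0" "s x \<noteq> 0" "line x \<in> U" "line (s x) \<in> U"
      and eq: "\<phi> (line (s x)) = (\<lambda>v. M *v v) ` \<phi> (line x)"
      and u: "\<And>i x. (\<Sum>k\<in>UNIV. r i $ k * (M *v x) $ k) = u i * (\<Sum>k\<in>UNIV. r i $ k * x $ k)"
    for x i j u and s :: "'k^5 \<Rightarrow> 'k^5" and M :: "'k^'m^'m"
  proof -
    have G: "(\<Sum>k\<in>UNIV. r i $ k * peval (g k) y) = (\<Sum>k\<in>UNIV. r i $ k * peval_map g y $ k)" for i y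
      by (simp add: peval_map_def)
    show ?thesis
    proof (cases "peval_map g x = 0 \<or> peval_map g (s x) = 0")
      case True
      then show ?thesis unfolding G by auto
    next
      case False
      have "line (peval_map g (s x)) = line (M *v peval_map g x)"
        using eq g(3)[OF x(1,3)] g(3)[OF x(2,4)] False by (simp add: line_image)
      then obtain m where "peval_map g (s x) = m *s (M *v peval_map g x)" using line_eqD False by metis
      then have "(\<Sum>k\<in>UNIV. r i $ k * peval_map g (s x) $ k) = m * (\<Sum>k\<in>UNIV. r i $ k * (M *v peval_map g x) $ k)" for i
        by (simp add: sum_distrib_left mult_ac)
      then show ?thesis unfolding G u by (simp add: mult_ac)
    qed
  qed
  have eq12: "(\<Sum>k\<in>UNIV. r i $ k * peval (g k) (swap12 x)) * (a j * (\<Sum>k\<in>UNIV. r j $ k * peval (g k) x)) =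
      (\<Sum>k\<in>UNIV. r j $ k * peval (g k) (swap12 x)) * (a i * (\<Sum>k\<in>UNIV. r i $ k * peval (g k) x))"
    if x: "x \<noteq> 0" "peval F x = 0" "peval f0 x \<noteq> 0" "peval f0 (swap12 x) \<noteq> 0" for x i j
  proof -
    have m: "line x \<in> U" "line (swap12 x) \<in> U" using memU x swap_nonzero(1)[OF x(1)] F_swap(1)[of x] by auto
    show ?thesis by (rule eig[of x swap12 A a i j, OF x(1) swap_nonzero(1)[OF x(1)] m eqA[OF x(1) m] r(3)])
  qed
  have eq45: "(\<Sum>k\<in>UNIV. r i $ k * peval (g k) (swap45 x)) * (b j * (\<Sum>k\<in>UNIV. r j $ k * peval (g k) x)) =
      (\<Sum>k\<in>UNIV. r j $ k * peval (g k) (swap45 x)) * (b i * (\<Sum>k\<in>UNIV. r i $ k * peval (g k) x))"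
    if x: "x \<noteq> 0" "peval F x = 0" "peval f0 x \<noteq> 0" "peval f0 (swap45 x) \<noteq> 0" for x i j
  proof -
    have m: "line x \<in> U" "line (swap45 x) \<in> U" using memU x swap_nonzero(2)[OF x(1)] F_swap(2)[of x] by auto
    show ?thesis by (rule eig[of x swap45 B b i j, OF x(1) swap_nonzero(2)[OF x(1)] m eqB[OF x(1) m] r(4)])
  qed
  define \<iota> :: "'k \<Rightarrow> 'k fls alg_closure" where "\<iota> = (\<lambda>x. to_ac (fls_const x))"
  have \<iota>: "ring_morphism \<iota>" 
    unfolding \<iota>_def by (rule ring_morphism_comp[OF _ ring_morphism_fls_const]) (simp add: ring_morphism_def)
  have t: "to_ac fls_X \<notin> range \<iota>"
  proof
    assume "to_ac fls_X \<in> range \<iota>"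
    then obtain x where "to_ac (fls_X - fls_const x :: 'k fls) = 0" by (auto simp: \<iota>_def)
    then have "(fls_X :: 'k fls) = fls_const x" by simp
    then have "fls_subdegree (fls_X :: 'k fls) = fls_subdegree (fls_const x)" by simp
    then show False by simp
  qed
  show False
    by (rule no_equivariant_forms[OF \<iota> t card f0(1) g(1) h(1) pt0 _ _ inv r(1,2,5) eq12 eq45])
      (use g(2) h(2) in \<open>simp_all add: v0_def w0_def\<close>)
qed

end

section \<open>The theorem\<close>

lemma ternary_cubic_expansion:
  fixes f :: "(5, 'k::comm_ring_1) mpoly"
  assumes "homogeneous 3 f" and "in_variables {3, 4, 5} f"
  shows "\<exists>K. \<forall>v. peval f v = (\<Sum>i\<le>3. \<Sum>j\<le>3 - i. K i j * (v $ 3 ^ i * v $ 4 ^ j * v $ 5 ^ (3 - i - j)))"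
proof -
  define mon where "mon i j = Poly_Mapping.single (3::5) i + Poly_Mapping.single 4 j + Poly_Mapping.single 5 (3 - i - j)" for i j :: nat
  define K where "K i j = Poly_Mapping.lookup f (mon i j)" for i j
  have lm: "Poly_Mapping.lookup (mon i j) 1 = 0" "Poly_Mapping.lookup (mon i j) 2 = 0"
    "Poly_Mapping.lookup (mon i j) 3 = i" "Poly_Mapping.lookup (mon i j) 4 = j"
    "Poly_Mapping.lookup (mon i j) 5 = 3 - i - j" for i j
    by (simp_all add: mon_def lookup_add lookup_single when_def)
  define S where "S = Sigma {..3::nat} (\<lambda>i. {..3 - i})"
  have inj: "inj_on (\<lambda>(i, j). mon i j) S"
    by (rule inj_onI) (auto dest: arg_cong[where f = "\<lambda>m. Poly_Mapping.lookup m 3"]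
      arg_cong[where f = "\<lambda>m. Poly_Mapping.lookup m 4"] simp: lm)
  have keys: "Poly_Mapping.keys f \<subseteq> (\<lambda>(i, j). mon i j) ` S"
  proof
    fix m assume m: "m \<in> Poly_Mapping.keys f"
    have sum: "(\<Sum>i\<in>UNIV. Poly_Mapping.lookup m i) = 3" using assms(1) m by (simp add: homogeneous_def)
    have "Poly_Mapping.keys m \<subseteq> {3, 4, 5}" using assms(2) m by (auto simp: in_variables_def)
    moreover have "(1::5) \<notin> {3, 4, 5}" "(2::5) \<notin> {3, 4, 5}" by simp_all
    ultimately have z: "Poly_Mapping.lookup m 1 = 0" "Poly_Mapping.lookup m 2 = 0"
      by (meson in_keys_iff subsetD)+
    have s: "Poly_Mapping.lookup m 3 + Poly_Mapping.lookup m 4 + Poly_Mapping.lookup m 5 = 3"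
      using sum z by (simp add: exhaust_5')
    have "m = mon (Poly_Mapping.lookup m 3) (Poly_Mapping.lookup m 4)"
    proof (rule poly_mapping_eqI)
      fix i :: 5
      have "i \<in> {1, 2, 3, 4, 5}" using UNIV_5 by blast
      then show "Poly_Mapping.lookup m i = Poly_Mapping.lookup (mon (Poly_Mapping.lookup m 3) (Poly_Mapping.lookup m 4)) i"
        using s z lm by (elim insertE emptyE) simp_all
    qed
    then show "m \<in> (\<lambda>(i, j). mon i j) ` S"
      using s by (intro image_eqI[of _ _ "(Poly_Mapping.lookup m 3, Poly_Mapping.lookup m 4)"]) (auto simp: S_def)
  qed
  have "peval f v = (\<Sum>i\<le>3. \<Sum>j\<le>3 - i. K i j * (v $ 3 ^ i * v $ 4 ^ j * v $ 5 ^ (3 - i - j)))" for v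
  proof -
    have "peval f v = (\<Sum>m\<in>(\<lambda>(i, j). mon i j) ` S. Poly_Mapping.lookup f m * (\<Prod>i\<in>UNIV. v $ i ^ Poly_Mapping.lookup m i))"
      unfolding peval_eval_in by (rule eval_in_superset[OF _ keys]) (simp_all add: S_def)
    also have "\<dots> = (\<Sum>(i, j)\<in>S. K i j * (v $ 3 ^ i * v $ 4 ^ j * v $ 5 ^ (3 - i - j)))"
      unfolding sum.reindex[OF inj] by (rule sum.cong) (auto simp: K_def exhaust_5' lm)
    also have "\<dots> = (\<Sum>i\<le>3. \<Sum>j\<le>3 - i. K i j * (v $ 3 ^ i * v $ 4 ^ j * v $ 5 ^ (3 - i - j)))"
      unfolding S_def by (subst sum.Sigma[symmetric]) auto
    finally show ?thesis .
  qed
  then show ?thesis by (intro exI[of _ K] allI)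
qed

lemma peval_cubic_form:
  "peval (cubic_form_2D4 f3) v = v $ 1 * v $ 2 * v $ 3 + peval f3 v"
proof -
  let ?m = "Poly_Mapping.single 1 1 + Poly_Mapping.single 2 1 + Poly_Mapping.single 3 1 :: 5 \<Rightarrow>\<^sub>0 nat"
  have "Var 1 * Var 2 * Var 3 = (Poly_Mapping.single ?m 1 :: (5, 'a) mpoly)"
    by (simp add: Var_def mult_single)
  moreover have "(\<Prod>i\<in>UNIV. v $ i ^ Poly_Mapping.lookup ?m i) = v $ 1 * v $ 2 * v $ 3"
    by (simp add: exhaust_5' lookup_add lookup_single when_def)
  ultimately show ?thesis
    unfolding cubic_form_2D4_def peval_eval_in eval_in_add[OF ring_morphism_id(1)]
    by (simp add: eval_in_single[OF ring_morphism_id(1)])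
qed

text \<open>The antisymmetric part of the form vanishes at \<open>(1, y, z)\<close> for all \<open>y\<close> and \<open>z\<close>; four values suffice to kill
  its four coefficients. The remaining coefficients are rewritten in terms of \<open>y + z\<close> and \<open>y - z\<close>.\<close>

lemma symmetric_ternary_cubic:
  fixes f3 :: "(5, 'k::field_char_0) mpoly"
  assumes "homogeneous 3 f3" "in_variables {3, 4, 5} f3"
    and sym: "\<And>y z. peval f3 (vector [0, 0, 1, y, z]) = peval f3 (vector [0, 0, 1, z, y])"
  shows "\<exists>c0 c1 c2 c3 c4 c5. \<forall>v. peval f3 v = cubN c0 c1 c2 c3 c4 c5 (v $ 3) (v $ 4 + v $ 5) (v $ 4 - v $ 5)"
proof -
  from ternary_cubic_expansion[OF assms(1,2)] obtain K where
    K: "\<forall>v. peval f3 v = (\<Sum>i\<le>3. \<Sum>j\<le>3 - i. K i j * (v $ 3 ^ i * v $ 4 ^ j * v $ 5 ^ (3 - i - j)))"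
    by (elim exE)
  define p where "p x y z = K 0 0 * z ^ 3 + K 0 1 * (y * z ^ 2) + K 0 2 * (y ^ 2 * z) + K 0 3 * y ^ 3 +
    (K 1 0 * (x * z ^ 2) + K 1 1 * (x * y * z) + K 1 2 * (x * y ^ 2)) + (K 2 0 * (x ^ 2 * z) + K 2 1 * (x ^ 2 * y)) +
    K 3 0 * x ^ 3" for x y z
  have p: "peval f3 v = p (v $ 3) (v $ 4) (v $ 5)" for v
    unfolding K[rule_format] p_def
    by (simp add: numeral_3_eq_3 numeral_2_eq_2)
  have s: "p 1 y z = p 1 z y" for y z using sym[of y z] unfolding p vector_5 .
  define d1 d2 d3 e where "d1 = K 2 1 - K 2 0" and "d2 = K 1 2 - K 1 0" and "d3 = K 0 3 - K 0 0" and "e = K 0 2 - K 0 1"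
  have D: "d3 * (y ^ 3 - z ^ 3) + e * (y ^ 2 * z - y * z ^ 2) + d2 * (y ^ 2 - z ^ 2) + d1 * (y - z) = p 1 y z - p 1 z y" for y z
    unfolding p_def d1_def d2_def d3_def e_def by (simp add: algebra_simps)
  have 1: "d3 + d2 + d1 = 0" using D[of 1 0] s[of 1 0] by simp
  have 2: "- d3 + d2 - d1 = 0" using D[of "-1" 0] s[of "-1" 0] by simp
  have 3: "8 * d3 + 4 * d2 + 2 * d1 = 0" using D[of 2 0] s[of 2 0] by (simp add: mult.commute)
  have 4: "7 * d3 + 2 * e + 3 * d2 + d1 = 0" using D[of 2 1] s[of 2 1] by (simp add: mult.commute)
  have "2 * d2 = (d3 + d2 + d1) + (- d3 + d2 - d1)" by simp
  then have d2: "d2 = 0" unfolding 1 2 by simp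
  have "6 * d3 = (8 * d3 + 4 * d2 + 2 * d1) - 2 * (d3 + d2 + d1)" unfolding d2 by (simp add: algebra_simps)
  then have d3: "d3 = 0" unfolding 1 3 by simp
  have d1: "d1 = 0" using 1 d2 d3 by simp
  have e: "e = 0" using 4 d1 d2 d3 by simp
  have eqs: "K 2 1 = K 2 0" "K 1 2 = K 1 0" "K 0 3 = K 0 0" "K 0 2 = K 0 1"
    using d1 d2 d3 e by (simp_all add: d1_def d2_def d3_def e_def)
  define k1 k2 k3 k4 where "k1 = K 1 0 / 4" and "k2 = K 1 1 / 4" and "k3 = K 0 0 / 4" and "k4 = K 0 1 / 4"
  have k: "K 1 0 = 4 * k1" "K 1 1 = 4 * k2" "K 0 0 = 4 * k3" "K 0 1 = 4 * k4"
    by (simp_all add: k1_def k2_def k3_def k4_def)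
  have "p x y z = cubN (K 3 0) (K 2 0) (2 * k1 + k2) (2 * k1 - k2) (k3 + k4) (3 * k3 - k4) x (y + z) (y - z)" for x y z
    unfolding p_def eqs k cubN_def by (simp add: algebra_simps power2_eq_square power3_eq_cube)
  then have "\<forall>v. peval f3 v = cubN (K 3 0) (K 2 0) (2 * k1 + k2) (2 * k1 - k2) (k3 + k4) (3 * k3 - k4) (v $ 3) (v $ 4 + v $ 5) (v $ 4 - v $ 5)"
    unfolding p by blast
  then show ?thesis by (intro exI)
qed

lemma Aut_mult:
  assumes "f \<in> carrier (Aut X)" "g \<in> carrier (Aut X)"
  shows "f \<otimes>\<^bsub>Aut X\<^esub> g = compose X f g"
  using assms by (simp add: Aut_def BijGroup_def)

theorem proposition5p16:
  fixes f3 :: "(5, 'k::{alg_closed_field, field_char_0}) mpoly"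
    and X :: "('k^5) set set"
    and G :: "(('k^5) set \<Rightarrow> ('k^5) set) set"
  assumes "uncountable (UNIV :: 'k set)"
    and "homogeneous 3 f3" and "in_variables {3, 4, 5} f3"
    and "X = hypersurface (cubic_form_2D4 f3)"
    and "has_2D4_singularities (cubic_form_2D4 f3)"
    and "induced_on X swap12 \<in> carrier (Aut X)" and "induced_on X swap45 \<in> carrier (Aut X)"
    and "subgroup G (Aut X)" and "finite G"
    and "generate (Aut X) {induced_on X swap12, induced_on X swap45} \<subseteq> G"
  shows "\<not> linearizable TYPE('m::finite) X G"
proof
  assume lin: "linearizable TYPE('m) X G"
  let ?F = "cubic_form_2D4 f3"
  define \<sigma> \<tau> where "\<sigma> = induced_on X swap12" and "\<tau> = induced_on X swap45"
  have aut: "\<sigma> \<in> carrier (Aut X)" "\<tau> \<in> carrier (Aut X)" using assms(6,7) by (simp_all add: \<sigma>_def \<tau>_def)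
  have maps: "f p \<in> X" if "f \<in> carrier (Aut X)" "p \<in> X" for f p
  proof -
    have "bij_betw f X X" using that(1) by (simp add: Aut_def Bij_def)
    then show ?thesis using that(2) bij_betwE by blast
  qed
  have \<sigma>: "\<sigma> (line x) = line (swap12 x)" and \<tau>: "\<tau> (line x) = line (swap45 x)" if "line x \<in> X" for x
    using that by (simp_all add: \<sigma>_def \<tau>_def induced_on_def swap_line)
  have f3_scale: "peval ?F (c *s v) = c ^ 3 * peval ?F v" for c v
    unfolding peval_cubic_form peval_scale[OF assms(2)] by (simp add: power3_eq_cube algebra_simps)
  have on: "peval ?F v = 0" if "line v \<in> X" "v \<noteq> 0" for v
  proof -
    from that(1) obtain u where u: "line v = line u" "peval ?F u = 0" unfolding assms(4) hypersurface_def by blast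
    from line_eqD[OF u(1) that(2)] obtain c where "v = c *s u" by blast
    then show ?thesis using u(2) by (simp add: f3_scale)
  qed
  have indep: "peval f3 v = peval f3 (vector [0, 0, v $ 3, v $ 4, v $ 5])" for v
  proof -
    from ternary_cubic_expansion[OF assms(2,3)] obtain K where
      "\<forall>v. peval f3 v = (\<Sum>i\<le>3. \<Sum>j\<le>3 - i. K i j * (v $ 3 ^ i * v $ 4 ^ j * v $ 5 ^ (3 - i - j)))"
      by (elim exE)
    note K = this[rule_format]
    show ?thesis unfolding K[of v] K[of "vector [0, 0, v $ 3, v $ 4, v $ 5]"] vector_5 ..
  qed
  \<comment> \<open>Any \<open>(1, y, z)\<close> extends to a point of \<open>X\<close> with \<open>x\<^sub>2 = 1\<close>; its image under the swap must lie on \<open>X\<close> again.\<close>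
  have sym: "peval f3 (vector [0, 0, 1, y, z]) = peval f3 (vector [0, 0, 1, z, y])" for y z
  proof -
    let ?v = "vector [- peval f3 (vector [0, 0, 1, y, z]), 1, 1, y, z] :: 'k^5"
    have v0: "?v \<noteq> 0" by (simp add: vec_eq_5 vector_5)
    have "peval ?F ?v = 0" unfolding peval_cubic_form indep[of ?v] vector_5 by simp
    then have lv: "line ?v \<in> X" using v0 unfolding assms(4) hypersurface_def by blast
    have "line (swap45 ?v) \<in> X" using maps[OF aut(2) lv] \<tau>[OF lv] by simp
    then have "peval ?F (swap45 ?v) = 0" using on swap_nonzero(2)[OF v0] by blast
    moreover have "peval ?F (swap45 ?v) = peval f3 (swap45 ?v) - peval f3 (vector [0, 0, 1, y, z])"
      unfolding peval_cubic_form by (simp add: swap45_def vector_5)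
    moreover have "peval f3 (swap45 ?v) = peval f3 (vector [0, 0, 1, z, y])"
      unfolding indep[of "swap45 ?v"] by (simp add: swap45_def vector_5)
    ultimately show ?thesis by simp
  qed
  from symmetric_ternary_cubic[OF assms(2,3) sym] obtain c0 c1 c2 c3 c4 c5 where
    f3: "\<forall>v. peval f3 v = cubN c0 c1 c2 c3 c4 c5 (v $ 3) (v $ 4 + v $ 5) (v $ 4 - v $ 5)"
    by (elim exE)
  interpret symmetric_cubic ?F c0 c1 c2 c3 c4 c5
  proof
    show "peval ?F v = v $ 1 * v $ 2 * v $ 3 + cubN c0 c1 c2 c3 c4 c5 (v $ 3) (v $ 4 + v $ 5) (v $ 4 - v $ 5)" for v
      unfolding peval_cubic_form f3[rule_format] ..
    show "card (singular_locus ?F) = 2" using assms(5) unfolding has_2D4_singularities_def by (rule conjunct1)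
  qed
  from lin[unfolded linearizable_def] obtain \<rho> :: "_ \<Rightarrow> 'k^'m^'m" where
    lin': "\<rho> \<in> hom ((Aut X)\<lparr>carrier := G\<rparr>) GL \<and>
      equivariantly_birational G (\<lambda>g. g) X (\<lambda>g p. (\<lambda>v. \<rho> g *v v) ` p) proj_space"
    by (elim exE)
  from lin'[THEN conjunct2, unfolded equivariantly_birational_def] obtain U W \<phi> where
    bir: "zariski_open_in X U \<and> U \<noteq> {} \<and> zariski_open_in (proj_space :: ('k^'m) set set) W \<and> W \<noteq> {} \<and>
      biregular U W \<phi> \<and> (\<forall>g\<in>G. \<forall>p\<in>U. g p \<in> U \<longrightarrow> \<phi> (g p) = (\<lambda>v. \<rho> g *v v) ` \<phi> p)"
    by (elim exE)
  note \<rho> = lin'[THEN conjunct1]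
  have U: "zariski_open_in X U" "U \<noteq> {}" and W: "zariski_open_in (proj_space :: ('k^'m) set set) W"
    and \<phi>: "biregular U W \<phi>" using bir by simp_all
  have eq: "\<phi> (g p) = (\<lambda>v. \<rho> g *v v) ` \<phi> p" if "g \<in> G" "p \<in> U" "g p \<in> U" for g p
    using bir that by simp
  have inG: "\<sigma> \<in> G" "\<tau> \<in> G" 
    unfolding \<sigma>_def \<tau>_def by (rule subsetD[OF assms(10)], rule generate.incl, simp)+
  have mult: "\<rho> (f \<otimes>\<^bsub>Aut X\<^esub> g) = \<rho> f ** \<rho> g" and inv: "invertible (\<rho> f)" if "f \<in> G" "g \<in> G" for f g
  proof -
    have "\<rho> (f \<otimes>\<^bsub>(Aut X)\<lparr>carrier := G\<rparr>\<^esub> g) = \<rho> f \<otimes>\<^bsub>GL\<^esub> \<rho> g"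
      by (rule hom_mult[OF \<rho>]) (simp_all add: that)
    then show "\<rho> (f \<otimes>\<^bsub>Aut X\<^esub> g) = \<rho> f ** \<rho> g" by (simp add: GL_def)
    have "\<rho> f \<in> carrier GL" by (rule hom_in_carrier[OF \<rho>]) (simp add: that)
    then show "invertible (\<rho> f)" by (simp add: GL_def)
  qed
  have lines: "\<exists>x. p = line x \<and> x \<noteq> 0" if "p \<in> X" for p
    using that unfolding assms(4) hypersurface_def by blast
  define one where "one = (\<lambda>p\<in>X. p)"
  have comp: "compose X f g = h" if "h \<in> extensional X" "\<And>x. line x \<in> X \<Longrightarrow> f (g (line x)) = h (line x)" for f g h
  proof
    fix p
    show "compose X f g p = h p"
    proof (cases "p \<in> X")
      case True
      then show ?thesis using lines[OF True] that(2) by (auto simp: compose_def)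
    next
      case False
      then show ?thesis using that(1) by (simp add: compose_def extensional_def)
    qed
  qed
  have mem: "line (swap12 x) \<in> X" "line (swap45 x) \<in> X" if "line x \<in> X" for x
    using maps[OF aut(1) that] maps[OF aut(2) that] \<sigma>[OF that] \<tau>[OF that] by simp_all
  have one_ext: "one \<in> extensional X" by (simp add: one_def)
  have ss: "\<sigma> \<otimes>\<^bsub>Aut X\<^esub> \<sigma> = one"
    unfolding Aut_mult[OF aut(1) aut(1)] by (rule comp[OF one_ext]) (simp add: \<sigma> mem swap_swap one_def)
  have tt: "\<tau> \<otimes>\<^bsub>Aut X\<^esub> \<tau> = one"
    unfolding Aut_mult[OF aut(2) aut(2)] by (rule comp[OF one_ext]) (simp add: \<tau> mem swap_swap one_def)
  have st: "\<sigma> \<otimes>\<^bsub>Aut X\<^esub> \<tau> = \<tau> \<otimes>\<^bsub>Aut X\<^esub> \<sigma>"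
    unfolding Aut_mult[OF aut(1) aut(2)] Aut_mult[OF aut(2) aut(1)]
    by (rule comp) (simp_all add: \<sigma> \<tau> mem swap_swap compose_eq compose_extensional)
  have oneG: "one \<in> G" using subgroup.m_closed[OF assms(8) inG(1) inG(1)] ss by simp
  have oneC: "one \<in> carrier (Aut X)" using subgroup.subset[OF assms(8)] oneG by blast
  have oo: "one \<otimes>\<^bsub>Aut X\<^esub> one = one"
    unfolding Aut_mult[OF oneC oneC] by (rule comp[OF one_ext]) (simp add: one_def)
  have r1: "\<rho> one = mat 1"
  proof -
    obtain E where E: "E ** \<rho> one = mat 1" using inv[OF oneG oneG] unfolding invertible_def by blast
    have "\<rho> one ** \<rho> one = \<rho> one" using mult[OF oneG oneG] oo by simp
    then have "E ** \<rho> one = E ** (\<rho> one ** \<rho> one)" by simp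
    then show ?thesis unfolding matrix_mul_assoc E by simp
  qed
  have UX: "p \<in> X" if "p \<in> U" for p using U(1) that unfolding zariski_open_in_def by blast
  show False
  proof (rule no_equivariant_model[OF _ U(2) W \<phi>])
    show "zariski_open_in (hypersurface ?F) U" using U(1) assms(4) by simp
    show "\<rho> \<sigma> ** \<rho> \<sigma> = mat 1" using mult[OF inG(1,1)] ss r1 by simp
    show "\<rho> \<tau> ** \<rho> \<tau> = mat 1" using mult[OF inG(2,2)] tt r1 by simp
    show "\<rho> \<sigma> ** \<rho> \<tau> = \<rho> \<tau> ** \<rho> \<sigma>" using mult[OF inG(1,2)] mult[OF inG(2,1)] st by simp
    show "\<phi> (line (swap12 x)) = (*v) (\<rho> \<sigma>) ` \<phi> (line x)" if "line x \<in> U" "line (swap12 x) \<in> U" for x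
      using eq[OF inG(1) that(1)] that \<sigma>[OF UX[OF that(1)]] by simp
    show "\<phi> (line (swap45 x)) = (*v) (\<rho> \<tau>) ` \<phi> (line x)" if "line x \<in> U" "line (swap45 x) \<in> U" for x
      using eq[OF inG(2) that(1)] that \<tau>[OF UX[OF that(1)]] by simp
  qed
qed

end
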